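(* Let $G$ be an ADB-AC graph with a planar annular embedding having $x+y$ annuli, where the $x\ge 1$ innermost annuli $A_1,\dots,A_x$ are ring annuli and the following $y\ge 1$ annuli $A_{x+1},\dots,A_{x+y}$ are block annuli. Then $G$ is Hamiltonian.
   Context: A Barnette graph is a finite $3$-regular, $3$-connected, planar, bipartite graph. A Barnette graph $G$ is an $x$-annular decomposable Barnette graph ($x$-ADB graph) if it has a plane embedding (a planar annular embedding) with pairwise vertex-disjoint cycles $C_0,C_1,\dots,C_n$ of $G$, each $C_{k-1}$ lying in the bounded region of $C_k$, such that $C_0$ bounds a face, $C_n$ bounds the unbounded face, every vertex lies on some $C_k$, and every edge is either an edge of some $C_k$ or joins a vertex of $C_{k-1}$ to a vertex of $C_k$ for some $1\le k\le n$. The closed region between $C_{k-1}$ and $C_k$ is the $k$-th annulus $A_k$; edges joining $C_{k-1}$ to $C_k$ lie in the interior of $A_k$; the faces of $G$ inside $A_k$ are the faces of $A_k$; $A_n$ is the outer annulus. Suppressing degree-$2$ vertices means replacing each maximal path whose internal vertices have degree $2$ by a single edge (a cycle all of whose vertices have degree $2$ becomes a vertex-less closed curve). An ADB graph with $n>2$ annuli is annular connected (ADB-AC) if for every $k$, deleting the edges in the interior of $A_k$ and suppressing degree-$2$ vertices yields either two Barnette graphs or a Barnette graph and a vertex-less closed curve. For $1\le k<n$, the $k$-annular restriction $G_k$ is obtained from the subgraph consisting of $C_0,\dots,C_k$ and the edges in the interiors of $A_1,\dots,A_k$ by suppressing degree-$2$ vertices; its outer annulus $O(G_k)$ is its $k$-th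 annulus. The faces of an outer annulus are cyclically arranged, consecutive ones sharing an edge in the interior of the annulus; they split into two alternating classes of pairwise non-adjacent faces; for ADB-AC graphs one class consists only of $4$-cycles, called the $4$-cycle class. For $k\ge 3$, each edge in the interior of $A_k$ has its endpoint on $C_{k-1}$ lying on an edge of the outer boundary of $G_{k-1}$, belonging to a unique face of $O(G_{k-1})$; the edge is attached to that face. $A_k$ is a block annulus if the edges in its interior are attached to faces in the $4$-cycle class of $O(G_{k-1})$, and a ring annulus if they are attached to faces not in that class. By convention $A_1$ and $A_2$ are of the same type as $A_3$. *)

theory Defs
  imports "HOL-Analysis.Analysis"
begin

section \<open>Undirected multigraphs\<close>

text \<open>
  Suppressing vertices of degree 2 can create loops, parallel edges and closed curves without
  vertices, so one type is used for simple graphs, multigraphs and such curves: an edge \<open>e\<close> is a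
  loop if \<open>ends H e\<close> is a singleton, and a vertex-less closed curve if \<open>ends H e = {}\<close>.
\<close>

record ('v, 'e) mgraph =
  verts :: "'v set"
  edges :: "'e set"
  ends :: "'e \<Rightarrow> 'v set"

definition simple_graph :: "('v, 'e) mgraph \<Rightarrow> bool" where
  "simple_graph H \<longleftrightarrow>
     (\<forall>e\<in>edges H. ends H e \<subseteq> verts H \<and> card (ends H e) = 2) \<and> inj_on (ends H) (edges H)"

text \<open>A loop counts twice.\<close>

definition degree :: "('v, 'e) mgraph \<Rightarrow> 'v \<Rightarrow> nat" where
  "degree H v = card {e \<in> edges H. v \<in> ends H e} + card {e \<in> edges H. ends H e = {v}}"

definition connected_graph :: "('v, 'e) mgraph \<Rightarrow> bool" where
  "connected_graph H \<longleftrightarrow> verts H \<noteq> {} \<and>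
     (\<forall>u\<in>verts H. \<forall>v\<in>verts H. (u, v) \<in> {(a, b). \<exists>e\<in>edges H. ends H e = {a, b}}\<^sup>*)"

definition del_verts :: "('v, 'e) mgraph \<Rightarrow> 'v set \<Rightarrow> ('v, 'e) mgraph" where
  "del_verts H S = H\<lparr>verts := verts H - S, edges := {e \<in> edges H. ends H e \<inter> S = {}}\<rparr>"

definition del_edges :: "('v, 'e) mgraph \<Rightarrow> 'e set \<Rightarrow> ('v, 'e) mgraph" where
  "del_edges H F = H\<lparr>edges := edges H - F\<rparr>"

definition vertex_connected :: "nat \<Rightarrow> ('v, 'e) mgraph \<Rightarrow> bool" where
  "vertex_connected k H \<longleftrightarrow> k < card (verts H) \<and>
     (\<forall>S. S \<subseteq> verts H \<and> card S < k \<longrightarrow> connected_graph (del_verts H S))"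

definition bipartite :: "('v, 'e) mgraph \<Rightarrow> bool" where
  "bipartite H \<longleftrightarrow>
     (\<exists>A\<subseteq>verts H. \<forall>e\<in>edges H. \<exists>a\<in>A. \<exists>b\<in>verts H - A. ends H e = {a, b})"

text \<open>Cycles are represented by their edge sets.\<close>

definition is_cycle :: "('v, 'e) mgraph \<Rightarrow> 'e set \<Rightarrow> bool" where
  "is_cycle H D \<longleftrightarrow> D \<subseteq> edges H \<and>
     (\<exists>vs es. es \<noteq> [] \<and> length vs = length es \<and> distinct vs \<and> distinct es \<and> set es = D \<and>
       set vs \<subseteq> verts H \<and>
       (\<forall>i<length es. ends H (es ! i) = {vs ! i, vs ! (Suc i mod length es)}))"

definition cverts :: "('v, 'e) mgraph \<Rightarrow> 'e set \<Rightarrow> 'v set" where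
  "cverts H D = (\<Union>e\<in>D. ends H e)"

definition hamiltonian :: "('v, 'e) mgraph \<Rightarrow> bool" where
  "hamiltonian H \<longleftrightarrow> (\<exists>D. is_cycle H D \<and> cverts H D = verts H)"


section \<open>Plane embeddings and Barnette graphs\<close>

text \<open>
  A drawing places each vertex \<open>v\<close> at the point \<open>pos v\<close> and each edge \<open>e\<close> along the point set
  \<open>crv e\<close>, end points included.
\<close>

definition plane_embedding ::
  "('v, 'e) mgraph \<Rightarrow> ('v \<Rightarrow> complex) \<Rightarrow> ('e \<Rightarrow> complex set) \<Rightarrow> bool" where
  "plane_embedding H pos crv \<longleftrightarrow>
     inj_on pos (verts H) \<and>
     (\<forall>e\<in>edges H. \<exists>g. arc g \<and> path_image g = crv e \<and>
        {pathstart g, pathfinish g} = pos ` ends H e) \<and>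
     (\<forall>e\<in>edges H. crv e \<inter> pos ` verts H = pos ` ends H e) \<and>
     (\<forall>e\<in>edges H. \<forall>f\<in>edges H. e \<noteq> f \<longrightarrow> crv e \<inter> crv f = pos ` (ends H e \<inter> ends H f))"

definition planar :: "('v, 'e) mgraph \<Rightarrow> bool" where
  "planar H \<longleftrightarrow> (\<exists>pos crv. plane_embedding H pos crv)"

definition drawing ::
  "('v, 'e) mgraph \<Rightarrow> ('v \<Rightarrow> complex) \<Rightarrow> ('e \<Rightarrow> complex set) \<Rightarrow> complex set" where
  "drawing H pos crv = pos ` verts H \<union> (\<Union>e\<in>edges H. crv e)"

definition faces ::
  "('v, 'e) mgraph \<Rightarrow> ('v \<Rightarrow> complex) \<Rightarrow> ('e \<Rightarrow> complex set) \<Rightarrow> complex set set" where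
  "faces H pos crv = components (- drawing H pos crv)"

definition barnette :: "('v, 'e) mgraph \<Rightarrow> bool" where
  "barnette H \<longleftrightarrow> finite (verts H) \<and> finite (edges H) \<and> simple_graph H \<and>
     (\<forall>v\<in>verts H. degree H v = 3) \<and> vertex_connected 3 H \<and> planar H \<and> bipartite H"


section \<open>Suppressing vertices of degree 2\<close>

text \<open>
  An edge of the suppressed graph is the set of edges of a maximal path (or cycle) whose internal
  vertices have degree 2, that is, a class of the equivalence relation generated by sharing a
  vertex of degree 2. It is drawn along \<open>merged_curve crv X\<close>.
\<close>

definition joined_at_degree_2 :: "('v, 'e) mgraph \<Rightarrow> ('e \<times> 'e) set" where
  "joined_at_degree_2 H = {(e, f). e \<in> edges H \<and> f \<in> edges H \<and>
     (\<exists>v\<in>verts H. degree H v = 2 \<and> v \<in> ends H e \<and> v \<in> ends H f)}"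

definition suppress :: "('v, 'e) mgraph \<Rightarrow> ('v, 'e set) mgraph" where
  "suppress H =
     \<lparr>verts = {v \<in> verts H. degree H v \<noteq> 2},
      edges = edges H // (joined_at_degree_2 H)\<^sup>*,
      ends = (\<lambda>X. {v \<in> verts H. degree H v \<noteq> 2 \<and> (\<exists>e\<in>X. v \<in> ends H e)})\<rparr>"

definition merged_curve :: "('e \<Rightarrow> complex set) \<Rightarrow> 'e set \<Rightarrow> complex set" where
  "merged_curve crv X = (\<Union>e\<in>X. crv e)"

definition vertexless_curve :: "('v, 'e) mgraph \<Rightarrow> bool" where
  "vertexless_curve H \<longleftrightarrow> verts H = {} \<and> (\<exists>c. edges H = {c} \<and> ends H c = {})"

definition disjoint_union ::
  "('v, 'e) mgraph \<Rightarrow> ('v, 'e) mgraph \<Rightarrow> ('v, 'e) mgraph \<Rightarrow> bool" where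
  "disjoint_union H H1 H2 \<longleftrightarrow>
     verts H1 \<inter> verts H2 = {} \<and> verts H1 \<union> verts H2 = verts H \<and>
     edges H1 \<inter> edges H2 = {} \<and> edges H1 \<union> edges H2 = edges H \<and>
     ends H1 = ends H \<and> ends H2 = ends H"


section \<open>Annular decompositions\<close>

text \<open>
  \<open>C k\<close> is the edge set of the cycle \<open>C\<^sub>k\<close>, and \<open>merged_curve crv (C k)\<close> the closed curve along
  which it is drawn. \<open>rungs G C k\<close> are the edges joining \<open>C\<^sub>k\<^sub>-\<^sub>1\<close> to \<open>C\<^sub>k\<close>, i.e. the
  edges in the interior of the \<open>k\<close>-th annulus; only \<open>k \<ge> 1\<close> is meaningful.
\<close>

definition rungs :: "('v, 'e) mgraph \<Rightarrow> (nat \<Rightarrow> 'e set) \<Rightarrow> nat \<Rightarrow> 'e set" where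
  "rungs G C k =
     {e \<in> edges G. \<exists>u\<in>cverts G (C (k - 1)). \<exists>v\<in>cverts G (C k). ends G e = {u, v}}"

definition annulus :: "('e \<Rightarrow> complex set) \<Rightarrow> (nat \<Rightarrow> 'e set) \<Rightarrow> nat \<Rightarrow> complex set" where
  "annulus crv C k =
     (merged_curve crv (C k) \<union> inside (merged_curve crv (C k)))
       - inside (merged_curve crv (C (k - 1)))"

definition planar_annular_embedding ::
  "('v, 'e) mgraph \<Rightarrow> ('v \<Rightarrow> complex) \<Rightarrow> ('e \<Rightarrow> complex set) \<Rightarrow> (nat \<Rightarrow> 'e set) \<Rightarrow> nat \<Rightarrow> bool" where
  "planar_annular_embedding G pos crv C n \<longleftrightarrow>
     plane_embedding G pos crv \<and>
     (\<forall>k\<le>n. is_cycle G (C k)) \<and>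
     (\<forall>j\<le>n. \<forall>k\<le>n. j \<noteq> k \<longrightarrow> cverts G (C j) \<inter> cverts G (C k) = {}) \<and>
     (\<forall>k\<in>{1..n}. merged_curve crv (C (k - 1)) \<subseteq> inside (merged_curve crv (C k))) \<and>
     (\<exists>F\<in>faces G pos crv. frontier F = merged_curve crv (C 0)) \<and>
     (\<exists>F\<in>faces G pos crv. \<not> bounded F \<and> frontier F = merged_curve crv (C n)) \<and>
     verts G = (\<Union>k\<le>n. cverts G (C k)) \<and>
     edges G = (\<Union>k\<le>n. C k) \<union> (\<Union>k\<in>{1..n}. rungs G C k)"

definition adb_ac ::
  "('v, 'e) mgraph \<Rightarrow> ('v \<Rightarrow> complex) \<Rightarrow> ('e \<Rightarrow> complex set) \<Rightarrow> (nat \<Rightarrow> 'e set) \<Rightarrow> nat \<Rightarrow> bool" where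
  "adb_ac G pos crv C n \<longleftrightarrow>
     barnette G \<and> planar_annular_embedding G pos crv C n \<and> n > 2 \<and>
     (\<forall>k\<in>{1..n}. \<exists>H1 H2. disjoint_union (suppress (del_edges G (rungs G C k))) H1 H2 \<and>
        barnette H1 \<and> (barnette H2 \<or> vertexless_curve H2))"


section \<open>Ring annuli and block annuli\<close>

definition annular_restriction ::
  "('v, 'e) mgraph \<Rightarrow> (nat \<Rightarrow> 'e set) \<Rightarrow> nat \<Rightarrow> ('v, 'e set) mgraph" where
  "annular_restriction G C k = suppress
     (G\<lparr>verts := (\<Union>j\<le>k. cverts G (C j)),
        edges := (\<Union>j\<le>k. C j) \<union> (\<Union>j\<in>{1..k}. rungs G C j)\<rparr>)"

definition outer_faces ::
  "('v, 'e) mgraph \<Rightarrow> ('v \<Rightarrow> complex) \<Rightarrow> ('e \<Rightarrow> complex set) \<Rightarrow> (nat \<Rightarrow> 'e set) \<Rightarrow> nat \<Rightarrow>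
   complex set set" where
  "outer_faces G pos crv C k =
     {F \<in> faces (annular_restriction G C k) pos (merged_curve crv). F \<subseteq> annulus crv C k}"

definition adjacent_faces ::
  "('v, 'e) mgraph \<Rightarrow> ('e \<Rightarrow> complex set) \<Rightarrow> (nat \<Rightarrow> 'e set) \<Rightarrow> nat \<Rightarrow>
   complex set \<Rightarrow> complex set \<Rightarrow> bool" where
  "adjacent_faces G crv C k F F' \<longleftrightarrow> F \<noteq> F' \<and>
     (\<exists>e\<in>rungs G C k. crv e \<subseteq> frontier F \<and> crv e \<subseteq> frontier F')"

definition four_cycle_face ::
  "('v, 'e) mgraph \<Rightarrow> ('e \<Rightarrow> complex set) \<Rightarrow> (nat \<Rightarrow> 'e set) \<Rightarrow> nat \<Rightarrow> complex set \<Rightarrow> bool" where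
  "four_cycle_face G crv C k F \<longleftrightarrow>
     (\<exists>D. is_cycle (annular_restriction G C k) D \<and> card D = 4 \<and>
        frontier F = (\<Union>X\<in>D. merged_curve crv X))"

text \<open>
  As the faces of the outer annulus are cyclically adjacent, its two alternating classes are the
  only way of splitting its faces into two sets of pairwise non-adjacent ones. For \<open>k \<ge> 2\<close> at most
  one of the two classes consists of 4-cycles: some vertex of \<open>C\<^sub>k\<^sub>-\<^sub>1\<close> is joined to
  \<open>C\<^sub>k\<^sub>-\<^sub>2\<close> and lies on a longer face.
\<close>

definition four_cycle_class ::
  "('v, 'e) mgraph \<Rightarrow> ('v \<Rightarrow> complex) \<Rightarrow> ('e \<Rightarrow> complex set) \<Rightarrow> (nat \<Rightarrow> 'e set) \<Rightarrow> nat \<Rightarrow>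
   complex set set \<Rightarrow> bool" where
  "four_cycle_class G pos crv C k P \<longleftrightarrow>
     P \<subseteq> outer_faces G pos crv C k \<and>
     (\<forall>F\<in>P. \<forall>F'\<in>P. \<not> adjacent_faces G crv C k F F') \<and>
     (\<forall>F\<in>outer_faces G pos crv C k - P. \<forall>F'\<in>outer_faces G pos crv C k - P.
        \<not> adjacent_faces G crv C k F F') \<and>
     (\<forall>F\<in>P. four_cycle_face G crv C k F)"

text \<open>
  The edge \<open>e\<close> in the interior of the \<open>k\<close>-th annulus is attached to the face \<open>F\<close> of
  the outer annulus of the \<open>(k-1)\<close>-annular restriction; \<open>X\<close> is the edge of the outer boundary on
  which the inner end of \<open>e\<close> lies.
\<close>

definition attached ::
  "('v, 'e) mgraph \<Rightarrow> ('v \<Rightarrow> complex) \<Rightarrow> ('e \<Rightarrow> complex set) \<Rightarrow> (nat \<Rightarrow> 'e set) \<Rightarrow> nat \<Rightarrow>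
   'e \<Rightarrow> complex set \<Rightarrow> bool" where
  "attached G pos crv C k e F \<longleftrightarrow>
     F \<in> outer_faces G pos crv C (k - 1) \<and>
     (\<exists>u\<in>ends G e \<inter> cverts G (C (k - 1)). \<exists>X\<in>edges (annular_restriction G C (k - 1)).
        X \<subseteq> C (k - 1) \<and> pos u \<in> merged_curve crv X \<and> merged_curve crv X \<subseteq> frontier F)"

text \<open>By convention the first two annuli are of the same type as the third, hence \<open>max k 3\<close>.\<close>

definition block_annulus ::
  "('v, 'e) mgraph \<Rightarrow> ('v \<Rightarrow> complex) \<Rightarrow> ('e \<Rightarrow> complex set) \<Rightarrow> (nat \<Rightarrow> 'e set) \<Rightarrow> nat \<Rightarrow> bool" where
  "block_annulus G pos crv C k \<longleftrightarrow> (let m = max k 3 in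
     \<exists>P. four_cycle_class G pos crv C (m - 1) P \<and>
       (\<forall>e\<in>rungs G C m. \<exists>F\<in>P. attached G pos crv C m e F))"

definition ring_annulus ::
  "('v, 'e) mgraph \<Rightarrow> ('v \<Rightarrow> complex) \<Rightarrow> ('e \<Rightarrow> complex set) \<Rightarrow> (nat \<Rightarrow> 'e set) \<Rightarrow> nat \<Rightarrow> bool" where
  "ring_annulus G pos crv C k \<longleftrightarrow> (let m = max k 3 in
     \<exists>P. four_cycle_class G pos crv C (m - 1) P \<and>
       (\<forall>e\<in>rungs G C m. \<exists>F\<in>outer_faces G pos crv C (m - 1) - P. attached G pos crv C m e F))"

end

theory Submission
  imports Defs
begin

text \<open>
  Every vertex of \<open>C k\<close> has one further edge, which leads either inwards to \<open>C (k - 1)\<close> or outwards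
  to \<open>C (k + 1)\<close>. By induction on \<open>k\<close> one builds a circuit through all vertices of
  \<open>C 0, \<dots>, C k\<close> that uses every edge of \<open>C k\<close> joining two outward vertices.
  Planarity (through theta curves) shows that two rungs which are consecutive on \<open>C k\<close> are
  consecutive on \<open>C (k - 1)\<close>, so the segments of \<open>C k\<close> between consecutive inward vertices
  correspond to the faces of the outer annulus of the restriction. Alternate segments bound faces of
  the 4-cycle class, and the feet of the two rungs at such a segment are joined by an edge of
  \<open>C (k - 1)\<close>, which the circuit uses.

  If the next annulus is a block annulus, the segments of the 4-cycle class cover all of \<open>C k\<close>, and
  replacing each of these edges by its two rungs and the segment extends the circuit. If it is a ring
  annulus, such a segment is a single edge, and \<open>C k\<close> is merged with the circuit along one 4-cycle
  consisting of that edge, two rungs and the edge joining their feet. \<open>C 1\<close> and \<open>C n\<close> are merged in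
  the same way; that suitable 4-cycles exist there follows from bipartiteness.
\<close>

section \<open>Arcs and theta curves\<close>

text \<open>The face classes are given only topologically, as components of the complement of a
  drawing, while the surgery on circuits is combinatorial. The bridge is one planarity fact: two
  neighbouring rungs cut off a sector of the annulus that no third rung enters. It works in one
  direction only, from neighbours on the outer cycle to their inner feet; the converse needs a count
  of three rungs per annulus, which is where 3-connectivity enters.

  The invariant asks for links between outward vertices because the feet of the next rungs are
  outward and, at a 4-cycle face, adjacent: these links are where the next surgery cuts. Many
  surgeries at one level do not interfere, because two faces of one class never share a rung.

  A 4-cycle class is available only at the levels 2 to \<open>n - 1\<close>, so the levels 1 and
  \<open>n\<close> have none. There a parity count in a 2-colouring has to produce the 4-cycle. At
  the outer end the last annulus is a block annulus, which puts outward vertices into segments of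
  odd length at least 3.\<close>

lemma notin_inside: "z \<in> S \<Longrightarrow> z \<notin> inside S"
  using inside_no_overlap[of S] by blast

text \<open>A drawing records an edge only as a point set, so arcs are handled as sets with named
  ends and the parametrisation stays hidden.\<close>

definition arc_between :: "complex set \<Rightarrow> complex \<Rightarrow> complex \<Rightarrow> bool" where
  "arc_between S p q \<longleftrightarrow> (\<exists>g. arc g \<and> path_image g = S \<and> pathstart g = p \<and> pathfinish g = q)"

lemma arc_between_sym: "arc_between S p q \<Longrightarrow> arc_between S q p"
  unfolding arc_between_def
  by (metis arc_reversepath path_image_reversepath pathfinish_reversepath pathstart_reversepath)

lemma arc_between_ends: "arc_between S p q \<Longrightarrow> p \<in> S \<and> q \<in> S \<and> p \<noteq> q"
  unfolding arc_between_def using arc_distinct_ends by fastforce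

lemma arc_between_join:
  assumes "arc_between S p q" "arc_between T q r" "S \<inter> T = {q}"
  shows "arc_between (S \<union> T) p r"
proof -
  obtain g h where g: "arc g" "path_image g = S" "pathstart g = p" "pathfinish g = q"
    and h: "arc h" "path_image h = T" "pathstart h = q" "pathfinish h = r"
    using assms unfolding arc_between_def by blast
  have "arc (g +++ h)"
    by (rule arc_join) (use g h assms in auto)
  then show ?thesis unfolding arc_between_def
    using g h by (intro exI[of _ "g +++ h"]) (auto simp: path_image_join)
qed

text \<open>What remains is the image of the half-open interval [0, 1). Connectedness confines an
  arc that meets a closed curve only in its end to one side of it; the closure statement then
  locates that end.\<close>

lemma arc_between_minus_end:
  assumes "arc_between S p q"
  shows "connected (S - {q})" "q \<in> closure (S - {q})"
proof -
  obtain g where g: "arc g" "path_image g = S" "pathstart g = p" "pathfinish g = q"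
    using assms unfolding arc_between_def by blast
  have cont: "continuous_on {0..1} g" and inj: "inj_on g {0..1}"
    using g unfolding arc_def path_def by auto
  have eq: "S - {q} = g ` {0..<1}"
  proof -
    have "S = g ` {0..1}" "q = g 1" using g by (auto simp: path_image_def pathfinish_def)
    moreover have "{0..1::real} - {1} = {0..<1}" by auto
    ultimately show ?thesis
      using inj_on_image_set_diff[OF inj, of "{0..1}" "{1}"] by auto
  qed
  show "connected (S - {q})" unfolding eq
    by (rule connected_continuous_image) (auto intro: continuous_on_subset[OF cont])
  have "g ` closure {0..<1} \<subseteq> closure (g ` {0..<1})"
    by (rule continuous_image_closure_subset[of "{0..1}"]) (use cont in auto)
  moreover have "1 \<in> closure {0..<1::real}" by simp
  ultimately show "q \<in> closure (S - {q})"
    unfolding eq using g by (auto simp: pathfinish_def)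
qed

lemma arc_between_infinite:
  assumes "arc_between S p q"
  shows "infinite S"
proof -
  obtain g where g: "arc g" "path_image g = S"
    using assms unfolding arc_between_def by blast
  have "infinite {0..1::real}" by simp
  then show ?thesis using g unfolding arc_def path_image_def
    using finite_imageD by blast
qed

text \<open>The Jordan curve theorem for a simple closed curve written as two arcs with common ends.
  The ends are the points where cuts will attach.\<close>

lemma closed_curve_props:
  assumes "arc_between S p q" "arc_between T p q" "S \<inter> T = {p, q}"
  shows "open (inside (S \<union> T))" "connected (inside (S \<union> T))" "inside (S \<union> T) \<noteq> {}"
    "frontier (inside (S \<union> T)) = S \<union> T" "frontier (outside (S \<union> T)) = S \<union> T"
    "connected (outside (S \<union> T))" "\<not> bounded (outside (S \<union> T))"
    "inside (S \<union> T) \<union> outside (S \<union> T) = - (S \<union> T)"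
proof -
  obtain g where g: "arc g" "path_image g = S" "pathstart g = p" "pathfinish g = q"
    using assms unfolding arc_between_def by blast
  obtain h where h: "arc h" "path_image h = T" "pathstart h = q" "pathfinish h = p"
    using arc_between_sym[OF assms(2)] unfolding arc_between_def by blast
  have "simple_path (g +++ h)"
    by (rule simple_path_join_loop) (use g h assms in auto)
  moreover have "path_image (g +++ h) = S \<union> T"
    using g h by (simp add: path_image_join)
  moreover have "pathfinish (g +++ h) = pathstart (g +++ h)" using g h by simp
  ultimately show "open (inside (S \<union> T))" "connected (inside (S \<union> T))" "inside (S \<union> T) \<noteq> {}"
    "frontier (inside (S \<union> T)) = S \<union> T" "frontier (outside (S \<union> T)) = S \<union> T"
    "connected (outside (S \<union> T))" "\<not> bounded (outside (S \<union> T))"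
    "inside (S \<union> T) \<union> outside (S \<union> T) = - (S \<union> T)"
    using Jordan_inside_outside[of "g +++ h"] by auto
qed

text \<open>A single interior point of \<open>U\<close> is enough to place it: \<open>U\<close>
  meets the closed curve only in \<open>p\<close> and \<open>q\<close>, so the rest of it stays on
  one side.\<close>

lemma theta_curve:
  assumes "arc_between S p q" "arc_between T p q" "arc_between U p q"
    "S \<inter> T = {p, q}" "S \<inter> U = {p, q}" "T \<inter> U = {p, q}"
    "U \<inter> inside (S \<union> T) \<noteq> {}"
  shows "inside (S \<union> U) \<inter> inside (T \<union> U) = {}"
    "inside (S \<union> U) \<union> inside (T \<union> U) \<union> (U - {p, q}) = inside (S \<union> T)"
proof -
  obtain c1 where c1: "arc c1" "path_image c1 = S" "pathstart c1 = p" "pathfinish c1 = q"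
    using assms unfolding arc_between_def by blast
  obtain c2 where c2: "arc c2" "path_image c2 = T" "pathstart c2 = p" "pathfinish c2 = q"
    using assms unfolding arc_between_def by blast
  obtain c where c: "arc c" "path_image c = U" "pathstart c = p" "pathfinish c = q"
    using assms unfolding arc_between_def by blast
  have "inside (S \<union> U) \<inter> inside (T \<union> U) = {} \<and>
    inside (S \<union> U) \<union> inside (T \<union> U) \<union> (U - {p, q}) = inside (S \<union> T)"
    by (rule split_inside_simple_closed_curve[of c1 p q c2 c])
      (use c1 c2 c assms arc_between_ends[OF assms(1)] arc_imp_simple_path in auto)
  then show "inside (S \<union> U) \<inter> inside (T \<union> U) = {}"
    "inside (S \<union> U) \<union> inside (T \<union> U) \<union> (U - {p, q}) = inside (S \<union> T)" by auto
qed

text \<open>The closure of the outside of the closed curve is connected, unbounded and misses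
  \<open>K\<close>. A point on or outside the curve therefore lies in an unbounded component of the
  complement of \<open>K\<close>.\<close>

lemma inside_subset_of_nested:
  assumes J: "arc_between S p q" "arc_between T p q" "S \<inter> T = {p, q}"
    and K: "K \<subseteq> inside (S \<union> T)"
  shows "inside K \<subseteq> inside (S \<union> T)"
proof
  note P = closed_curve_props[OF J]
  fix z assume z: "z \<in> inside K"
  let ?C = "closure (outside (S \<union> T))"
  have C: "?C = outside (S \<union> T) \<union> (S \<union> T)"
    using P(5) by (metis closure_Un_frontier)
  have disj: "?C \<subseteq> - K" using K C notin_inside[of _ "S \<union> T"] inside_Int_outside[of "S \<union> T"]
    by blast
  have con: "connected ?C" using P(6) by (rule connected_imp_connected_closure)
  have unb: "\<not> bounded ?C" using P(7) bounded_subset closure_subset by blast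
  show "z \<in> inside (S \<union> T)"
  proof (rule ccontr)
    assume "z \<notin> inside (S \<union> T)"
    then have "z \<in> ?C" unfolding C using P(8) by blast
    then have "?C \<subseteq> connected_component_set (- K) z"
      using con disj by (simp add: connected_component_maximal)
    then have "\<not> bounded (connected_component_set (- K) z)" using unb bounded_subset by blast
    then show False using z unfolding inside_def by auto
  qed
qed

text \<open>A connected set that properly extends \<open>F\<close> meets the frontier of
  \<open>F\<close>, hence \<open>D\<close>. This is how a region found by theta curves is recognised
  as a face of a drawing.\<close>

lemma component_if_frontier_subset:
  assumes "open F" "connected F" "F \<noteq> {}" "F \<inter> D = {}" "frontier F \<subseteq> D"
  shows "F \<in> components (- D)"
  unfolding in_components_maximal
proof (intro conjI allI impI)
  show "F \<noteq> {}" "F \<subseteq> - D" "connected F" using assms by auto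
  fix d assume "d \<noteq> {} \<and> F \<subseteq> d \<and> d \<subseteq> - D \<and> connected d"
  then have d: "d \<subseteq> - D" "connected d" and "F \<subseteq> d" by auto
  show "d = F"
  proof (rule ccontr)
    assume "d \<noteq> F"
    then have "d \<inter> F \<noteq> {}" "d - F \<noteq> {}" using \<open>F \<subseteq> d\<close> assms by auto
    then have "d \<inter> frontier F \<noteq> {}" using connected_Int_frontier d by blast
    then show False using d assms by auto
  qed
qed

text \<open>
  The boundary of an annulus consists of the outer curve \<open>X \<union> Y\<close> and the inner curve \<open>A \<union> B\<close>; it is
  cut by two disjoint arcs \<open>R\<close> (from \<open>p\<close> to \<open>a\<close>) and \<open>S\<close> (from \<open>q\<close> to \<open>b\<close>).
\<close>

locale cut_annulus =
  fixes X Y A B R S :: "complex set" and p q a b :: complex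
  assumes XY: "arc_between X p q" "arc_between Y p q" "X \<inter> Y = {p, q}"
    and AB: "arc_between A a b" "arc_between B a b" "A \<inter> B = {a, b}"
    and R: "arc_between R p a" "R \<inter> (X \<union> Y) = {p}" "R \<inter> (A \<union> B) = {a}"
    and S: "arc_between S q b" "S \<inter> (X \<union> Y) = {q}" "S \<inter> (A \<union> B) = {b}"
    and RS: "R \<inter> S = {}"
    and nested: "A \<union> B \<subseteq> inside (X \<union> Y)"
begin

lemma disjoint_XY_AB: "z \<in> X \<or> z \<in> Y \<Longrightarrow> z \<in> A \<or> z \<in> B \<Longrightarrow> False"
  using nested notin_inside[of z "X \<union> Y"] by blast

lemma R_eq: "z \<in> R \<Longrightarrow> z \<in> X \<or> z \<in> Y \<Longrightarrow> z = p" "z \<in> R \<Longrightarrow> z \<in> A \<or> z \<in> B \<Longrightarrow> z = a"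
  using R(2,3) by blast+

lemma S_eq: "z \<in> S \<Longrightarrow> z \<in> X \<or> z \<in> Y \<Longrightarrow> z = q" "z \<in> S \<Longrightarrow> z \<in> A \<or> z \<in> B \<Longrightarrow> z = b"
  using S(2,3) by blast+

lemma ends_in: "p \<in> X" "q \<in> X" "p \<in> Y" "q \<in> Y" "a \<in> A" "b \<in> A" "a \<in> B" "b \<in> B"
  "p \<in> R" "a \<in> R" "q \<in> S" "b \<in> S"
  using XY AB R S arc_between_ends by blast+

lemma RS_notin: "z \<in> R \<Longrightarrow> z \<in> S \<Longrightarrow> False"
  using RS by blast

lemma RAS_int: "X \<inter> (R \<union> A \<union> S) = {p, q}" "Y \<inter> (R \<union> A \<union> S) = {p, q}"
  using R_eq(1) S_eq(1) disjoint_XY_AB ends_in by fast+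

lemma RXS_int: "A \<inter> (R \<union> X \<union> S) = {a, b}" "B \<inter> (R \<union> X \<union> S) = {a, b}"
  using R_eq(2) S_eq(2) disjoint_XY_AB ends_in by fast+

lemma arc_RAS: "arc_between (R \<union> A \<union> S) p q"
proof (rule arc_between_join[OF arc_between_join[OF R(1) AB(1)] arc_between_sym[OF S(1)]])
  show "R \<inter> A = {a}" using R_eq(2) ends_in by fast
  show "(R \<union> A) \<inter> S = {b}" using S_eq(2) RS_notin ends_in by fast
qed

lemma arc_RXS: "arc_between (R \<union> X \<union> S) a b"
proof (rule arc_between_join[OF arc_between_join[OF arc_between_sym[OF R(1)] XY(1)] S(1)])
  show "R \<inter> X = {p}" using R_eq(1) ends_in by fast
  show "(R \<union> X) \<inter> S = {q}" using S_eq(1) RS_notin ends_in by fast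
qed

lemma theta_outer:
  "inside (X \<union> (R \<union> A \<union> S)) \<inter> inside (Y \<union> (R \<union> A \<union> S)) = {}"
  "inside (X \<union> (R \<union> A \<union> S)) \<union> inside (Y \<union> (R \<union> A \<union> S)) \<union> ((R \<union> A \<union> S) - {p, q}) = inside (X \<union> Y)"
proof -
  have ne: "(R \<union> A \<union> S) \<inter> inside (X \<union> Y) \<noteq> {}"
    using nested arc_between_ends[OF AB(1)] by auto
  note th = theta_curve[OF XY(1,2) arc_RAS XY(3) RAS_int ne]
  show "inside (X \<union> (R \<union> A \<union> S)) \<inter> inside (Y \<union> (R \<union> A \<union> S)) = {}"
    "inside (X \<union> (R \<union> A \<union> S)) \<union> inside (Y \<union> (R \<union> A \<union> S)) \<union> ((R \<union> A \<union> S) - {p, q}) = inside (X \<union> Y)"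
    using th by auto
qed

text \<open>The closed curve \<open>X \<union> (R \<union> A \<union> S)\<close> is now read as two
  arcs from \<open>a\<close> to \<open>b\<close>, so that \<open>B\<close> becomes the
  chord.\<close>

lemma theta_inner:
  assumes "B \<inter> inside (X \<union> (R \<union> A \<union> S)) \<noteq> {}"
  shows "inside (A \<union> B) \<inter> inside (X \<union> (R \<union> B \<union> S)) = {}"
  "inside (A \<union> B) \<union> inside (X \<union> (R \<union> B \<union> S)) \<union> (B - {a, b}) = inside (X \<union> (R \<union> A \<union> S))"
proof -
  have eq: "A \<union> (R \<union> X \<union> S) = X \<union> (R \<union> A \<union> S)" "R \<union> X \<union> S \<union> B = X \<union> (R \<union> B \<union> S)" by auto
  have ne: "B \<inter> inside (A \<union> (R \<union> X \<union> S)) \<noteq> {}" using assms eq by simp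
  have "(R \<union> X \<union> S) \<inter> B = {a, b}" using RXS_int by auto
  note th = theta_curve[OF AB(1) arc_RXS AB(2) RXS_int(1) AB(3) this ne, unfolded eq]
  show "inside (A \<union> B) \<inter> inside (X \<union> (R \<union> B \<union> S)) = {}"
  "inside (A \<union> B) \<union> inside (X \<union> (R \<union> B \<union> S)) \<union> (B - {a, b}) = inside (X \<union> (R \<union> A \<union> S))"
    using th by auto
qed

lemma swap_inner: "cut_annulus X Y B A R S p q a b"
proof
  show "B \<inter> A = {a, b}" "R \<inter> (B \<union> A) = {a}" "S \<inter> (B \<union> A) = {b}" "B \<union> A \<subseteq> inside (X \<union> Y)"
    using AB(3) R(3) S(3) nested by (simp_all only: Int_commute Un_commute)
qed (fact XY AB R S RS)+

lemma swap_outer: "cut_annulus Y X A B R S p q a b"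
proof
  show "Y \<inter> X = {p, q}" "R \<inter> (Y \<union> X) = {p}" "S \<inter> (Y \<union> X) = {q}" "A \<union> B \<subseteq> inside (Y \<union> X)"
    using XY(3) R(2) S(2) nested by (simp_all only: Int_commute Un_commute)
qed (fact XY AB R S RS)+

text \<open>If both alternatives failed, an inner point of \<open>B\<close> would lie on the
  \<open>X\<close> side of \<open>R \<union> A \<union> S\<close>, so \<open>B\<close> would split
  that side; an inner point of \<open>A\<close> would then lie in one of the parts, although
  \<open>A\<close> bounds the whole. The case distinction serves to name the inner arc that faces
  \<open>X\<close>.\<close>

lemma inner_arc_cases:
  "B \<inter> inside (Y \<union> (R \<union> A \<union> S)) \<noteq> {} \<or> A \<inter> inside (Y \<union> (R \<union> B \<union> S)) \<noteq> {}"
proof (rule ccontr)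
  assume neg: "\<not> ?thesis"
  interpret s: cut_annulus X Y B A R S p q a b by (rule swap_inner)
  have "infinite (B - {a, b})" using arc_between_infinite[OF AB(2)] by auto
  then obtain z where z: "z \<in> B" "z \<noteq> a" "z \<noteq> b"
    by (metis Diff_iff ex_in_conv finite.emptyI insertCI)
  have "z \<in> inside (X \<union> Y)" "z \<notin> R \<union> A \<union> S" using z nested R_eq(2) S_eq(2) AB(3) by auto
  then have "z \<in> inside (X \<union> (R \<union> A \<union> S))" using theta_outer(2) neg z by blast
  then have 1: "B \<inter> inside (X \<union> (R \<union> A \<union> S)) \<noteq> {}" using z by auto
  have "infinite (A - {a, b})" using arc_between_infinite[OF AB(1)] by auto
  then obtain w where w: "w \<in> A" "w \<noteq> a" "w \<noteq> b"
    by (metis Diff_iff ex_in_conv finite.emptyI insertCI)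
  have "w \<in> inside (X \<union> Y)" "w \<notin> R \<union> B \<union> S" using w nested R_eq(2) S_eq(2) AB(3) by auto
  then have "w \<in> inside (X \<union> (R \<union> B \<union> S))" using s.theta_outer(2) neg w by blast
  then have "w \<in> inside (X \<union> (R \<union> A \<union> S))" using theta_inner(2)[OF 1] by blast
  then show False using w notin_inside[of _ "X \<union> (R \<union> A \<union> S)"] by auto
qed

end

text \<open>With \<open>B\<close> on the \<open>Y\<close> side, the arcs \<open>X\<close>,
  \<open>R\<close>, \<open>A\<close> and \<open>S\<close> bound one of the two sectors of the
  annulus. A common point suffices, because this is the form the theta lemma asks for.\<close>

locale sector = cut_annulus +
  assumes B_beyond: "B \<inter> inside (Y \<union> (R \<union> A \<union> S)) \<noteq> {}"
begin

abbreviation "F \<equiv> inside (X \<union> (R \<union> A \<union> S))"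

lemmas F_props = closed_curve_props[OF XY(1) arc_RAS RAS_int(1)]

lemma F_subset: "F \<subseteq> inside (X \<union> Y)"
  unfolding theta_outer(2)[symmetric] by (rule le_supI1[OF Un_upper1])

sublocale o: cut_annulus Y X A B R S p q a b by (rule swap_outer)

lemmas theta_Y = o.theta_inner[OF B_beyond]

lemma F_disjoint_boundary: "F \<inter> (X \<union> Y \<union> A \<union> B \<union> R \<union> S) = {}"
proof -
  have "F \<inter> (X \<union> Y) = {}" using F_subset notin_inside[of _ "X \<union> Y"] by auto
  moreover have "F \<inter> (R \<union> A \<union> S) = {}" using notin_inside[of _ "X \<union> (R \<union> A \<union> S)"] by auto
  moreover have "F \<inter> B = {}"
  proof -
    have "B \<subseteq> insert a (insert b (inside (Y \<union> (R \<union> A \<union> S))))" unfolding theta_Y(2)[symmetric] by auto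
    moreover have "a \<in> R \<union> A \<union> S" "b \<in> R \<union> A \<union> S" using arc_between_ends[OF AB(1)] by auto
    ultimately show ?thesis using \<open>F \<inter> (R \<union> A \<union> S) = {}\<close> theta_outer(1) by auto
  qed
  ultimately show ?thesis by auto
qed

lemma F_disjoint_inside: "F \<inter> inside (A \<union> B) = {}"
proof -
  have "inside (A \<union> B) \<subseteq> inside (Y \<union> (R \<union> A \<union> S))" unfolding theta_Y(2)[symmetric] by auto
  then show ?thesis using theta_outer(1) by auto
qed

text \<open>Apart from its inner end, \<open>T\<close> is connected, avoids the frontiers of
  \<open>F\<close> and of the hole, and starts outside both. So it runs in the sector at
  \<open>Y\<close>, whose closure meets \<open>A\<close> only in the feet of \<open>R\<close> and
  \<open>S\<close>. Applied to rungs, this is the planarity argument on which everything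
  rests.\<close>

lemma other_arc:
  assumes T: "arc_between T w z" and w: "T \<inter> (X \<union> Y) = {w}" "w \<notin> X"
    and z: "T \<inter> (A \<union> B) = {z}" and disj: "T \<inter> R = {}" "T \<inter> S = {}"
  shows "T \<inter> F = {}" "z \<notin> A"
proof -
  have wY: "w \<in> Y" and zAB: "z \<in> A \<union> B" using w z by auto
  have wz: "w \<in> T - {z}" using arc_between_ends[OF T] by auto
  have "(T - {z}) \<inter> F = {}"
  proof (rule ccontr)
    assume ne: "(T - {z}) \<inter> F \<noteq> {}"
    have "w \<notin> F" using F_disjoint_boundary wY by auto
    then have "(T - {z}) - F \<noteq> {}" using wz by auto
    then have "(T - {z}) \<inter> frontier F \<noteq> {}"
      using connected_Int_frontier arc_between_minus_end(1)[OF T] ne by blast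
    then show False unfolding F_props(4) using w z disj by auto
  qed
  then show TF: "T \<inter> F = {}" using F_disjoint_boundary zAB by auto
  have out: "(T - {z}) \<inter> inside (A \<union> B) = {}"
  proof (rule ccontr)
    assume ne: "(T - {z}) \<inter> inside (A \<union> B) \<noteq> {}"
    have "w \<notin> inside (A \<union> B)"
      using inside_subset_of_nested[OF XY nested] notin_inside[of _ "X \<union> Y"] wY by auto
    then have "(T - {z}) - inside (A \<union> B) \<noteq> {}" using wz by auto
    then have "(T - {z}) \<inter> frontier (inside (A \<union> B)) \<noteq> {}"
      using connected_Int_frontier arc_between_minus_end(1)[OF T] ne by blast
    then show False unfolding closed_curve_props(4)[OF AB] using z by auto
  qed
  have "(T - {w}) \<subseteq> inside (X \<union> Y)"
  proof (rule ccontr)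
    assume "\<not> (T - {w}) \<subseteq> inside (X \<union> Y)"
    then have ne: "(T - {w}) - inside (X \<union> Y) \<noteq> {}" by auto
    have "z \<in> T - {w}" using arc_between_ends[OF T] by auto
    then have "(T - {w}) \<inter> inside (X \<union> Y) \<noteq> {}" using zAB nested by auto
    then have "(T - {w}) \<inter> frontier (inside (X \<union> Y)) \<noteq> {}"
      using connected_Int_frontier arc_between_minus_end(1)[OF arc_between_sym[OF T]] ne by blast
    then show False unfolding closed_curve_props(4)[OF XY] using w by auto
  qed
  \<comment> \<open>The disc splits into the hole, \<open>F\<close>, the sector at \<open>Y\<close>
    and the boundary arcs; all but the sector at \<open>Y\<close> are excluded.\<close>
  have sub: "T - {z} - {w} \<subseteq> inside (Y \<union> (R \<union> B \<union> S))"
  proof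
    fix u assume u: "u \<in> T - {z} - {w}"
    have uin: "u \<in> inside (X \<union> Y)" using \<open>T - {w} \<subseteq> inside (X \<union> Y)\<close> u by blast
    have n: "u \<notin> A" "u \<notin> B" "u \<notin> R" "u \<notin> S" using u z(1) disj by auto
    have "u \<notin> F" using u TF by blast
    then have "u \<in> inside (Y \<union> (R \<union> A \<union> S))" using theta_outer(2) uin n by blast
    moreover have "u \<notin> inside (A \<union> B)" using out u by blast
    ultimately show "u \<in> inside (Y \<union> (R \<union> B \<union> S))" using theta_Y(2) n by blast
  qed
  interpret ib: cut_annulus Y X B A R S p q a b by (rule o.swap_inner)
  note J = closed_curve_props[OF ib.XY(1) ib.arc_RAS ib.RAS_int(1)]
  have "T - {z} \<subseteq> closure (inside (Y \<union> (R \<union> B \<union> S)))"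
    using sub wY J(4) closure_Un_frontier[of "inside (Y \<union> (R \<union> B \<union> S))"] by auto
  then have "z \<in> closure (inside (Y \<union> (R \<union> B \<union> S)))"
    using arc_between_minus_end(2)[OF T] closure_minimal by blast
  then have zc: "z \<in> inside (Y \<union> (R \<union> B \<union> S)) \<or> z \<in> Y \<union> (R \<union> B \<union> S)"
    using J(4) closure_Un_frontier[of "inside (Y \<union> (R \<union> B \<union> S))"] by auto
  show "z \<notin> A"
  proof
    assume "z \<in> A"
    have zT: "z \<in> T" using z by auto
    have "z \<notin> inside (Y \<union> (R \<union> A \<union> S))"
      using \<open>z \<in> A\<close> notin_inside[of _ "Y \<union> (R \<union> A \<union> S)"] by auto
    then have "z \<notin> inside (Y \<union> (R \<union> B \<union> S))" using theta_Y(2) by auto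
    then have "z \<in> Y \<union> (R \<union> B \<union> S)" using zc by auto
    then have "z \<in> B" using \<open>z \<in> A\<close> zT disj disjoint_XY_AB[of z] by auto
    then have "z \<in> {a, b}" using \<open>z \<in> A\<close> AB by auto
    then show False using zT disj arc_between_ends[OF R(1)] arc_between_ends[OF S(1)] by auto
  qed
qed

text \<open>\<open>H\<close> lies in the remaining part of the disc, bounded by \<open>Y\<close>,
  \<open>R\<close>, \<open>A\<close> and \<open>S\<close>, whose closure meets \<open>X\<close> in
  \<open>p\<close> and \<open>q\<close> alone. Hence \<open>F\<close> is the only face on the inner
  side of an edge on \<open>X\<close>.\<close>

lemma unique_face_at_X:
  assumes H: "H \<subseteq> inside (X \<union> Y)" "H \<inter> (R \<union> A \<union> S) = {}" "H \<inter> F = {}"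
  shows "frontier H \<inter> X \<subseteq> {p, q}"
proof -
  have "H \<subseteq> F \<union> inside (Y \<union> (R \<union> A \<union> S)) \<union> ((R \<union> A \<union> S) - {p, q})"
    unfolding theta_outer(2) by (rule H(1))
  then have "H \<subseteq> inside (Y \<union> (R \<union> A \<union> S))" using H(2,3) by auto
  then have "closure H \<subseteq> closure (inside (Y \<union> (R \<union> A \<union> S)))" by (rule closure_mono)
  then have "frontier H \<subseteq> closure (inside (Y \<union> (R \<union> A \<union> S)))" by (auto simp: frontier_def)
  also have "\<dots> = inside (Y \<union> (R \<union> A \<union> S)) \<union> (Y \<union> (R \<union> A \<union> S))"
    using closed_curve_props(4)[OF o.XY(1) o.arc_RAS o.RAS_int(1)]
      closure_Un_frontier[of "inside (Y \<union> (R \<union> A \<union> S))"] by auto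
  finally have fr: "frontier H \<subseteq> inside (Y \<union> (R \<union> A \<union> S)) \<union> (Y \<union> (R \<union> A \<union> S))" .
  have "inside (Y \<union> (R \<union> A \<union> S)) \<subseteq> inside (X \<union> Y)" unfolding theta_outer(2)[symmetric] by auto
  then have "X \<inter> inside (Y \<union> (R \<union> A \<union> S)) = {}" using notin_inside[of _ "X \<union> Y"] by auto
  then show ?thesis using fr XY(3) RAS_int(1) by auto
qed

end

section \<open>Circuits as lists of vertices\<close>

text \<open>Vertex lists with unordered pairs as links make splicing and reversal easy. As
  \<open>G\<close> is simple, a pair determines its edge, and edge sets return in
  \<open>hamiltonian_if_circuit\<close>.\<close>

fun links :: "'v list \<Rightarrow> 'v set set" where
  "links (u # v # vs) = insert {u, v} (links (v # vs))"
| "links _ = {}"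

definition closed_links :: "'v list \<Rightarrow> 'v set set" where
  "closed_links vs = links (vs @ [hd vs])"

lemma links_append:
  "xs \<noteq> [] \<Longrightarrow> ys \<noteq> [] \<Longrightarrow> links (xs @ ys) = links xs \<union> links ys \<union> {{last xs, hd ys}}"
proof (induction xs rule: links.induct)
  case ("2_2" v)
  then show ?case by (cases ys) auto
qed auto

lemma links_rev: "links (rev xs) = links xs"
proof (induction xs)
  case (Cons x xs)
  show ?case
  proof (cases xs)
    case (Cons y ys)
    have "links (rev (x # xs)) = links (rev xs @ [x])" by simp
    also have "\<dots> = links (rev xs) \<union> {{y, x}}"
      using Cons by (subst links_append) (auto simp: last_rev)
    finally show ?thesis using Cons.IH Cons by (simp add: insert_commute)
  qed simp
qed simp

lemma links_split: "l \<in> links xs \<Longrightarrow> \<exists>as u v bs. xs = as @ u # v # bs \<and> l = {u, v}"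
proof (induction xs rule: links.induct)
  case (1 u v vs)
  show ?case
  proof (cases "l = {u, v}")
    case True
    then show ?thesis by (intro exI[of _ "[]"]) auto
  next
    case False
    then obtain as u' v' bs where "v # vs = as @ u' # v' # bs \<and> l = {u', v'}" using 1 by auto
    then show ?thesis by (intro exI[of _ "u # as"]) auto
  qed
qed auto

lemma closed_links_eq: "xs \<noteq> [] \<Longrightarrow> closed_links xs = links xs \<union> {{last xs, hd xs}}"
  unfolding closed_links_def by (simp add: links_append)

lemma closed_links_rotate: "xs \<noteq> [] \<Longrightarrow> ys \<noteq> [] \<Longrightarrow> closed_links (xs @ ys) = closed_links (ys @ xs)"
  by (auto simp: closed_links_eq links_append)

lemma closed_links_rev: "xs \<noteq> [] \<Longrightarrow> closed_links (rev xs) = closed_links xs"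
  by (simp add: closed_links_eq links_rev last_rev hd_rev insert_commute)

text \<open>Rotation moves the seam of the cyclic list to the chosen link; a reversal corrects the
  order if the link is met as \<open>v\<close>, \<open>u\<close>.\<close>

lemma closed_links_open_at:
  assumes "{u, v} \<in> closed_links L" "L \<noteq> []"
  obtains M where "M \<noteq> []" "last M = u" "hd M = v" "closed_links M = closed_links L"
    "set M = set L" "length M = length L" "distinct M = distinct L"
proof -
  obtain as x y bs where eq: "L @ [hd L] = as @ x # y # bs" and l: "{u, v} = {x, y}"
    using links_split assms(1) unfolding closed_links_def by metis
  have "\<exists>M. M \<noteq> [] \<and> last M = x \<and> hd M = y \<and> closed_links M = closed_links L \<and>
    set M = set L \<and> length M = length L \<and> distinct M = distinct L"
  proof (cases "bs = []")
    case True
    then have "L = as @ [x]" "hd L = y" using eq by (auto simp: append_eq_append_conv2 append_eq_Cons_conv)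
    then show ?thesis by (intro exI[of _ L]) auto
  next
    case False
    then obtain cs c where "bs = cs @ [c]" by (metis append_butlast_last_id)
    then have L: "L = (as @ [x]) @ (y # cs)" using eq by auto
    have "closed_links ((y # cs) @ (as @ [x])) = closed_links L"
      unfolding L by (rule closed_links_rotate) auto
    then show ?thesis
      unfolding L by (intro exI[of _ "(y # cs) @ (as @ [x])"]) auto
  qed
  then obtain M where M: "M \<noteq> []" "last M = x" "hd M = y" "closed_links M = closed_links L"
    "set M = set L" "length M = length L" "distinct M = distinct L" by blast
  show thesis
  proof (cases "u = x")
    case True
    then show thesis using that[of M] M l by (auto simp: doubleton_eq_iff)
  next
    case False
    then have "u = y" "v = x" using l by (auto simp: doubleton_eq_iff)
    then show thesis using that[of "rev M"] M by (simp add: last_rev hd_rev closed_links_rev)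
  qed
qed

lemma links_upto:
  fixes c :: "int \<Rightarrow> 'v"
  shows "links (map c [i..j]) = {{c t, c (t + 1)} |t. i \<le> t \<and> t < j}"
proof (induction "nat (j - i)" arbitrary: i)
  case 0
  then have "i \<ge> j" by simp
  then consider "i = j" | "i > j" by linarith
  then show ?case by cases auto
next
  case (Suc n)
  then have ij: "i < j" by linarith
  then have "[i..j] = i # (i + 1) # [i + 2..j]"
    using upto_rec1[of i j] upto_rec1[of "i + 1" j] by (simp add: add.assoc)
  moreover have "[i + 1..j] = (i + 1) # [i + 2..j]"
    using ij upto_rec1[of "i + 1" j] by (simp add: add.assoc)
  ultimately have "links (map c [i..j]) = insert {c i, c (i + 1)} (links (map c [i + 1..j]))" by simp
  also have "\<dots> = insert {c i, c (i + 1)} {{c t, c (t + 1)} |t. i + 1 \<le> t \<and> t < j}"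
    using Suc by simp
  also have "\<dots> = {{c t, c (t + 1)} |t. i \<le> t \<and> t < j}"
  proof -
    have "i \<le> t \<and> t < j \<longleftrightarrow> t = i \<or> (i + 1 \<le> t \<and> t < j)" for t using ij by auto
    then show ?thesis by auto
  qed
  finally show ?case .
qed

definition circuit :: "('v, 'e) mgraph \<Rightarrow> 'v list \<Rightarrow> bool" where
  "circuit G vs \<longleftrightarrow> distinct vs \<and> 3 \<le> length vs \<and> closed_links vs \<subseteq> ends G ` edges G"

text \<open>Cutting the circuit at a link and appending \<open>p\<close> is the only surgery of the
  proof: \<open>p\<close> runs along a segment of \<open>C k\<close> in a block step, and along all
  of \<open>C k\<close> except one edge in a merge.\<close>

lemma circuit_insert_path:
  assumes L: "circuit G L" and l: "{u, v} \<in> closed_links L"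
    and p: "distinct p" "p \<noteq> []" "set p \<inter> set L = {}" "links p \<subseteq> ends G ` edges G"
    and up: "{u, hd p} \<in> ends G ` edges G" and pv: "{last p, v} \<in> ends G ` edges G"
  obtains L' where "circuit G L'" "set L' = set L \<union> set p"
    "closed_links L - {{u, v}} \<union> links p \<subseteq> closed_links L'"
proof -
  have "L \<noteq> []" using L unfolding circuit_def by auto
  then obtain M where M: "M \<noteq> []" "last M = u" "hd M = v" "closed_links M = closed_links L"
    "set M = set L" "length M = length L" "distinct M = distinct L"
    using closed_links_open_at[OF l] by blast
  have eq: "closed_links L = links M \<union> {{u, v}}"
    using M closed_links_eq by metis
  have eq': "closed_links (M @ p) = links M \<union> links p \<union> {{u, hd p}} \<union> {{last p, v}}"
    using M p by (auto simp: closed_links_eq links_append)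
  have "circuit G (M @ p)"
    using L M p up pv eq unfolding circuit_def eq' by auto
  moreover have "set (M @ p) = set L \<union> set p" using M by auto
  moreover have "closed_links L - {{u, v}} \<union> links p \<subseteq> closed_links (M @ p)"
    unfolding eq eq' by auto
  ultimately show thesis using that by blast
qed

lemma closed_links_nth:
  assumes "vs \<noteq> []"
  shows "closed_links vs = {{vs ! i, vs ! (Suc i mod length vs)} |i. i < length vs}"
proof -
  have links: "links xs = {{xs ! i, xs ! Suc i} |i. Suc i < length xs}" for xs :: "'a list"
  proof (induction xs rule: links.induct)
    case (1 u v vs)
    have "{{(u # v # vs) ! i, (u # v # vs) ! Suc i} |i. Suc i < length (u # v # vs)}
      = insert {u, v} {{(v # vs) ! i, (v # vs) ! Suc i} |i. Suc i < length (v # vs)}"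
      (is "?l = ?r")
    proof
      show "?l \<subseteq> ?r"
      proof
        fix l assume "l \<in> ?l"
        then obtain i where "l = {(u # v # vs) ! i, (u # v # vs) ! Suc i}" "Suc i < length (u # v # vs)" by auto
        then show "l \<in> ?r" by (cases i) auto
      qed
      show "?r \<subseteq> ?l"
      proof
        fix l assume "l \<in> ?r"
        then consider "l = {u, v}" | i where "l = {(v # vs) ! i, (v # vs) ! Suc i}" "Suc i < length (v # vs)" by auto
        then show "l \<in> ?l"
        proof cases
          case 1
          then show ?thesis by (intro CollectI exI[of _ 0]) auto
        next
          case 2
          then show ?thesis by (intro CollectI exI[of _ "Suc i"]) auto
        qed
      qed
    qed
    then show ?case using 1 by simp
  qed auto
  have "{{(vs @ [hd vs]) ! i, (vs @ [hd vs]) ! Suc i} |i. Suc i < length (vs @ [hd vs])}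
    = {{vs ! i, vs ! (Suc i mod length vs)} |i. i < length vs}"
  proof -
    have "(vs @ [hd vs]) ! i = vs ! i" "(vs @ [hd vs]) ! Suc i = vs ! (Suc i mod length vs)"
      if "i < length vs" for i
      using that assms by (auto simp: nth_append hd_conv_nth mod_Suc)
    note nth = this
    have "Suc i < length (vs @ [hd vs]) \<longleftrightarrow> i < length vs" for i by simp
    then show ?thesis using nth by (auto 0 0 intro!: Collect_cong) (metis nth)+
  qed
  then show ?thesis unfolding closed_links_def links by simp
qed

text \<open>If the pairs agree at different positions, each index is the cyclic successor of the
  other, which is possible only for length 2.\<close>

lemma consecutive_pair_inj:
  assumes d: "distinct vs" and l: "3 \<le> length vs" and ij: "i < length vs" "j < length vs"
    and eq: "{vs ! i, vs ! (Suc i mod length vs)} = {vs ! j, vs ! (Suc j mod length vs)}"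
  shows "i = j"
proof (rule ccontr)
  assume "i \<noteq> j"
  have m: "Suc i mod length vs < length vs" "Suc j mod length vs < length vs"
    using l by (auto intro!: mod_less_divisor)
  have "i = Suc j mod length vs" "j = Suc i mod length vs"
    using eq d ij m \<open>i \<noteq> j\<close> by (auto simp: doubleton_eq_iff nth_eq_iff_index_eq)
  moreover have "Suc k mod length vs = (if Suc k = length vs then 0 else Suc k)" if "k < length vs" for k
    using that by auto
  ultimately show False using l ij by (auto split: if_splits)
qed

text \<open>\<open>is_cycle\<close> wants a list of edges, so one edge is chosen for each link;
  different positions have different links and hence different edges.\<close>

lemma hamiltonian_if_circuit:
  assumes "circuit G vs" "set vs = verts G"
  shows "hamiltonian G"
proof -
  have d: "distinct vs" and l: "3 \<le> length vs" using assms unfolding circuit_def by auto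
  have ne: "vs \<noteq> []" using l by auto
  let ?l = "\<lambda>i. {vs ! i, vs ! (Suc i mod length vs)}"
  have "\<exists>e. i < length vs \<longrightarrow> e \<in> edges G \<and> ends G e = ?l i" for i
  proof (cases "i < length vs")
    case True
    then have "?l i \<in> closed_links vs" unfolding closed_links_nth[OF ne] by auto
    then have "?l i \<in> ends G ` edges G" using assms(1) unfolding circuit_def by (rule_tac subsetD) auto
    then obtain e where "e \<in> edges G" "?l i = ends G e" by (rule imageE) 
    then show ?thesis by (intro exI[of _ e]) simp
  qed simp
  then obtain f where f: "\<And>i. i < length vs \<Longrightarrow> f i \<in> edges G \<and> ends G (f i) = ?l i"
    by (metis (lifting) choice)
  define es where "es = map f [0..<length vs]"
  have "is_cycle G (set es)"
    unfolding is_cycle_def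
  proof (intro conjI exI)
    show "set es \<subseteq> edges G" unfolding es_def using f by auto
    show "es \<noteq> []" "length vs = length es" unfolding es_def using l by auto
    show "distinct vs" by (rule d)
    have "inj_on f {0..<length vs}"
    proof (rule inj_onI)
      fix i j assume "i \<in> {0..<length vs}" "j \<in> {0..<length vs}" and eq: "f i = f j"
      then have ij: "i < length vs" "j < length vs" by auto
      have "?l i = ?l j" using f[OF ij(1)] f[OF ij(2)] eq by simp
      then show "i = j" by (rule consecutive_pair_inj[OF d l ij])
    qed
    then show "distinct es" unfolding es_def distinct_map by simp
    show "set es = set es" ..
    show "set vs \<subseteq> verts G" using assms by simp
    show "\<forall>i<length es. ends G (es ! i) = {vs ! i, vs ! (Suc i mod length es)}"
      unfolding es_def using f by auto
  qed
  moreover have "cverts G (set es) = verts G"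
  proof -
    have "cverts G (set es) = (\<Union>i<length vs. ?l i)"
      unfolding cverts_def es_def using f by auto
    also have "\<dots> = set vs"
    proof
      show "(\<Union>i<length vs. ?l i) \<subseteq> set vs"
        using l by (auto intro!: nth_mem mod_less_divisor)
      show "set vs \<subseteq> (\<Union>i<length vs. ?l i)" by (auto simp: in_set_conv_nth)
    qed
    finally show ?thesis using assms by simp
  qed
  ultimately show ?thesis unfolding hamiltonian_def by blast
qed

section \<open>Annular graphs\<close>

text \<open>Extending a cycle periodically over the integers removes case distinctions at the
  wrap-around: any \<open>l\<close> successive indices run once around. The bound 3 comes from
  simplicity, which excludes loops and parallel edges.\<close>

lemma is_cycle_periodic:
  assumes G: "simple_graph G" and D: "is_cycle G D"
  obtains c :: "int \<Rightarrow> 'v" and ed :: "int \<Rightarrow> 'e" and l :: int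
  where "3 \<le> l" "\<And>s t. c s = c t \<longleftrightarrow> s mod l = t mod l" "D = range ed"
    "\<And>t. ends G (ed t) = {c t, c (t + 1)}"
proof -
  obtain vs es where D1: "D \<subseteq> edges G" and ne: "es \<noteq> []" and len: "length vs = length es"
    and d: "distinct vs" "distinct es" and es: "set es = D"
    and ends: "\<And>i. i < length es \<Longrightarrow> ends G (es ! i) = {vs ! i, vs ! (Suc i mod length es)}"
    using D unfolding is_cycle_def by metis
  let ?m = "length es"
  have m0: "?m > 0" using ne by simp
  have c2: "card (ends G (es ! i)) = 2" if "i < ?m" for i
    using that G es D1 unfolding simple_graph_def by (metis nth_mem subsetD)
  have m1: "?m \<noteq> 1"
  proof
    assume "?m = 1"
    then show False using c2[of 0] ends[of 0] by simp
  qed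
  have m2: "?m \<noteq> 2"
  proof
    assume m: "?m = 2"
    then have "ends G (es ! 0) = ends G (es ! 1)" using ends[of 0] ends[of 1] by (auto simp: mod_Suc)
    moreover have "es ! 0 \<in> edges G" "es ! 1 \<in> edges G" using m es D1 by (metis nth_mem subsetD one_less_numeral_iff semiring_norm(76) zero_less_numeral)+
    ultimately have "es ! 0 = es ! 1" using G unfolding simple_graph_def inj_on_def by blast
    then show False using d m by (simp add: nth_eq_iff_index_eq)
  qed
  have m3: "3 \<le> ?m" using m0 m1 m2 by linarith
  define l where "l = int ?m"
  define c where "c t = vs ! nat (t mod l)" for t
  define ed where "ed t = es ! nat (t mod l)" for t
  have l3: "3 \<le> l" using m3 unfolding l_def by simp
  have r: "nat (t mod l) < ?m" for t using m0 unfolding l_def by (simp add: nat_less_iff)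
  have "c s = c t \<longleftrightarrow> s mod l = t mod l" for s t
    unfolding c_def using r[of s] r[of t] d(1) len l3 by (auto simp: nth_eq_iff_index_eq nat_eq_iff2)
  moreover have "D = range ed"
  proof
    show "range ed \<subseteq> D" unfolding ed_def using r es nth_mem by blast
    show "D \<subseteq> range ed"
    proof
      fix e assume "e \<in> D"
      then obtain i where i: "i < ?m" "e = es ! i" using es by (metis in_set_conv_nth)
      then have "e = ed (int i)" unfolding ed_def l_def by simp
      then show "e \<in> range ed" by simp
    qed
  qed
  moreover have "ends G (ed t) = {c t, c (t + 1)}" for t
  proof -
    have "int (Suc (nat (t mod l))) = t mod l + 1" using l3 by simp
    then have "int (Suc (nat (t mod l)) mod ?m) = (t mod l + 1) mod l"
      unfolding zmod_int l_def by (simp add: add.commute)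
    also have "\<dots> = (t + 1) mod l" by (simp add: mod_add_left_eq)
    finally have "(t + 1) mod l = int (Suc (nat (t mod l)) mod ?m)" ..
    then have "nat ((t + 1) mod l) = Suc (nat (t mod l)) mod ?m" by simp
    then show ?thesis unfolding ed_def c_def using ends[OF r[of t]] by simp
  qed
  ultimately show thesis using that l3 by blast
qed

lemma mod_close:
  fixes s t L :: int
  assumes "s mod L = t mod L" "\<bar>s - t\<bar> < L"
  shows "s = t"
proof -
  have "L dvd s - t" using assms(1) by (simp add: mod_eq_dvd_iff)
  then show ?thesis using assms(2) zdvd_not_zless[of "\<bar>s - t\<bar>" L] by (cases "s = t") auto
qed

text \<open>All cycles are parametrised once. Nothing relates the orientations or starting points of
  different cycles, which is why feet of rungs are later compared as unordered pairs.\<close>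

locale annular =
  fixes G :: "('v, 'e) mgraph" and pos :: "'v \<Rightarrow> complex" and crv :: "'e \<Rightarrow> complex set"
    and C :: "nat \<Rightarrow> 'e set" and n :: nat
    and c :: "nat \<Rightarrow> int \<Rightarrow> 'v" and ed :: "nat \<Rightarrow> int \<Rightarrow> 'e" and l :: "nat \<Rightarrow> int"
  assumes barn: "barnette G" and emb: "planar_annular_embedding G pos crv C n"
    and l3: "k \<le> n \<Longrightarrow> 3 \<le> l k"
    and c_eq: "k \<le> n \<Longrightarrow> c k s = c k t \<longleftrightarrow> s mod l k = t mod l k"
    and C_eq: "k \<le> n \<Longrightarrow> C k = range (ed k)"
    and ends_ed: "k \<le> n \<Longrightarrow> ends G (ed k t) = {c k t, c k (t + 1)}"
begin

lemma fin: "finite (verts G)" "finite (edges G)"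
  and simple: "simple_graph G"
  and deg3: "v \<in> verts G \<Longrightarrow> degree G v = 3"
  and conn3: "vertex_connected 3 G"
  and bip: "bipartite G"
  using barn unfolding barnette_def by auto

lemma ends_verts: "e \<in> edges G \<Longrightarrow> ends G e \<subseteq> verts G"
  and card_ends: "e \<in> edges G \<Longrightarrow> card (ends G e) = 2"
  and ends_inj: "e \<in> edges G \<Longrightarrow> f \<in> edges G \<Longrightarrow> ends G e = ends G f \<Longrightarrow> e = f"
  using simple unfolding simple_graph_def inj_on_def by auto

definition V :: "nat \<Rightarrow> 'v set" where "V k = range (c k)"

lemma c_in_V [simp]: "c k t \<in> V k"
  unfolding V_def by simp

lemma cverts_C: "k \<le> n \<Longrightarrow> cverts G (C k) = V k"
  unfolding cverts_def V_def C_eq using ends_ed by auto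

lemma plane: "plane_embedding G pos crv"
  using emb unfolding planar_annular_embedding_def by blast

lemma V_disjoint: "j \<le> n \<Longrightarrow> k \<le> n \<Longrightarrow> v \<in> V j \<Longrightarrow> v \<in> V k \<Longrightarrow> j = k"
  using emb cverts_C unfolding planar_annular_embedding_def by (metis disjoint_iff)

lemma nested: "1 \<le> k \<Longrightarrow> k \<le> n \<Longrightarrow> merged_curve crv (C (k - 1)) \<subseteq> inside (merged_curve crv (C k))"
  using emb unfolding planar_annular_embedding_def by auto

lemma verts_eq: "verts G = (\<Union>k\<le>n. V k)"
  using emb cverts_C unfolding planar_annular_embedding_def by auto

lemma V_verts: "k \<le> n \<Longrightarrow> V k \<subseteq> verts G"
  unfolding verts_eq by auto

lemma edges_eq: "edges G = (\<Union>k\<le>n. C k) \<union> (\<Union>k\<in>{1..n}. rungs G C k)"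
  using emb unfolding planar_annular_embedding_def by blast

lemma ed_edge: "k \<le> n \<Longrightarrow> ed k t \<in> edges G"
  unfolding edges_eq using C_eq by auto

lemma c_inj: "k \<le> n \<Longrightarrow> c k s = c k t \<Longrightarrow> \<bar>s - t\<bar> < l k \<Longrightarrow> s = t"
  using c_eq mod_close by blast

lemma c_period: "k \<le> n \<Longrightarrow> c k (t + m * l k) = c k t"
  using c_eq by simp

lemma shift_window:
  assumes "k \<le> n"
  obtains m where "i \<le> t + m * l k" "t + m * l k < i + l k"
proof
  let ?m = "- ((t - i) div l k)"
  have "t + ?m * l k = i + (t - i) mod l k"
    by (simp add: minus_div_mult_eq_mod[symmetric] algebra_simps)
  moreover have "0 \<le> (t - i) mod l k" "(t - i) mod l k < l k" using l3[OF assms] by auto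
  ultimately show "i \<le> t + ?m * l k" "t + ?m * l k < i + l k" by auto
qed

lemma V_window:
  assumes "k \<le> n" "v \<in> V k"
  obtains t where "i \<le> t" "t < i + l k" "c k t = v"
proof -
  obtain t where "v = c k t" using assms unfolding V_def by auto
  then show thesis using shift_window[OF assms(1), of i t] c_period[OF assms(1)] that by metis
qed

lemma ed_eq: "k \<le> n \<Longrightarrow> ed k s = ed k t \<longleftrightarrow> s mod l k = t mod l k"
proof
  assume k: "k \<le> n" and "s mod l k = t mod l k"
  moreover have "(s + 1) mod l k = (t + 1) mod l k" using calculation by (metis mod_add_left_eq)
  ultimately have "ends G (ed k s) = ends G (ed k t)" using ends_ed c_eq by simp metis
  then show "ed k s = ed k t" using ends_inj ed_edge k by blast
next
  assume k: "k \<le> n" and "ed k s = ed k t"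
  then have eq: "{c k s, c k (s + 1)} = {c k t, c k (t + 1)}" using ends_ed by metis
  show "s mod l k = t mod l k"
  proof (rule ccontr)
    assume "\<not> ?thesis"
    then have "c k s \<noteq> c k t" using c_eq k by blast
    then have "c k s = c k (t + 1)" "c k (s + 1) = c k t" using eq by (auto simp: doubleton_eq_iff)
    then have "s mod l k = (t + 1) mod l k" "(s + 1) mod l k = t mod l k" using c_eq k by blast+
    then have "(t + 2) mod l k = t mod l k" by (metis add.assoc mod_add_left_eq one_add_one)
    then have "t + 2 = t" by (rule mod_close) (use l3[OF k] in auto)
    then show False by simp
  qed
qed

lemma ed_at: "k \<le> n \<Longrightarrow> e \<in> C k \<Longrightarrow> c k t \<in> ends G e \<Longrightarrow> e = ed k t \<or> e = ed k (t - 1)"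
proof -
  assume k: "k \<le> n" and e: "e \<in> C k" and t: "c k t \<in> ends G e"
  obtain s where s: "e = ed k s" using e C_eq[OF k] by auto
  have "c k t = c k s \<or> c k t = c k (s + 1)" using t s ends_ed k by auto
  then consider "t mod l k = s mod l k" | "t mod l k = (s + 1) mod l k" using c_eq k by blast
  then show ?thesis
  proof cases
    case 1
    then show ?thesis using ed_eq k s by auto
  next
    case 2
    then have "(t - 1) mod l k = (s + 1 - 1) mod l k" by (metis mod_diff_left_eq)
    then have "(t - 1) mod l k = s mod l k" by simp
    then show ?thesis using ed_eq k s by auto
  qed
qed

section \<open>Rungs, and vertices leading inwards or outwards\<close>

definition rung :: "nat \<Rightarrow> 'e \<Rightarrow> 'v \<Rightarrow> 'v \<Rightarrow> bool" where
  "rung k e u v \<longleftrightarrow> 1 \<le> k \<and> k \<le> n \<and> e \<in> edges G \<and> ends G e = {u, v} \<and> u \<in> V (k - 1) \<and> v \<in> V k"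

lemma rungs_iff: "1 \<le> k \<Longrightarrow> k \<le> n \<Longrightarrow> e \<in> rungs G C k \<longleftrightarrow> (\<exists>u v. rung k e u v)"
  unfolding rungs_def rung_def by (auto simp: cverts_C)

lemma C_ends: "k \<le> n \<Longrightarrow> e \<in> C k \<Longrightarrow> ends G e \<subseteq> V k"
  using C_eq ends_ed by auto

lemma C_edges: "k \<le> n \<Longrightarrow> C k \<subseteq> edges G"
  using edges_eq by auto

lemma rung_notin_C: "rung k e u v \<Longrightarrow> j \<le> n \<Longrightarrow> e \<notin> C j"
proof
  assume r: "rung k e u v" and j: "j \<le> n" and "e \<in> C j"
  then have "u \<in> V j" "v \<in> V j" using C_ends r unfolding rung_def by auto
  moreover have "u \<in> V (k - 1)" "v \<in> V k" "1 \<le> k" "k \<le> n" using r unfolding rung_def by auto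
  ultimately have "j = k - 1" "j = k" using V_disjoint j by (meson diff_le_self le_trans)+
  then show False using \<open>1 \<le> k\<close> by simp
qed

lemma edges_at:
  assumes k: "k \<le> n" and e: "e \<in> edges G" "c k t \<in> ends G e"
  shows "e \<in> C k \<or> (\<exists>u. rung k e u (c k t)) \<or> (\<exists>w. rung (k + 1) e (c k t) w)"
proof -
  consider j where "j \<le> n" "e \<in> C j" | j where "1 \<le> j" "j \<le> n" "e \<in> rungs G C j"
    using e unfolding edges_eq by auto
  then show ?thesis
  proof cases
    case 1
    then have "c k t \<in> V j" using C_ends e by auto
    then have "j = k" using V_disjoint[of j k "c k t"] 1 k by auto
    then show ?thesis using 1 by auto
  next
    case 2
    then obtain u v where r: "rung j e u v" using rungs_iff by auto
    then have r': "u \<in> V (j - 1)" "v \<in> V j" "ends G e = {u, v}" unfolding rung_def by auto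
    then consider "c k t = u" | "c k t = v" using e by auto
    then show ?thesis
    proof cases
      case 1
      then have "k = j - 1" using V_disjoint[of k "j - 1" u] r' 2 k by (metis c_in_V diff_le_self le_trans)
      then have "j = k + 1" using \<open>1 \<le> j\<close> by simp
      then show ?thesis using r 1 by auto
    next
      case 2
      then have "k = j" using V_disjoint[of k j v] r' \<open>j \<le> n\<close> k by (metis c_in_V)
      then show ?thesis using r 2 by auto
    qed
  qed
qed

text \<open>The vertex is cubic and its two cycle edges are distinct, which leaves one further
  edge.\<close>

lemma star:
  assumes k: "k \<le> n"
  obtains e where "{f \<in> edges G. c k t \<in> ends G f} = {ed k t, ed k (t - 1), e}" "e \<notin> C k"
proof -
  let ?S = "{f \<in> edges G. c k t \<in> ends G f}"
  have "degree G (c k t) = 3" by (rule deg3[OF subsetD[OF V_verts[OF k] c_in_V]])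
  moreover have "{e \<in> edges G. ends G e = {c k t}} = {}" using card_ends by fastforce
  ultimately have c3: "card ?S = 3" unfolding degree_def by simp
  have fS: "finite ?S" using fin by simp
  have sub: "{ed k t, ed k (t - 1)} \<subseteq> ?S" using ed_edge k ends_ed by auto
  have "t mod l k \<noteq> (t - 1) mod l k" using mod_close[of t "l k" "t - 1"] l3[OF k] by auto
  then have "ed k t \<noteq> ed k (t - 1)" using ed_eq k by blast
  then have "card (?S - {ed k t, ed k (t - 1)}) = 1"
    using c3 sub fS by (simp add: card_Diff_subset)
  then obtain e where e: "?S - {ed k t, ed k (t - 1)} = {e}" by (meson card_1_singletonE)
  then have "?S = {ed k t, ed k (t - 1), e}" using sub by auto
  moreover have "e \<notin> C k" using ed_at[OF k, of e t] e by auto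
  ultimately show thesis using that by blast
qed

lemma rung_unique_at:
  assumes k: "k \<le> n" and "e \<in> edges G" "e \<notin> C k" "c k t \<in> ends G e"
    and "e' \<in> edges G" "e' \<notin> C k" "c k t \<in> ends G e'"
  shows "e = e'"
proof -
  obtain f where f: "{f \<in> edges G. c k t \<in> ends G f} = {ed k t, ed k (t - 1), f}" "f \<notin> C k"
    using star[OF k, of t] .
  have "ed k t \<in> C k" "ed k (t - 1) \<in> C k" using C_eq k by auto
  moreover have "e \<in> {ed k t, ed k (t - 1), f}" "e' \<in> {ed k t, ed k (t - 1), f}"
    using assms unfolding f(1)[symmetric] by auto
  ultimately show ?thesis using assms(3,6) by auto
qed

lemma rung_outer_unique:
  assumes "rung k e u v" "rung k e' u' v" shows "e = e'" "u = u'"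
proof -
  have k: "k \<le> n" using assms unfolding rung_def by auto
  obtain t where t: "v = c k t" using assms unfolding rung_def V_def by auto
  show ee: "e = e'"
    by (rule rung_unique_at[OF k, of _ t])
      (use rung_notin_C[OF assms(1) k] rung_notin_C[OF assms(2) k] assms t in \<open>auto simp: rung_def\<close>)
  show "u = u'" using assms ee card_ends unfolding rung_def by (auto simp: doubleton_eq_iff)
qed

lemma rung_inner_unique:
  assumes "rung k e u v" "rung k e' u v'" shows "e = e'" "v = v'"
proof -
  have k: "k - 1 \<le> n" using assms unfolding rung_def by auto
  obtain t where t: "u = c (k - 1) t" using assms unfolding rung_def V_def by auto
  show ee: "e = e'"
    by (rule rung_unique_at[OF k, of _ t])
      (use rung_notin_C[OF assms(1) k] rung_notin_C[OF assms(2) k] assms t in \<open>auto simp: rung_def\<close>)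
  show "v = v'" using assms ee card_ends unfolding rung_def by (auto simp: doubleton_eq_iff)
qed

definition inward :: "nat \<Rightarrow> 'v set" where "inward k = {v. \<exists>e u. rung k e u v}"
definition outward :: "nat \<Rightarrow> 'v set" where "outward k = {u. \<exists>e v. rung (k + 1) e u v}"

lemma inward_V: "inward k \<subseteq> V k" and outward_V: "outward k \<subseteq> V k"
  unfolding inward_def outward_def rung_def by auto

text \<open>The third edge at a vertex is a rung to a neighbouring level by \<open>edges_at\<close>.
  If it led both ways, its other end would lie on \<open>C (k - 1)\<close> and on
  \<open>C (k + 1)\<close>.\<close>

lemma in_out: "k \<le> n \<Longrightarrow> v \<in> V k \<Longrightarrow> v \<in> inward k \<longleftrightarrow> v \<notin> outward k"
proof -
  assume k: "k \<le> n" and "v \<in> V k"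
  then obtain t where t: "v = c k t" unfolding V_def by auto
  obtain e where e: "{f \<in> edges G. c k t \<in> ends G f} = {ed k t, ed k (t - 1), e}" "e \<notin> C k"
    using star[OF k] .
  then have "e \<in> edges G" "c k t \<in> ends G e" by auto
  then have ex: "v \<in> inward k \<or> v \<in> outward k"
    using edges_at[OF k, of e t] e t unfolding inward_def outward_def by auto
  have "False" if "v \<in> inward k" "v \<in> outward k"
  proof -
    obtain e u where 1: "rung k e u v" using \<open>v \<in> inward k\<close> unfolding inward_def by auto
    obtain e' w where 2: "rung (k + 1) e' v w" using \<open>v \<in> outward k\<close> unfolding outward_def by auto
    have "e = e'"
      by (rule rung_unique_at[OF k, of _ t])
        (use rung_notin_C[OF 1 k] rung_notin_C[OF 2 k] 1 2 t in \<open>auto simp: rung_def\<close>)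
    then have "{u, v} = {v, w}" using 1 2 unfolding rung_def by auto
    then have "u = w" by (auto simp: doubleton_eq_iff)
    then have "k - 1 = k + 1" using V_disjoint[of "k - 1" "k + 1" u] 1 2 unfolding rung_def by auto
    then show False by simp
  qed
  then show ?thesis using ex by auto
qed

lemma inward_0: "inward 0 = {}" and outward_n: "outward n = {}"
  unfolding inward_def outward_def rung_def by auto

text \<open>A walk from \<open>C 0\<close> to \<open>C k\<close> first reaches level
  \<open>k\<close> in an inward vertex. If there were fewer than three of these, deleting them would
  leave the graph connected by 3-connectivity, and yet cut \<open>C 0\<close> off from the rest of
  \<open>C k\<close>.\<close>

lemma card_inward:
  assumes k: "1 \<le> k" "k \<le> n"
  shows "3 \<le> card (inward k)"
proof (rule ccontr)
  assume neg: "\<not> 3 \<le> card (inward k)"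
  have sub: "inward k \<subseteq> verts G" using inward_V V_verts k by blast
  then have con: "connected_graph (del_verts G (inward k))"
    using conn3 neg unfolding vertex_connected_def by auto
  let ?H = "del_verts G (inward k)"
  let ?r = "{(a, b). \<exists>e\<in>edges ?H. ends ?H e = {a, b}}"
  let ?W = "\<Union>j<k. V j"
  have step: "b \<in> ?W" if ab: "a \<in> ?W" "(a, b) \<in> ?r" for a b
  proof -
    obtain e where e: "e \<in> edges G" "ends G e = {a, b}" "ends G e \<inter> inward k = {}"
      using ab(2) unfolding del_verts_def by auto
    obtain j where j: "j < k" "a \<in> V j" using ab(1) by auto
    then obtain t where t: "a = c j t" unfolding V_def by auto
    have jn: "j \<le> n" using j k by simp
    consider "e \<in> C j" | u where "rung j e u a" | w where "rung (j + 1) e a w"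
      using edges_at[OF jn, of e t] e t by auto
    then show ?thesis
    proof cases
      case 1
      then show ?thesis using C_ends[OF jn] e j by blast
    next
      case 2
      then have "u = b" "u \<in> V (j - 1)" using e unfolding rung_def by (auto simp: doubleton_eq_iff)
      then show ?thesis using j by auto
    next
      case 3
      then have b: "w = b" "b \<in> V (j + 1)" using e unfolding rung_def by (auto simp: doubleton_eq_iff)
      have "b \<notin> inward k" using e by auto
      then have "j + 1 \<noteq> k" using 3 b unfolding inward_def by auto
      then show ?thesis using b j by force
    qed
  qed
  have reach: "b \<in> ?W" if "(a, b) \<in> ?r\<^sup>*" "a \<in> ?W" for a b
    using that by (induction rule: rtrancl_induct) (use step in blast)+
  \<comment> \<open>A target for the walk is left, because \<open>C k\<close> has at least three
    vertices.\<close>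
  have "V k - inward k \<noteq> {}"
  proof
    assume "V k - inward k = {}"
    then have "V k = inward k" using inward_V by auto
    moreover have "inj_on (c k) {0, 1, 2}"
      by (rule inj_onI, rule c_inj[OF k(2)]) (use l3[OF k(2)] in auto)
    then have "card (c k ` {0, 1, 2}) = 3" by (simp add: card_image)
    moreover have "c k ` {0, 1, 2} \<subseteq> V k" by auto
    moreover have "finite (V k)" using V_verts[OF k(2)] fin finite_subset by blast
    ultimately show False using neg card_mono by metis
  qed
  then obtain b where b: "b \<in> V k" "b \<notin> inward k" by auto
  have a: "c 0 0 \<in> V 0" by simp
  have "c 0 0 \<notin> inward k" using inward_V[of k] V_disjoint[of 0 k "c 0 0"] k by auto
  then have va: "c 0 0 \<in> verts ?H" using V_verts[of 0] unfolding del_verts_def by auto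
  have vb: "b \<in> verts ?H" using b V_verts[OF k(2)] unfolding del_verts_def by auto
  have "(c 0 0, b) \<in> ?r\<^sup>*" using con va vb unfolding connected_graph_def by blast
  moreover have "c 0 0 \<in> ?W" using k a by (intro UN_I[of 0]) auto
  ultimately have "b \<in> ?W" by (rule reach)
  then obtain j where "j < k" "b \<in> V j" by auto
  then show False using V_disjoint[of j k b] b k by auto
qed

text \<open>Integer indices record direction and lap. A translation by a multiple of
  \<open>l k\<close> describes the same stretch of \<open>C k\<close>, so gaps are compared up to
  such shifts.\<close>

definition gap :: "nat \<Rightarrow> int \<Rightarrow> int \<Rightarrow> bool" where
  "gap k i j \<longleftrightarrow> 1 \<le> k \<and> k \<le> n \<and> i < j \<and> c k i \<in> inward k \<and> c k j \<in> inward k \<and>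
     (\<forall>t. i < t \<and> t < j \<longrightarrow> c k t \<notin> inward k)"

text \<open>Another inward vertex, present because there are at least three, ends the gap within one
  lap. So the gap and the rest of \<open>C k\<close> form two arcs of a closed curve.\<close>

lemma gap_less:
  assumes "gap k i j" shows "j < i + l k" "c k i \<noteq> c k j"
proof -
  have k: "1 \<le> k" "k \<le> n" using assms unfolding gap_def by auto
  have "\<not> inward k \<subseteq> {c k i}"
  proof
    assume "inward k \<subseteq> {c k i}"
    then have "card (inward k) \<le> card {c k i}" by (rule card_mono[rotated]) simp
    then show False using card_inward[OF k] by simp
  qed
  then obtain v where v: "v \<in> inward k" "v \<noteq> c k i" by auto
  obtain t where t: "i \<le> t" "t < i + l k" "c k t = v" using V_window[OF k(2), of v i] v inward_V by blast
  have "t \<noteq> i" using t v by auto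
  then have "\<not> t < j" using assms t v unfolding gap_def by auto
  then show 1: "j < i + l k" using t by simp
  show "c k i \<noteq> c k j"
  proof
    assume "c k i = c k j"
    then have "i = j" using c_inj[OF k(2), of i j] 1 assms unfolding gap_def by auto
    then show False using assms unfolding gap_def by auto
  qed
qed

lemma inward_ex: "1 \<le> k \<Longrightarrow> k \<le> n \<Longrightarrow> \<exists>v. v \<in> inward k"
  using card_inward[of k] by (cases "inward k = {}") auto

lemma next_inward:
  assumes k: "1 \<le> k" "k \<le> n"
  obtains j where "i < j" "c k j \<in> inward k" "\<And>t. i < t \<Longrightarrow> t < j \<Longrightarrow> c k t \<notin> inward k"
proof -
  obtain v where v: "v \<in> inward k" using inward_ex[OF k] by blast
  obtain t where t: "i + 1 \<le> t" "c k t = v" using V_window[OF k(2), of v "i + 1"] v inward_V by blast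
  have ex: "\<exists>m::nat. 0 < m \<and> c k (i + int m) \<in> inward k"
    using t v by (intro exI[of _ "nat (t - i)"]) auto
  define m where "m = (LEAST m::nat. 0 < m \<and> c k (i + int m) \<in> inward k)"
  have m: "0 < m" "c k (i + int m) \<in> inward k" using LeastI_ex[OF ex] unfolding m_def by auto
  have "c k t \<notin> inward k" if "i < t" "t < i + int m" for t
    using not_less_Least[of "nat (t - i)" "\<lambda>m. 0 < m \<and> c k (i + int m) \<in> inward k"] that
    unfolding m_def[symmetric] by (auto simp: nat_less_iff)
  then show thesis using that[of "i + int m"] m by auto
qed

lemma prev_inward:
  assumes k: "1 \<le> k" "k \<le> n"
  obtains i where "i < j" "c k i \<in> inward k" "\<And>t. i < t \<Longrightarrow> t < j \<Longrightarrow> c k t \<notin> inward k"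
proof -
  obtain v where v: "v \<in> inward k" using inward_ex[OF k] by blast
  obtain t where t: "t < (j - l k) + l k" "c k t = v" using V_window[OF k(2), of v "j - l k"] v inward_V by blast
  have ex: "\<exists>m::nat. 0 < m \<and> c k (j - int m) \<in> inward k"
    using t v by (intro exI[of _ "nat (j - t)"]) auto
  define m where "m = (LEAST m::nat. 0 < m \<and> c k (j - int m) \<in> inward k)"
  have m: "0 < m" "c k (j - int m) \<in> inward k" using LeastI_ex[OF ex] unfolding m_def by auto
  have "c k t \<notin> inward k" if "j - int m < t" "t < j" for t
    using not_less_Least[of "nat (j - t)" "\<lambda>m. 0 < m \<and> c k (j - int m) \<in> inward k"] that
    unfolding m_def[symmetric] by (auto simp: nat_less_iff)
  then show thesis using that[of "j - int m"] m by auto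
qed

lemma gap_next:
  assumes "1 \<le> k" "k \<le> n" "c k i \<in> inward k"
  obtains j where "gap k i j"
  using next_inward[OF assms(1,2), of i] assms that unfolding gap_def by metis

lemma gap_prev:
  assumes "1 \<le> k" "k \<le> n" "c k j \<in> inward k"
  obtains i where "gap k i j"
  using prev_inward[OF assms(1,2), of j] assms that unfolding gap_def by metis

lemma gap_around:
  assumes "1 \<le> k" "k \<le> n" "c k t \<notin> inward k"
  obtains i j where "gap k i j" "i < t" "t < j"
proof -
  obtain i where i: "i < t" "c k i \<in> inward k" "\<And>s. i < s \<Longrightarrow> s < t \<Longrightarrow> c k s \<notin> inward k"
    by (rule prev_inward[OF assms(1,2), of t]) blast
  obtain j where j: "t < j" "c k j \<in> inward k" "\<And>s. t < s \<Longrightarrow> s < j \<Longrightarrow> c k s \<notin> inward k"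
    by (rule next_inward[OF assms(1,2), of t]) blast
  have "c k s \<notin> inward k" if "i < s" "s < j" for s
    using i(3)[of s] j(3)[of s] assms(3) that by (cases s t rule: linorder_cases) auto
  then have "gap k i j" unfolding gap_def using i j assms by auto
  then show thesis using i j that by blast
qed

lemma gap_shift: "gap k i j \<Longrightarrow> gap k (i + m * l k) (j + m * l k)"
proof -
  assume g: "gap k i j"
  then have k: "k \<le> n" unfolding gap_def by auto
  have "c k t \<notin> inward k" if "i + m * l k < t" "t < j + m * l k" for t
  proof -
    have "c k (t + (- m) * l k) \<notin> inward k" using g that unfolding gap_def by auto
    then show ?thesis using c_period[OF k] by metis
  qed
  then show ?thesis using g c_period[OF k] unfolding gap_def by auto
qed

section \<open>Faces of an annulus\<close>

abbreviation "cu \<equiv> merged_curve crv"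

lemma cu_Un: "cu (E \<union> F) = cu E \<union> cu F" and cu_single: "cu {e} = crv e"
  and cu_mono: "E \<subseteq> F \<Longrightarrow> cu E \<subseteq> cu F"
  unfolding merged_curve_def by auto

lemma pos_inj: "inj_on pos (verts G)"
  using plane unfolding plane_embedding_def by (rule conjunct1)

lemma crv_arc:
  assumes "e \<in> edges G" "ends G e = {u, v}"
  shows "arc_between (crv e) (pos u) (pos v)"
proof -
  obtain g where g: "arc g" "path_image g = crv e" "{pathstart g, pathfinish g} = pos ` ends G e"
    using plane[unfolded plane_embedding_def, THEN conjunct2, THEN conjunct1] assms(1) by blast
  then have "arc_between (crv e) (pathstart g) (pathfinish g)" unfolding arc_between_def by blast
  moreover have "{pathstart g, pathfinish g} = {pos u, pos v}" using g assms by simp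
  ultimately show ?thesis using arc_between_sym by (auto simp: doubleton_eq_iff)
qed

lemma crv_infinite: "e \<in> edges G \<Longrightarrow> infinite (crv e)"
  using crv_arc arc_between_infinite card_ends by (metis card_2_iff)

lemma pos_in_crv: "v \<in> verts G \<Longrightarrow> e \<in> edges G \<Longrightarrow> pos v \<in> crv e \<longleftrightarrow> v \<in> ends G e"
proof -
  assume v: "v \<in> verts G" and e: "e \<in> edges G"
  have "crv e \<inter> pos ` verts G = pos ` ends G e"
    using plane[unfolded plane_embedding_def, THEN conjunct2, THEN conjunct2, THEN conjunct1] e by blast
  then have "pos v \<in> crv e \<longleftrightarrow> pos v \<in> pos ` ends G e" using v by auto
  also have "\<dots> \<longleftrightarrow> v \<in> ends G e" using pos_inj ends_verts[OF e] v by (meson inj_on_image_mem_iff)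
  finally show ?thesis .
qed

lemma cverts_verts: "E \<subseteq> edges G \<Longrightarrow> cverts G E \<subseteq> verts G"
  unfolding cverts_def using ends_verts by blast

lemma pos_in_cu: "v \<in> verts G \<Longrightarrow> E \<subseteq> edges G \<Longrightarrow> pos v \<in> cu E \<longleftrightarrow> v \<in> cverts G E"
  unfolding merged_curve_def cverts_def using pos_in_crv by blast

lemma cu_Int:
  assumes "E \<subseteq> edges G" "F \<subseteq> edges G" "E \<inter> F = {}"
  shows "cu E \<inter> cu F = pos ` (cverts G E \<inter> cverts G F)"
proof -
  have eq: "crv e \<inter> crv f = pos ` (ends G e \<inter> ends G f)" if "e \<in> E" "f \<in> F" for e f
  proof -
    have "e \<noteq> f" "e \<in> edges G" "f \<in> edges G" using that assms by auto
    then show ?thesis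
      using plane[unfolded plane_embedding_def, THEN conjunct2, THEN conjunct2, THEN conjunct2] by blast
  qed
  show ?thesis
  proof
    show "cu E \<inter> cu F \<subseteq> pos ` (cverts G E \<inter> cverts G F)"
    proof
      fix z assume "z \<in> cu E \<inter> cu F"
      then obtain e f where ef: "e \<in> E" "f \<in> F" "z \<in> crv e" "z \<in> crv f"
        unfolding merged_curve_def by auto
      then have "z \<in> pos ` (ends G e \<inter> ends G f)" using eq by blast
      then show "z \<in> pos ` (cverts G E \<inter> cverts G F)" using ef unfolding cverts_def by blast
    qed
    show "pos ` (cverts G E \<inter> cverts G F) \<subseteq> cu E \<inter> cu F"
    proof
      fix z assume "z \<in> pos ` (cverts G E \<inter> cverts G F)"
      then obtain v where v: "z = pos v" "v \<in> cverts G E" "v \<in> cverts G F" by auto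
      then show "z \<in> cu E \<inter> cu F" using pos_in_cu assms cverts_verts by blast
    qed
  qed
qed

text \<open>Distinct edges meet at most in common ends, while an arc is infinite. This turns
  equalities between frontiers back into statements about edges.\<close>

lemma edge_in_if_crv_subset:
  assumes "e \<in> edges G" "E \<subseteq> edges G" "crv e \<subseteq> cu E"
  shows "e \<in> E"
proof (rule ccontr)
  assume "e \<notin> E"
  then have "cu {e} \<inter> cu E = pos ` (cverts G {e} \<inter> cverts G E)"
    by (intro cu_Int) (use assms in auto)
  then have "crv e \<subseteq> pos ` ends G e" using assms unfolding cu_single cverts_def by auto
  moreover have "finite (ends G e)" using card_ends[OF assms(1)] card.infinite by fastforce
  ultimately show False using crv_infinite[OF assms(1)] finite_subset by blast
qed

section \<open>Arcs of the cycles and the curves they trace\<close>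

definition seg :: "nat \<Rightarrow> int \<Rightarrow> int \<Rightarrow> 'e set" where "seg k i j = ed k ` {i..<j}"

lemma seg_edges: "k \<le> n \<Longrightarrow> seg k i j \<subseteq> edges G"
  unfolding seg_def using ed_edge by auto

lemma seg_C: "k \<le> n \<Longrightarrow> seg k i j \<subseteq> C k"
  unfolding seg_def C_eq by auto

lemma cverts_seg: "k \<le> n \<Longrightarrow> i < j \<Longrightarrow> cverts G (seg k i j) = c k ` {i..j}"
proof
  assume k: "k \<le> n" and ij: "i < j"
  show "cverts G (seg k i j) \<subseteq> c k ` {i..j}"
    unfolding cverts_def seg_def using ends_ed[OF k] by auto
  show "c k ` {i..j} \<subseteq> cverts G (seg k i j)"
  proof
    fix v assume "v \<in> c k ` {i..j}"
    then obtain t where t: "v = c k t" "i \<le> t" "t \<le> j" by auto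
    define s where "s = (if t = j then j - 1 else t)"
    have "v \<in> ends G (ed k s)" "i \<le> s" "s < j" using t ij ends_ed[OF k] unfolding s_def by auto
    then show "v \<in> cverts G (seg k i j)" unfolding cverts_def seg_def by auto
  qed
qed

lemma C_window: "k \<le> n \<Longrightarrow> C k = seg k i (i + l k)"
proof -
  assume k: "k \<le> n"
  have "ed k t \<in> ed k ` {i..<i + l k}" for t
  proof -
    obtain m where m: "i \<le> t + m * l k" "t + m * l k < i + l k" using shift_window[OF k] .
    have "ed k t = ed k (t + m * l k)" using ed_eq[OF k] by simp
    then show ?thesis using m by auto
  qed
  then show ?thesis unfolding seg_def C_eq[OF k] by auto
qed

lemma C_split:
  assumes k: "k \<le> n" and ij: "i < j" "j < i + l k"
  shows "C k = seg k i j \<union> seg k j (i + l k)" "seg k i j \<inter> seg k j (i + l k) = {}"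
    "c k ` {i..j} \<inter> c k ` {j..i + l k} = {c k i, c k j}"
proof -
  show "C k = seg k i j \<union> seg k j (i + l k)"
    unfolding C_window[OF k, of i] seg_def using ij by (auto simp flip: image_Un)
  show "seg k i j \<inter> seg k j (i + l k) = {}"
  proof -
    have False if "ed k s = ed k t" "i \<le> s" "s < j" "j \<le> t" "t < i + l k" for s t
      using mod_close[of s "l k" t] ed_eq[OF k] that by auto
    then show ?thesis unfolding seg_def by (auto 4 4)
  qed
  have p: "c k (i + l k) = c k i" using c_period[OF k, of i 1] by simp
  show "c k ` {i..j} \<inter> c k ` {j..i + l k} = {c k i, c k j}"
  proof
    show "c k ` {i..j} \<inter> c k ` {j..i + l k} \<subseteq> {c k i, c k j}"
    proof
      fix v assume "v \<in> c k ` {i..j} \<inter> c k ` {j..i + l k}"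
      then obtain s t where st: "v = c k s" "v = c k t" "i \<le> s" "s \<le> j" "j \<le> t" "t \<le> i + l k" by fastforce
      show "v \<in> {c k i, c k j}"
      proof (cases "t = i + l k \<or> t = j")
        case True
        then show ?thesis using st p by auto
      next
        case False
        then have "s = t" using c_inj[OF k, of s t] st by auto
        then show ?thesis using st False by auto
      qed
    qed
    have "c k i \<in> c k ` {j..i + l k}" unfolding p[symmetric] using ij by auto
    then show "{c k i, c k j} \<subseteq> c k ` {i..j} \<inter> c k ` {j..i + l k}" using ij by auto
  qed
qed

text \<open>Induction on the right end: below a full lap the next vertex is new, so the next edge
  meets the arc traced so far only in its starting point.\<close>

lemma seg_arc:
  assumes k: "k \<le> n" and ij: "i < j" "j < i + l k"
  shows "arc_between (cu (seg k i j)) (pos (c k i)) (pos (c k j))"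
  using ij
proof (induction j rule: int_gr_induct)
  case base
  have "seg k i (i + 1) = {ed k i}" unfolding seg_def by auto
  then show ?case using crv_arc[OF ed_edge[OF k] ends_ed[OF k]] by (simp add: cu_single)
next
  case (step j)
  have eq: "seg k i (j + 1) = seg k i j \<union> {ed k j}"
  proof -
    have "{i..<j + 1} = {i..<j} \<union> {j}" using step by auto
    then show ?thesis unfolding seg_def by simp
  qed
  have nin: "ed k j \<notin> seg k i j"
  proof
    assume "ed k j \<in> seg k i j"
    then obtain s where "ed k j = ed k s" "i \<le> s" "s < j" unfolding seg_def by auto
    then show False using mod_close[of s "l k" j] ed_eq[OF k] step by auto
  qed
  have "cu (seg k i j) \<inter> cu {ed k j} = pos ` (c k ` {i..j} \<inter> {c k j, c k (j + 1)})"
    using cu_Int[OF seg_edges[OF k, of i j], of "{ed k j}"] nin ed_edge[OF k] cverts_seg[OF k \<open>i < j\<close>] ends_ed[OF k]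
    unfolding cverts_def by simp
  also have "c k ` {i..j} \<inter> {c k j, c k (j + 1)} = {c k j}"
  proof -
    have "c k (j + 1) \<noteq> c k s" if "i \<le> s" "s \<le> j" for s
      using c_inj[OF k, of "j + 1" s] that step by auto
    then show ?thesis using step by force
  qed
  finally have int: "cu (seg k i j) \<inter> crv (ed k j) = {pos (c k j)}" by (simp add: cu_single)
  have "arc_between (cu (seg k i j) \<union> crv (ed k j)) (pos (c k i)) (pos (c k (j + 1)))"
    by (rule arc_between_join[OF _ crv_arc[OF ed_edge[OF k] ends_ed[OF k]] int])
      (use step in simp)
  then show ?case unfolding eq cu_Un cu_single .
qed

lemma C_curve:
  assumes k: "k \<le> n" and ij: "i < j" "j < i + l k"
  shows "arc_between (cu (seg k i j)) (pos (c k i)) (pos (c k j))"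
    "arc_between (cu (seg k j (i + l k))) (pos (c k i)) (pos (c k j))"
    "cu (seg k i j) \<inter> cu (seg k j (i + l k)) = {pos (c k i), pos (c k j)}"
    "cu (C k) = cu (seg k i j) \<union> cu (seg k j (i + l k))"
proof -
  have p: "c k (i + l k) = c k i" using c_period[OF k, of i 1] by simp
  show "arc_between (cu (seg k i j)) (pos (c k i)) (pos (c k j))" by (rule seg_arc[OF assms])
  show "arc_between (cu (seg k j (i + l k))) (pos (c k i)) (pos (c k j))"
    using arc_between_sym[OF seg_arc[OF k, of j "i + l k"]] ij p by simp
  show "cu (seg k i j) \<inter> cu (seg k j (i + l k)) = {pos (c k i), pos (c k j)}"
    using cu_Int[OF seg_edges[OF k] seg_edges[OF k] C_split(2)[OF assms]] C_split(3)[OF assms]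
      cverts_seg[OF k, of i j] cverts_seg[OF k, of j "i + l k"] ij by simp
  show "cu (C k) = cu (seg k i j) \<union> cu (seg k j (i + l k))"
    using C_split(1)[OF assms] cu_Un by simp
qed

lemma C_jordan:
  assumes k: "k \<le> n"
  shows "frontier (inside (cu (C k))) = cu (C k)" "open (inside (cu (C k)))"
    "connected (inside (cu (C k)))"
    "K \<subseteq> inside (cu (C k)) \<Longrightarrow> inside K \<subseteq> inside (cu (C k))"
proof -
  have ij: "(0::int) < 1" "1 < 0 + l k" using l3[OF k] by auto
  note J = C_curve[OF k ij]
  show "frontier (inside (cu (C k))) = cu (C k)" "open (inside (cu (C k)))"
    "connected (inside (cu (C k)))"
    unfolding J(4) by (rule closed_curve_props[OF J(1-3)])+
  show "K \<subseteq> inside (cu (C k)) \<Longrightarrow> inside K \<subseteq> inside (cu (C k))"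
    unfolding J(4) by (rule inside_subset_of_nested[OF J(1-3)])
qed

lemma cu_C_Int:
  assumes "k \<le> n" "e \<in> edges G" "e \<notin> C k"
  shows "crv e \<inter> cu (C k) = pos ` (ends G e \<inter> V k)"
  using cu_Int[of "{e}" "C k"] assms C_edges[of k] cverts_C[of k]
  unfolding cu_single by (auto simp: cverts_def)

lemma rung_Int:
  assumes "rung k e u v"
  shows "crv e \<inter> cu (C k) = {pos v}" "crv e \<inter> cu (C (k - 1)) = {pos u}"
proof -
  have r: "1 \<le> k" "k \<le> n" "e \<in> edges G" "ends G e = {u, v}" "u \<in> V (k - 1)" "v \<in> V k"
    using assms unfolding rung_def by auto
  have k': "k - 1 \<le> n" "k \<noteq> k - 1" using r by auto
  have "u \<notin> V k" "v \<notin> V (k - 1)"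
    using V_disjoint[OF r(2) k'(1)] r k'(2) by auto
  then show "crv e \<inter> cu (C k) = {pos v}" "crv e \<inter> cu (C (k - 1)) = {pos u}"
    using cu_C_Int[OF r(2,3)] cu_C_Int[OF k'(1) r(3)] r rung_notin_C[OF assms] k' by auto
qed

lemma rung_arc: "rung k e u v \<Longrightarrow> arc_between (crv e) (pos v) (pos u)"
  using crv_arc[of e u v] arc_between_sym unfolding rung_def by blast

lemma rung_disjoint:
  assumes "rung k e u v" "rung k e' u' v'" "v \<noteq> v'"
  shows "e \<noteq> e'" "u \<noteq> u'" "crv e \<inter> crv e' = {}"
proof -
  have k: "k \<le> n" "k - 1 \<le> n" "k \<noteq> k - 1" using assms unfolding rung_def by auto
  have dis: "w \<notin> V k" if "w \<in> V (k - 1)" for w using V_disjoint[OF k(1,2)] k(3) that by auto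
  show u: "u \<noteq> u'" using rung_inner_unique assms by blast
  show e: "e \<noteq> e'"
  proof
    assume "e = e'"
    then have "{u, v} = {u', v'}" using assms unfolding rung_def by auto
    then have "u = v'" using u by (auto simp: doubleton_eq_iff)
    then show False using dis[of u] assms unfolding rung_def by auto
  qed
  have "u \<noteq> v'" "v \<noteq> u'"
    using dis[of u] dis[of u'] assms unfolding rung_def by auto
  then show "crv e \<inter> crv e' = {}"
    using cu_Int[of "{e}" "{e'}"] assms u e unfolding cu_single rung_def by (auto simp: cverts_def)
qed

section \<open>The drawing up to level \<open>k\<close> and its faces in the outer annulus\<close>

definition sub_edges :: "nat \<Rightarrow> 'e set" where
  "sub_edges k = (\<Union>j\<le>k. C j) \<union> (\<Union>j\<in>{1..k}. rungs G C j)"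

lemma sub_edgesI: "j \<le> k \<Longrightarrow> C j \<subseteq> sub_edges k" "1 \<le> j \<Longrightarrow> j \<le> k \<Longrightarrow> rungs G C j \<subseteq> sub_edges k"
  unfolding sub_edges_def by fastforce+

lemma sub_edges_Suc: "sub_edges (Suc m) = sub_edges m \<union> C (Suc m) \<union> rungs G C (Suc m)"
  unfolding sub_edges_def by (auto simp: atMost_Suc atLeastAtMostSuc_conv)

lemma sub_edges_edges: "k \<le> n \<Longrightarrow> sub_edges k \<subseteq> edges G"
  unfolding sub_edges_def edges_eq by auto

text \<open>Lower levels are inside by nesting. A rung meets \<open>C (Suc m)\<close> only in its
  outer end and has its foot inside, so connectedness keeps it inside.\<close>

lemma sub_edges_inside:
  "m \<le> n \<Longrightarrow> cu (sub_edges m) \<subseteq> cu (C m) \<union> inside (cu (C m))"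
proof (induction m)
  case 0
  then show ?case unfolding sub_edges_def by auto
next
  case (Suc m)
  have nst: "cu (C m) \<subseteq> inside (cu (C (Suc m)))" using nested[of "Suc m"] Suc.prems by simp
  have 1: "cu (sub_edges m) \<subseteq> inside (cu (C (Suc m)))"
    using Suc nst C_jordan(4)[OF Suc.prems nst] by auto
  have "crv e \<subseteq> cu (C (Suc m)) \<union> inside (cu (C (Suc m)))" if e: "e \<in> rungs G C (Suc m)" for e
  proof -
    obtain u v where r: "rung (Suc m) e u v" using rungs_iff Suc.prems e by auto
    note I = rung_Int[OF r]
    have u: "pos u \<in> crv e - {pos v}" "pos u \<in> inside (cu (C (Suc m)))"
      using arc_between_ends[OF rung_arc[OF r]] I(2) nst by auto
    have "(crv e - {pos v}) - inside (cu (C (Suc m))) = {}"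
    proof (rule ccontr)
      assume "(crv e - {pos v}) - inside (cu (C (Suc m))) \<noteq> {}"
      then have "(crv e - {pos v}) \<inter> frontier (inside (cu (C (Suc m)))) \<noteq> {}"
        using connected_Int_frontier[OF arc_between_minus_end(1)[OF arc_between_sym[OF rung_arc[OF r]]]] u
        by blast
      then show False unfolding C_jordan(1)[OF Suc.prems] using I by auto
    qed
    then show ?thesis using I by auto
  qed
  then have "cu (rungs G C (Suc m)) \<subseteq> cu (C (Suc m)) \<union> inside (cu (C (Suc m)))"
    unfolding merged_curve_def by blast
  then show ?case unfolding sub_edges_Suc cu_Un using 1 by blast
qed

lemma gapD: "gap k i j \<Longrightarrow> 1 \<le> k" "gap k i j \<Longrightarrow> k \<le> n" "gap k i j \<Longrightarrow> k - 1 \<le> n"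
  "gap k i j \<Longrightarrow> i < j" "gap k i j \<Longrightarrow> c k i \<in> inward k" "gap k i j \<Longrightarrow> c k j \<in> inward k"
  "gap k i j \<Longrightarrow> i < t \<Longrightarrow> t < j \<Longrightarrow> c k t \<notin> inward k"
  unfolding gap_def by (simp_all, linarith)

text \<open>\<open>i'\<close> and \<open>j'\<close> index the feet, ordered so that the arc of
  \<open>C (k - 1)\<close> running upwards from \<open>i'\<close> to \<open>j'\<close> is the one
  facing the gap. Which of them is the foot of \<open>r\<close> stays open, since the two cycles may
  be oriented oppositely.\<close>

definition gap_sector :: "nat \<Rightarrow> int \<Rightarrow> int \<Rightarrow> 'e \<Rightarrow> 'e \<Rightarrow> int \<Rightarrow> int \<Rightarrow> bool" where
  "gap_sector k i j r s i' j' \<longleftrightarrow> gap k i j \<and> i' < j' \<and> j' < i' + l (k - 1) \<and>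
    (\<exists>a b. rung k r a (c k i) \<and> rung k s b (c k j) \<and> {c (k - 1) i', c (k - 1) j'} = {a, b} \<and>
      sector (cu (seg k i j)) (cu (seg k j (i + l k))) (cu (seg (k - 1) i' j'))
        (cu (seg (k - 1) j' (i' + l (k - 1)))) (crv r) (crv s)
        (pos (c k i)) (pos (c k j)) (pos a) (pos b))"

lemma gap_sectorE:
  assumes "gap_sector k i j r s i' j'"
  obtains a b where "gap k i j" "i' < j'" "j' < i' + l (k - 1)"
    "rung k r a (c k i)" "rung k s b (c k j)" "{c (k - 1) i', c (k - 1) j'} = {a, b}"
    "sector (cu (seg k i j)) (cu (seg k j (i + l k))) (cu (seg (k - 1) i' j'))
      (cu (seg (k - 1) j' (i' + l (k - 1)))) (crv r) (crv s)
      (pos (c k i)) (pos (c k j)) (pos a) (pos b)"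
  using assms unfolding gap_sector_def by (elim conjE exE) (rule that; assumption)

lemma gap_sectorI:
  assumes "gap k i j" "i' < j'" "j' < i' + l (k - 1)"
    "rung k r a (c k i)" "rung k s b (c k j)" "{c (k - 1) i', c (k - 1) j'} = {a, b}"
    "sector (cu (seg k i j)) (cu (seg k j (i + l k))) (cu (seg (k - 1) i' j'))
      (cu (seg (k - 1) j' (i' + l (k - 1)))) (crv r) (crv s)
      (pos (c k i)) (pos (c k j)) (pos a) (pos b)"
  shows "gap_sector k i j r s i' j'"
  unfolding gap_sector_def using assms by (intro conjI exI[of _ a] exI[of _ b])

text \<open>The two rungs cut the annulus, and \<open>inner_arc_cases\<close> decides which arc
  between the feet faces the gap.\<close>

lemma gap_sector_ex:
  assumes g: "gap k i j" and r: "rung k r a (c k i)" and s: "rung k s b (c k j)"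
  obtains i' j' where "gap_sector k i j r s i' j'"
proof -
  have k: "1 \<le> k" "k \<le> n" and k': "k - 1 \<le> n" and ij: "i < j" using gapD[OF g] by simp_all
  note g' = gap_less[OF g]
  note RS = rung_disjoint[OF r s g'(2)]
  obtain i' where i': "c (k - 1) i' = a"
    using V_window[OF k', of a] r unfolding rung_def by blast
  obtain j' where j': "i' \<le> j'" "j' < i' + l (k - 1)" "c (k - 1) j' = b"
    using V_window[OF k', of b i'] s unfolding rung_def by blast
  have "i' \<noteq> j'" using i' j' RS by auto
  then have ij': "i' < j'" using j' by simp
  note X = C_curve[OF k(2) ij g'(1)]
  note A = C_curve[OF k' ij' j'(2)]
  note rI = rung_Int[OF r] and sI = rung_Int[OF s]
  interpret cut_annulus "cu (seg k i j)" "cu (seg k j (i + l k))" "cu (seg (k - 1) i' j')"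
    "cu (seg (k - 1) j' (i' + l (k - 1)))" "crv r" "crv s"
    "pos (c k i)" "pos (c k j)" "pos a" "pos b"
  proof
    show "cu (seg (k - 1) i' j') \<union> cu (seg (k - 1) j' (i' + l (k - 1))) \<subseteq>
      inside (cu (seg k i j) \<union> cu (seg k j (i + l k)))"
      using nested[OF k] unfolding X(4) A(4) .
    show "crv r \<inter> (cu (seg k i j) \<union> cu (seg k j (i + l k))) = {pos (c k i)}"
      "crv s \<inter> (cu (seg k i j) \<union> cu (seg k j (i + l k))) = {pos (c k j)}"
      using rI sI unfolding X(4) by auto
    show "crv r \<inter> (cu (seg (k - 1) i' j') \<union> cu (seg (k - 1) j' (i' + l (k - 1)))) = {pos a}"
      "crv s \<inter> (cu (seg (k - 1) i' j') \<union> cu (seg (k - 1) j' (i' + l (k - 1)))) = {pos b}"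
      using rI sI unfolding A(4) by auto
  qed (use X A i' j' rung_arc[OF r] rung_arc[OF s] RS in simp_all)
  from inner_arc_cases show thesis
  proof
    assume "cu (seg (k - 1) j' (i' + l (k - 1))) \<inter>
      inside (cu (seg k j (i + l k)) \<union> (crv r \<union> cu (seg (k - 1) i' j') \<union> crv s)) \<noteq> {}"
    then interpret s1: sector "cu (seg k i j)" "cu (seg k j (i + l k))" "cu (seg (k - 1) i' j')"
    "cu (seg (k - 1) j' (i' + l (k - 1)))" "crv r" "crv s"
    "pos (c k i)" "pos (c k j)" "pos a" "pos b"
      by unfold_locales
    have "gap_sector k i j r s i' j'"
      by (rule gap_sectorI[OF g ij' j'(2) r s _ s1.sector_axioms]) (simp only: i' j'(3))
    then show thesis by (rule that)
  next
    interpret sw: cut_annulus "cu (seg k i j)" "cu (seg k j (i + l k))"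
      "cu (seg (k - 1) j' (i' + l (k - 1)))" "cu (seg (k - 1) i' j')" "crv r" "crv s"
      "pos (c k i)" "pos (c k j)" "pos a" "pos b" by (rule swap_inner)
    assume "cu (seg (k - 1) i' j') \<inter>
      inside (cu (seg k j (i + l k)) \<union> (crv r \<union> cu (seg (k - 1) j' (i' + l (k - 1))) \<union> crv s)) \<noteq> {}"
    then interpret s2: sector "cu (seg k i j)" "cu (seg k j (i + l k))"
      "cu (seg (k - 1) j' (i' + l (k - 1)))" "cu (seg (k - 1) i' j')" "crv r" "crv s"
      "pos (c k i)" "pos (c k j)" "pos a" "pos b"
      by unfold_locales
    \<comment> \<open>The facing arc now runs from \<open>j'\<close> to
      \<open>i' + l (k - 1)\<close>. Its complement must end one lap after \<open>j'\<close>, and is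
      the arc from \<open>i'\<close> to \<open>j'\<close> shifted by that lap.\<close>
    have "seg (k - 1) (i' + l (k - 1)) (j' + l (k - 1)) = seg (k - 1) i' j'"
    proof -
      have "{i' + l (k - 1)..<j' + l (k - 1)} = (\<lambda>t. t + l (k - 1)) ` {i'..<j'}" by simp
      moreover have "ed (k - 1) (t + l (k - 1)) = ed (k - 1) t" for t using ed_eq[OF k'] by simp
      ultimately show ?thesis unfolding seg_def by (simp only: image_image)
    qed
    moreover have "c (k - 1) (i' + l (k - 1)) = a" using c_period[OF k', of i' 1] i' by simp
    ultimately have "gap_sector k i j r s j' (i' + l (k - 1))"
      using s2.sector_axioms ij' j'
      by (intro gap_sectorI[OF g _ _ r s]) (auto simp: insert_commute)
    then show thesis by (rule that)
  qed
qed

definition gap_face :: "nat \<Rightarrow> int \<Rightarrow> int \<Rightarrow> 'e \<Rightarrow> 'e \<Rightarrow> int \<Rightarrow> int \<Rightarrow> complex set" where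
  "gap_face k i j r s i' j' = inside (cu (seg k i j) \<union> (crv r \<union> cu (seg (k - 1) i' j') \<union> crv s))"

text \<open>The outer end is inward, so it is not in the interior of the gap; being neither of its
  ends, it lies on the complementary arc, and \<open>other_arc\<close> applies.\<close>

lemma gap_sector_other_rung:
  assumes gs: "gap_sector k i j r s i' j'" and e: "rung k e u v" "v \<noteq> c k i" "v \<noteq> c k j"
  shows "crv e \<inter> gap_face k i j r s i' j' = {}" "pos u \<notin> cu (seg (k - 1) i' j')"
proof -
  obtain a b where g: "gap k i j" and ij': "i' < j'" "j' < i' + l (k - 1)"
    and r: "rung k r a (c k i)" and s: "rung k s b (c k j)"
    and "{c (k - 1) i', c (k - 1) j'} = {a, b}"
    and sec: "sector (cu (seg k i j)) (cu (seg k j (i + l k))) (cu (seg (k - 1) i' j'))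
        (cu (seg (k - 1) j' (i' + l (k - 1)))) (crv r) (crv s)
        (pos (c k i)) (pos (c k j)) (pos a) (pos b)"
    using gap_sectorE[OF gs] .
  interpret sector "cu (seg k i j)" "cu (seg k j (i + l k))" "cu (seg (k - 1) i' j')"
    "cu (seg (k - 1) j' (i' + l (k - 1)))" "crv r" "crv s"
    "pos (c k i)" "pos (c k j)" "pos a" "pos b" by (rule sec)
  have k: "1 \<le> k" "k \<le> n" and k': "k - 1 \<le> n" and ij: "i < j" using gapD[OF g] by simp_all
  note X = C_curve[OF k(2) ij gap_less(1)[OF g]]
  note A = C_curve[OF k' ij']
  have v: "v \<in> inward k" "v \<in> V k" using e unfolding inward_def rung_def by auto
  have "v \<noteq> c k t" if "i \<le> t" "t \<le> j" for t
    using gapD(7)[OF g, of t] v e that by (cases "t = i \<or> t = j") auto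
  then have "v \<notin> cverts G (seg k i j)" unfolding cverts_seg[OF k(2) ij] by (simp add: image_iff)
  then have vX: "pos v \<notin> cu (seg k i j)"
    using pos_in_cu[OF _ seg_edges[OF k(2)]] v V_verts[OF k(2)] by blast
  note I = rung_Int[OF e(1)]
  have "crv e \<inter> crv r = {}" "crv e \<inter> crv s = {}"
    using rung_disjoint(3)[OF e(1) r e(2)] rung_disjoint(3)[OF e(1) s e(3)] by auto
  note other = other_arc[OF rung_arc[OF e(1)] I(1)[unfolded X(4)] vX I(2)[unfolded A(4)] this]
  show "crv e \<inter> gap_face k i j r s i' j' = {}" "pos u \<notin> cu (seg (k - 1) i' j')"
    using other unfolding gap_face_def by auto
qed

text \<open>An outward vertex strictly between the feet would be the foot of a third rung, landing
  on the facing arc.\<close>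

lemma gap_sector_feet:
  assumes gs: "gap_sector k i j r s i' j'" and t: "i' < t" "t < j'"
  shows "c (k - 1) t \<notin> outward (k - 1)"
proof
  assume "c (k - 1) t \<in> outward (k - 1)"
  obtain a b where g: "gap k i j" and ij': "i' < j'" "j' < i' + l (k - 1)"
    and r: "rung k r a (c k i)" and s: "rung k s b (c k j)"
    and ab: "{c (k - 1) i', c (k - 1) j'} = {a, b}"
    and "sector (cu (seg k i j)) (cu (seg k j (i + l k))) (cu (seg (k - 1) i' j'))
        (cu (seg (k - 1) j' (i' + l (k - 1)))) (crv r) (crv s)
        (pos (c k i)) (pos (c k j)) (pos a) (pos b)"
    using gap_sectorE[OF gs] .
  have k: "1 \<le> k" "k \<le> n" and k': "k - 1 \<le> n" using gapD[OF g] by simp_all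
  obtain e v where e: "rung k e (c (k - 1) t) v"
    using \<open>c (k - 1) t \<in> outward (k - 1)\<close> k unfolding outward_def by auto
  have "c (k - 1) t \<noteq> c (k - 1) i'" "c (k - 1) t \<noteq> c (k - 1) j'"
    using c_inj[OF k', of t i'] c_inj[OF k', of t j'] t ij' by auto
  then have "c (k - 1) t \<noteq> a" "c (k - 1) t \<noteq> b" using ab by (auto simp: doubleton_eq_iff)
  then have "v \<noteq> c k i" "v \<noteq> c k j" using rung_outer_unique(2) e r s by blast+
  then have "pos (c (k - 1) t) \<notin> cu (seg (k - 1) i' j')"
    using gap_sector_other_rung(2)[OF gs e] by blast
  moreover have "c (k - 1) t \<in> cverts G (seg (k - 1) i' j')"
    unfolding cverts_seg[OF k' ij'(1)] using t by auto
  ultimately show False using pos_in_cu[OF _ seg_edges[OF k']] V_verts[OF k'] by (metis c_in_V subsetD)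
qed

text \<open>Nothing drawn up to level \<open>k\<close> enters the region: lower levels lie in the
  closed hole, and other rungs are kept out by the crossing argument. The last claim carries
  \<open>unique_face_at_X\<close> over to edges of the gap.\<close>

lemma gap_face_props:
  assumes gs: "gap_sector k i j r s i' j'"
  defines "F \<equiv> gap_face k i j r s i' j'"
  shows "open F" "connected F" "F \<noteq> {}"
    "frontier F = cu (seg k i j \<union> {r, s} \<union> seg (k - 1) i' j')"
    "F \<inter> cu (sub_edges k) = {}" "F \<subseteq> annulus crv C k"
    "\<And>H e. H \<inter> cu (sub_edges k) = {} \<Longrightarrow> H \<subseteq> inside (cu (C k)) \<Longrightarrow> H \<inter> F = {} \<Longrightarrow>
      e \<in> seg k i j \<Longrightarrow> \<not> crv e \<subseteq> frontier H"
proof -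
  obtain a b where g: "gap k i j" and ij': "i' < j'" "j' < i' + l (k - 1)"
    and r: "rung k r a (c k i)" and s: "rung k s b (c k j)"
    and ab: "{c (k - 1) i', c (k - 1) j'} = {a, b}"
    and sec: "sector (cu (seg k i j)) (cu (seg k j (i + l k))) (cu (seg (k - 1) i' j'))
        (cu (seg (k - 1) j' (i' + l (k - 1)))) (crv r) (crv s)
        (pos (c k i)) (pos (c k j)) (pos a) (pos b)"
    using gap_sectorE[OF gs] .
  interpret sector "cu (seg k i j)" "cu (seg k j (i + l k))" "cu (seg (k - 1) i' j')"
    "cu (seg (k - 1) j' (i' + l (k - 1)))" "crv r" "crv s"
    "pos (c k i)" "pos (c k j)" "pos a" "pos b" by (rule sec)
  have k: "1 \<le> k" "k \<le> n" and k': "k - 1 \<le> n" and ij: "i < j" using gapD[OF g] by simp_all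
  note X = C_curve[OF k(2) ij gap_less(1)[OF g]]
  note A = C_curve[OF k' ij']
  have Feq: "F = inside (cu (seg k i j) \<union> (crv r \<union> cu (seg (k - 1) i' j') \<union> crv s))"
    unfolding F_def gap_face_def ..
  show "open F" "connected F" "F \<noteq> {}" unfolding Feq by (rule F_props)+
  have cu_eq: "cu (seg k i j \<union> {r, s} \<union> seg (k - 1) i' j') =
    cu (seg k i j) \<union> (crv r \<union> cu (seg (k - 1) i' j') \<union> crv s)"
    unfolding merged_curve_def by auto
  show fr: "frontier F = cu (seg k i j \<union> {r, s} \<union> seg (k - 1) i' j')"
    unfolding cu_eq Feq by (rule F_props)
  have bd: "F \<inter> cu (C k) = {}" "F \<inter> cu (C (k - 1)) = {}" "F \<inter> crv r = {}" "F \<inter> crv s = {}"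
    using F_disjoint_boundary unfolding Feq X(4) A(4) by blast+
  have ins: "F \<inter> inside (cu (C (k - 1))) = {}"
    using F_disjoint_inside unfolding Feq A(4) .
  have low: "F \<inter> cu (sub_edges (k - 1)) = {}"
    using sub_edges_inside[OF k'] bd ins by blast
  have rg: "F \<inter> cu (rungs G C k) = {}"
  proof -
    have "F \<inter> crv e = {}" if "e \<in> rungs G C k" for e
    proof -
      obtain u v where e: "rung k e u v" using rungs_iff[OF k, of e] \<open>e \<in> rungs G C k\<close> by blast
      consider "v = c k i" | "v = c k j" | "v \<noteq> c k i" "v \<noteq> c k j" by blast
      then show ?thesis
      proof cases
        case 1
        then have "e = r" using rung_outer_unique(1) e r by blast
        then show ?thesis using bd by simp
      next
        case 2
        then have "e = s" using rung_outer_unique(1) e s by blast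
        then show ?thesis using bd by simp
      next
        case 3
        then show ?thesis using gap_sector_other_rung(1)[OF gs e] unfolding F_def by blast
      qed
    qed
    then show ?thesis unfolding merged_curve_def by blast
  qed
  have "sub_edges k = sub_edges (k - 1) \<union> C k \<union> rungs G C k"
    using sub_edges_Suc[of "k - 1"] k by simp
  then show "F \<inter> cu (sub_edges k) = {}" using low rg bd(1) by (simp add: cu_Un Int_Un_distrib)
  show "F \<subseteq> annulus crv C k"
    using F_subset ins unfolding annulus_def Feq X(4) by blast
  fix H e
  assume H: "H \<inter> cu (sub_edges k) = {}" "H \<subseteq> inside (cu (C k))" "H \<inter> F = {}" and e: "e \<in> seg k i j"
  have "{r, s} \<union> seg (k - 1) i' j' \<subseteq> sub_edges k"
  proof -
    have "r \<in> rungs G C k" "s \<in> rungs G C k" using rungs_iff[OF k] r s by blast+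
    moreover have "seg (k - 1) i' j' \<subseteq> C (k - 1)" by (rule seg_C[OF k'])
    moreover have "C (k - 1) \<subseteq> sub_edges k" "rungs G C k \<subseteq> sub_edges k"
      using sub_edgesI[of "k - 1" k] sub_edgesI[of k k] k by auto
    ultimately show ?thesis by blast
  qed
  then have "cu ({r, s} \<union> seg (k - 1) i' j') \<subseteq> cu (sub_edges k)" by (rule cu_mono)
  moreover have "cu ({r, s} \<union> seg (k - 1) i' j') = crv r \<union> cu (seg (k - 1) i' j') \<union> crv s"
    unfolding merged_curve_def by auto
  ultimately have "H \<inter> (crv r \<union> cu (seg (k - 1) i' j') \<union> crv s) = {}" using H by auto
  then have sub: "frontier H \<inter> cu (seg k i j) \<subseteq> {pos (c k i), pos (c k j)}"
    using unique_face_at_X[of H] H unfolding Feq X(4) by blast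
  show "\<not> crv e \<subseteq> frontier H"
  proof
    assume "crv e \<subseteq> frontier H"
    moreover have "crv e \<subseteq> cu (seg k i j)" using e unfolding merged_curve_def by blast
    ultimately have "crv e \<subseteq> {pos (c k i), pos (c k j)}" using sub by blast
    then have "finite (crv e)" using finite_subset by blast
    then show False using crv_infinite seg_edges[OF k(2)] e by blast
  qed
qed

section \<open>The restriction after suppression of vertices of degree 2\<close>

abbreviation restr :: "nat \<Rightarrow> ('v, 'e) mgraph" where
  "restr k \<equiv> G\<lparr>verts := (\<Union>j\<le>k. cverts G (C j)), edges := sub_edges k\<rparr>"

lemma annular_restriction_eq: "annular_restriction G C k = suppress (restr k)"
  unfolding annular_restriction_def sub_edges_def ..

lemma joined_restr: "joined_at_degree_2 (restr k) \<subseteq> sub_edges k \<times> sub_edges k"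
  unfolding joined_at_degree_2_def by auto

lemma class_subset:
  assumes "X \<in> edges (annular_restriction G C k)"
  shows "X \<subseteq> sub_edges k" "\<exists>e\<in>sub_edges k. X = (joined_at_degree_2 (restr k))\<^sup>* `` {e}"
proof -
  let ?r = "joined_at_degree_2 (restr k)"
  show ex: "\<exists>e\<in>sub_edges k. X = ?r\<^sup>* `` {e}"
    using assms unfolding annular_restriction_eq suppress_def quotient_def by auto
  then obtain e where e: "e \<in> sub_edges k" "X = ?r\<^sup>* `` {e}" by blast
  show "X \<subseteq> sub_edges k"
  proof
    fix f assume "f \<in> X"
    then have "(e, f) \<in> ?r\<^sup>*" using e by simp
    then show "f \<in> sub_edges k"
      by (induction rule: rtrancl_induct) (use e joined_restr[of k] in auto)
  qed
qed

lemma Union_classes: "(\<Union>X\<in>edges (annular_restriction G C k). X) = sub_edges k"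
proof
  show "(\<Union>X\<in>edges (annular_restriction G C k). X) \<subseteq> sub_edges k" using class_subset(1) by blast
  show "sub_edges k \<subseteq> (\<Union>X\<in>edges (annular_restriction G C k). X)"
  proof
    fix e assume "e \<in> sub_edges k"
    then have "(joined_at_degree_2 (restr k))\<^sup>* `` {e} \<in> edges (annular_restriction G C k)"
      unfolding annular_restriction_eq suppress_def by (auto intro: quotientI)
    moreover have "e \<in> (joined_at_degree_2 (restr k))\<^sup>* `` {e}" by simp
    ultimately show "e \<in> (\<Union>X\<in>edges (annular_restriction G C k). X)" by blast
  qed
qed

lemma cverts_cover: "(\<Union>j\<le>k. cverts G (C j)) \<subseteq> cverts G (sub_edges k)"
  unfolding cverts_def sub_edges_def by blast

text \<open>The edges of the suppressed graph are classes that together contain all edges of the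
  subgraph. So suppression changes the graph but not the point set drawn, and faces can be found
  before it.\<close>

lemma drawing_restriction:
  assumes k: "k \<le> n"
  shows "drawing (annular_restriction G C k) pos cu = cu (sub_edges k)"
proof -
  have "(\<Union>X\<in>edges (annular_restriction G C k). cu X) = cu (sub_edges k)"
    unfolding Union_classes[symmetric] merged_curve_def by blast
  moreover have "verts (annular_restriction G C k) \<subseteq> (\<Union>j\<le>k. cverts G (C j))"
    unfolding annular_restriction_eq suppress_def by auto
  then have "verts (annular_restriction G C k) \<subseteq> cverts G (sub_edges k)" using cverts_cover by blast
  then have "pos ` verts (annular_restriction G C k) \<subseteq> cu (sub_edges k)"
    using pos_in_cu[OF _ sub_edges_edges[OF k]] cverts_verts[OF sub_edges_edges[OF k]] by blast
  ultimately show ?thesis unfolding drawing_def by auto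
qed

lemma outer_faces_iff:
  "k \<le> n \<Longrightarrow> F \<in> outer_faces G pos crv C k \<longleftrightarrow> F \<in> components (- cu (sub_edges k)) \<and> F \<subseteq> annulus crv C k"
  unfolding outer_faces_def faces_def by (simp add: drawing_restriction)

text \<open>The region avoids the drawing and has its frontier in it, so it is a component of the
  complement. Distinct components are disjoint, so the uniqueness clause of
  \<open>gap_face_props\<close> identifies any face along the gap.\<close>

lemma gap_face_outer:
  assumes gs: "gap_sector k i j r s i' j'"
  shows "gap_face k i j r s i' j' \<in> outer_faces G pos crv C k"
    "\<And>H e. H \<in> outer_faces G pos crv C k \<Longrightarrow> e \<in> seg k i j \<Longrightarrow> crv e \<subseteq> frontier H \<Longrightarrow>
      H = gap_face k i j r s i' j'"
proof -
  let ?F = "gap_face k i j r s i' j'"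
  have g: "gap k i j" using gs unfolding gap_sector_def by blast
  note P = gap_face_props[OF gs]
  have k: "1 \<le> k" "k \<le> n" and k': "k - 1 \<le> n" using gapD[OF g] by simp_all
  have "seg k i j \<union> {r, s} \<union> seg (k - 1) i' j' \<subseteq> sub_edges k"
  proof -
    have "r \<in> rungs G C k" "s \<in> rungs G C k"
      using rungs_iff[OF k] gs unfolding gap_sector_def by blast+
    moreover have "seg (k - 1) i' j' \<subseteq> C (k - 1)" "seg k i j \<subseteq> C k" using seg_C[OF k'] seg_C[OF k(2)] by auto
    moreover have "C (k - 1) \<subseteq> sub_edges k" "C k \<subseteq> sub_edges k" "rungs G C k \<subseteq> sub_edges k"
      using sub_edgesI[of "k - 1" k] sub_edgesI[of k k] k by auto
    ultimately show ?thesis by blast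
  qed
  then have "frontier ?F \<subseteq> cu (sub_edges k)" unfolding P(4) by (rule cu_mono)
  then have comp: "?F \<in> components (- cu (sub_edges k))"
    using P component_if_frontier_subset by blast
  then show out: "?F \<in> outer_faces G pos crv C k" using outer_faces_iff k P(6) by blast
  fix H e
  assume H: "H \<in> outer_faces G pos crv C k" and e: "e \<in> seg k i j" "crv e \<subseteq> frontier H"
  have H': "H \<in> components (- cu (sub_edges k))" "H \<subseteq> annulus crv C k" using H outer_faces_iff k by blast+
  then have dis: "H \<inter> cu (sub_edges k) = {}" using in_components_subset by blast
  have "C k \<subseteq> sub_edges k" unfolding sub_edges_def by auto
  then have "H \<inter> cu (C k) = {}" using cu_mono dis by blast
  then have "H \<subseteq> inside (cu (C k))" using H'(2) unfolding annulus_def by blast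
  show "H = ?F"
  proof (rule ccontr)
    assume "H \<noteq> ?F"
    then have "H \<inter> ?F = {}" using components_nonoverlap[OF H'(1) comp] by blast
    then show False using P(7)[OF dis \<open>H \<subseteq> inside (cu (C k))\<close>] e by blast
  qed
qed

section \<open>The 4-cycle class\<close>

text \<open>At vertices up to level \<open>k\<close>, only rungs to level \<open>k + 1\<close> are
  lost, and these start at outward vertices of \<open>C k\<close>. The vertices named here therefore
  keep degree 3.\<close>

lemma restr_edges_at:
  assumes k: "1 \<le> k" "k \<le> n" and v: "v \<in> V (k - 1) \<or> v \<in> inward k" and e: "e \<in> edges G" "v \<in> ends G e"
  shows "e \<in> sub_edges k"
proof -
  obtain m where m: "v \<in> V m" "m = k - 1 \<or> (m = k \<and> v \<in> inward k)" using v inward_V by blast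
  then have mn: "m \<le> n" "m \<le> k" using k by auto
  obtain t where t: "v = c m t" using m unfolding V_def by auto
  consider "e \<in> C m" | u where "rung m e u v" | w where "rung (m + 1) e v w"
    using edges_at[OF mn(1), of e t] e t by auto
  then show ?thesis
  proof cases
    case 1
    then show ?thesis using sub_edgesI(1)[OF mn(2)] by blast
  next
    case 2
    then have "1 \<le> m" unfolding rung_def by auto
    then show ?thesis using sub_edgesI(2)[OF _ mn(2)] rungs_iff[OF _ mn(1)] 2 by blast
  next
    case 3
    then have "v \<in> outward m" unfolding outward_def by blast
    then have "m = k - 1" using m in_out[OF mn(1) m(1)] by blast
    then have "m + 1 = k" using k by simp
    then show ?thesis using sub_edgesI(2)[OF k(1)] rungs_iff[OF k] 3 by blast
  qed
qed

lemma restr_degree: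
  assumes k: "1 \<le> k" "k \<le> n" and v: "v \<in> V (k - 1) \<or> v \<in> inward k"
  shows "degree (restr k) v = 3"
proof -
  have "{e \<in> sub_edges k. v \<in> ends G e} = {e \<in> edges G. v \<in> ends G e}"
    using restr_edges_at[OF assms] sub_edges_edges[OF k(2)] by blast
  moreover have "{e \<in> sub_edges k. ends G e = {v}} = {e \<in> edges G. ends G e = {v}}"
    using restr_edges_at[OF assms] sub_edges_edges[OF k(2)] by blast
  moreover have "k - 1 \<le> n" using k by simp
  then have "v \<in> verts G" using v V_verts[OF k(2)] V_verts[of "k - 1"] inward_V[of k] by blast
  ultimately show ?thesis using deg3[of v] unfolding degree_def by simp
qed

text \<open>Classes grow only across vertices of degree 2, and neither end of \<open>f\<close> is
  one.\<close>

lemma singleton_class: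
  assumes k: "1 \<le> k" "k \<le> n" and f: "ends G f \<subseteq> V (k - 1) \<union> inward k"
    and X: "X \<in> edges (annular_restriction G C k)" "f \<in> X"
  shows "X = {f}"
proof -
  let ?r = "joined_at_degree_2 (restr k)"
  have d: "degree (restr k) v \<noteq> 2" if "v \<in> ends G f" for v
    using restr_degree[OF k, of v] f that by auto
  have nr: "(f, g) \<notin> ?r" "(g, f) \<notin> ?r" for g
    using d unfolding joined_at_degree_2_def by auto
  obtain e where e: "X = ?r\<^sup>* `` {e}" using class_subset(2)[OF X(1)] by blast
  then have "(e, f) \<in> ?r\<^sup>*" using X(2) by simp
  then have ef: "e = f" using nr(2) by (metis rtranclE)
  have "g = f" if "(f, g) \<in> ?r\<^sup>*" for g
    using that nr(1) by (metis converse_rtranclE)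
  then show ?thesis unfolding e ef by auto
qed

lemma C_disjoint: "j \<le> n \<Longrightarrow> k \<le> n \<Longrightarrow> e \<in> C j \<Longrightarrow> e \<in> C k \<Longrightarrow> j = k"
proof -
  assume jk: "j \<le> n" "k \<le> n" and e: "e \<in> C j" "e \<in> C k"
  have "card (ends G e) = 2" using card_ends C_edges[OF jk(1)] e by blast
  then obtain v where "v \<in> ends G e" by fastforce
  then show "j = k" using V_disjoint[OF jk] C_ends jk e by blast
qed

lemma rung_in_rungs: "rung k e u v \<Longrightarrow> e \<in> rungs G C k"
  using rungs_iff[of k e] unfolding rung_def by blast

text \<open>The two rungs and the \<open>j' - i'\<close> edges of the inner arc are separate edges
  of the suppressed graph, all on the frontier, and the gap contributes at least one more. Four
  edges leave room for a single inner one.\<close>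

lemma four_cycle_gap:
  assumes gs: "gap_sector k i j r s i' j'" and four: "four_cycle_face G crv C k (gap_face k i j r s i' j')"
  shows "j' = i' + 1"
proof -
  obtain a b where g: "gap k i j" and ij': "i' < j'" "j' < i' + l (k - 1)"
    and r: "rung k r a (c k i)" and s: "rung k s b (c k j)"
    using gs unfolding gap_sector_def by blast
  have k: "1 \<le> k" "k \<le> n" and k': "k - 1 \<le> n" and ij: "i < j" using gapD[OF g] by simp_all
  let ?A = "annular_restriction G C k"
  obtain D where D: "is_cycle ?A D" "card D = 4"
    and fr: "frontier (gap_face k i j r s i' j') = (\<Union>X\<in>D. cu X)"
    using four unfolding four_cycle_face_def by blast
  have DA: "D \<subseteq> edges ?A" using D(1) unfolding is_cycle_def by blast
  then have "(\<Union>X\<in>D. X) \<subseteq> sub_edges k" using class_subset(1) by blast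
  then have De: "(\<Union>X\<in>D. X) \<subseteq> edges G" using sub_edges_edges[OF k(2)] by blast
  let ?S = "{r, s} \<union> seg (k - 1) i' j'"
  have "cu (\<Union>X\<in>D. X) = (\<Union>X\<in>D. cu X)" unfolding merged_curve_def by blast
  then have fr': "cu (seg k i j \<union> ?S) = cu (\<Union>X\<in>D. X)"
    using gap_face_props(4)[OF gs] fr by (simp add: Un_assoc Un_commute Un_left_commute)
  have inD: "\<exists>X\<in>D. f \<in> X" if f: "f \<in> seg k i j \<union> ?S" for f
  proof -
    have "f \<in> edges G" using f seg_edges[OF k(2)] seg_edges[OF k'] r s unfolding rung_def by blast
    moreover have "crv f \<subseteq> cu (\<Union>X\<in>D. X)" unfolding fr'[symmetric] using f unfolding merged_curve_def by blast
    ultimately show ?thesis using edge_in_if_crv_subset De by blast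
  qed
  have single: "{f} \<in> D" if f: "f \<in> ?S" for f
  proof -
    obtain X where X: "X \<in> D" "f \<in> X" using inD[OF UnI2[OF f]] by (elim bexE)
    have "ends G f \<subseteq> V (k - 1) \<union> inward k"
    proof -
      consider "f = r" | "f = s" | "f \<in> C (k - 1)" using f subsetD[OF seg_C[OF k']] by auto
      then show ?thesis
      proof cases
        case 1
        then show ?thesis using r unfolding inward_def rung_def by auto
      next
        case 2
        then show ?thesis using s unfolding inward_def rung_def by auto
      next
        case 3
        then show ?thesis using C_ends[OF k'] by blast
      qed
    qed
    then have "X = {f}" using singleton_class[OF k] X DA by blast
    then show ?thesis using X by simp
  qed
  have ei: "ed k i \<in> seg k i j" unfolding seg_def using ij by auto
  then obtain X0 where X0: "X0 \<in> D" "ed k i \<in> X0" using inD[OF UnI1[OF ei]] by (elim bexE)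
  have edC: "ed k i \<in> C k" using C_eq k by auto
  have "k - 1 \<noteq> k" using k by simp
  then have segn: "e \<notin> C k" if "e \<in> seg (k - 1) i' j'" for e
    using that seg_C[OF k'] C_disjoint[OF k' k(2)] by blast
  have "ed k i \<notin> ?S"
    using segn edC rung_notin_C[OF r k(2)] rung_notin_C[OF s k(2)] by blast
  then have X0n: "X0 \<notin> (\<lambda>f. {f}) ` ?S" using X0(2) by blast
  have finD: "finite D" using D(2) card.infinite by fastforce
  have sub: "insert X0 ((\<lambda>f. {f}) ` ?S) \<subseteq> D" using X0(1) single by blast
  have finS: "finite ?S" unfolding seg_def by simp
  have rs: "r \<noteq> s" using rung_disjoint(1)[OF r s gap_less(2)[OF g]] .
  have "{r, s} \<inter> seg (k - 1) i' j' = {}"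
    using seg_C[OF k'] rung_notin_C[OF r k'] rung_notin_C[OF s k'] by blast
  then have "card ?S = 2 + card (seg (k - 1) i' j')"
    using rs finS by (subst card_Un_disjoint) auto
  moreover have "card (seg (k - 1) i' j') = nat (j' - i')"
  proof -
    have "inj_on (ed (k - 1)) {i'..<j'}"
    proof (rule inj_onI)
      fix x y assume "x \<in> {i'..<j'}" "y \<in> {i'..<j'}" "ed (k - 1) x = ed (k - 1) y"
      then show "x = y" using mod_close[of x "l (k - 1)" y] ed_eq[OF k'] ij' by auto
    qed
    then show ?thesis unfolding seg_def by (simp add: card_image)
  qed
  moreover have "card ((\<lambda>f. {f}) ` ?S) = card ?S" by (rule card_image) simp
  moreover have "card (insert X0 ((\<lambda>f. {f}) ` ?S)) = Suc (card ((\<lambda>f. {f}) ` ?S))"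
    using X0n finS by (intro card_insert_disjoint) auto
  moreover have "card (insert X0 ((\<lambda>f. {f}) ` ?S)) \<le> 4" using card_mono[OF finD sub] D(2) by simp
  ultimately have "nat (j' - i') \<le> 1" by linarith
  then show ?thesis using ij' by simp
qed

text \<open>
  As an edge of \<open>C k\<close> lies on a unique face of the annulus inside it, this says that this face
  belongs to \<open>P\<close>.
\<close>

definition marked :: "complex set set \<Rightarrow> 'e \<Rightarrow> bool" where
  "marked P e \<longleftrightarrow> (\<exists>F\<in>P. crv e \<subseteq> frontier F)"

lemma inward_rung: "v \<in> inward k \<Longrightarrow> \<exists>e u. rung k e u v"
  unfolding inward_def by blast

lemma gap_sector_exists:
  assumes "gap k i j"
  obtains r s i' j' where "gap_sector k i j r s i' j'"
proof -
  obtain r a where r: "rung k r a (c k i)" using inward_rung gapD(5)[OF assms] by blast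
  obtain s b where s: "rung k s b (c k j)" using inward_rung gapD(6)[OF assms] by blast
  show thesis using gap_sector_ex[OF assms r s] that by blast
qed

lemma marked_iff:
  assumes P: "P \<subseteq> outer_faces G pos crv C k" and gs: "gap_sector k i j r s i' j'" and e: "e \<in> seg k i j"
  shows "marked P e \<longleftrightarrow> gap_face k i j r s i' j' \<in> P"
proof
  assume "marked P e"
  then show "gap_face k i j r s i' j' \<in> P"
    using gap_face_outer(2)[OF gs _ e] P unfolding marked_def by blast
next
  assume "gap_face k i j r s i' j' \<in> P"
  moreover have "crv e \<subseteq> frontier (gap_face k i j r s i' j')"
    unfolding gap_face_props(4)[OF gs] using e unfolding merged_curve_def by blast
  ultimately show "marked P e" unfolding marked_def by blast
qed

lemma seg_mem: "i \<le> t \<Longrightarrow> t < j \<Longrightarrow> ed k t \<in> seg k i j"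
  unfolding seg_def by auto

lemma marked_gap:
  assumes P: "P \<subseteq> outer_faces G pos crv C k" and g: "gap k i j"
    and t: "i \<le> t" "t < j" "i \<le> t'" "t' < j"
  shows "marked P (ed k t) \<longleftrightarrow> marked P (ed k t')"
proof -
  obtain r s i' j' where gs: "gap_sector k i j r s i' j'" using gap_sector_exists[OF g] .
  show ?thesis using marked_iff[OF P gs seg_mem] t by simp
qed

text \<open>The gaps meeting at \<open>c k j\<close> share the rung there, so their faces are
  adjacent, and neither \<open>P\<close> nor the set of remaining outer faces contains two adjacent
  faces.\<close>

lemma marked_flip:
  assumes P: "four_cycle_class G pos crv C k P" and k: "1 \<le> k" "k \<le> n" and j: "c k j \<in> inward k"
  shows "marked P (ed k (j - 1)) \<longleftrightarrow> \<not> marked P (ed k j)"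
proof -
  have sub: "P \<subseteq> outer_faces G pos crv C k" using P unfolding four_cycle_class_def by blast
  obtain i where g1: "gap k i j" using gap_prev[OF k j] .
  obtain m where g2: "gap k j m" using gap_next[OF k j] .
  obtain r s i' j' where gs1: "gap_sector k i j r s i' j'" using gap_sector_exists[OF g1] .
  obtain r2 s2 i2 j2 where gs2: "gap_sector k j m r2 s2 i2 j2" using gap_sector_exists[OF g2] .
  let ?F1 = "gap_face k i j r s i' j'" and ?F2 = "gap_face k j m r2 s2 i2 j2"
  have k': "k - 1 \<le> n" "k - 1 \<noteq> k" using k by auto
  obtain b where s: "rung k s b (c k j)" using gs1 unfolding gap_sector_def by blast
  obtain a2 b2 where r2: "rung k r2 a2 (c k j)" and s2: "rung k s2 b2 (c k m)"
    using gs2 unfolding gap_sector_def by blast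
  have sr: "s = r2" using rung_outer_unique(1)[OF s r2] .
  have e1: "ed k (j - 1) \<in> seg k i j" using gapD(4)[OF g1] by (intro seg_mem) auto
  have e2: "ed k j \<in> seg k j m" using gapD(4)[OF g2] by (intro seg_mem) auto
  \<comment> \<open>Adjacency requires distinct faces: \<open>ed k (j - 1)\<close> is on the first
    frontier, but the second gap, being shorter than a lap, does not reach it.\<close>
  have ne: "?F1 \<noteq> ?F2"
  proof
    assume eq: "?F1 = ?F2"
    have "crv (ed k (j - 1)) \<subseteq> frontier ?F1"
      unfolding gap_face_props(4)[OF gs1] using e1 unfolding merged_curve_def by blast
    then have "crv (ed k (j - 1)) \<subseteq> cu (seg k j m \<union> {r2, s2} \<union> seg (k - 1) i2 j2)"
      unfolding eq gap_face_props(4)[OF gs2] .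
    moreover have "seg k j m \<union> {r2, s2} \<union> seg (k - 1) i2 j2 \<subseteq> edges G"
      using seg_edges[OF k(2)] seg_edges[OF k'(1)] r2 s2 unfolding rung_def by blast
    ultimately have "ed k (j - 1) \<in> seg k j m \<union> {r2, s2} \<union> seg (k - 1) i2 j2"
      using edge_in_if_crv_subset ed_edge[OF k(2)] by blast
    moreover have eC: "ed k (j - 1) \<in> C k" using C_eq k by auto
    then have "ed k (j - 1) \<notin> seg (k - 1) i2 j2" "ed k (j - 1) \<noteq> r2" "ed k (j - 1) \<noteq> s2"
      using seg_C[OF k'(1)] C_disjoint[OF k'(1) k(2)] k' rung_notin_C[OF r2 k(2)] rung_notin_C[OF s2 k(2)] by blast+
    ultimately have "ed k (j - 1) \<in> seg k j m" by blast
    then obtain t where t: "ed k (j - 1) = ed k t" "j \<le> t" "t < m" unfolding seg_def by auto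
    then have "j - 1 = t" using mod_close[of "j - 1" "l k" t] ed_eq[OF k(2)] gap_less(1)[OF g2] by auto
    then show False using t by simp
  qed
  have "crv s \<subseteq> frontier ?F1" "crv s \<subseteq> frontier ?F2"
    unfolding gap_face_props(4)[OF gs1] gap_face_props(4)[OF gs2]
    unfolding sr merged_curve_def by blast+
  then have adj: "adjacent_faces G crv C k ?F1 ?F2"
    unfolding adjacent_faces_def using ne rung_in_rungs[OF s] by blast
  have "?F1 \<in> P \<longleftrightarrow> ?F2 \<notin> P"
    using P adj gap_face_outer(1)[OF gs1] gap_face_outer(1)[OF gs2] unfolding four_cycle_class_def by blast
  then show ?thesis using marked_iff[OF sub gs1 e1] marked_iff[OF sub gs2 e2] by blast
qed

text \<open>A marked gap belongs to a 4-cycle face, where the arc between the feet is one edge. This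
  supplies the link at which the circuit is cut.\<close>

lemma marked_feet:
  assumes P: "four_cycle_class G pos crv C k P" and g: "gap k i j" and marked: "marked P (ed k i)"
    and r: "rung k r a (c k i)" and s: "rung k s b (c k j)"
  shows "\<exists>t. {a, b} = {c (k - 1) t, c (k - 1) (t + 1)}"
proof -
  have sub: "P \<subseteq> outer_faces G pos crv C k" using P unfolding four_cycle_class_def by blast
  obtain i' j' where gs: "gap_sector k i j r s i' j'" using gap_sector_ex[OF g r s] .
  have "gap_face k i j r s i' j' \<in> P" using marked_iff[OF sub gs seg_mem] marked gapD(4)[OF g] by blast
  then have "j' = i' + 1" using four_cycle_gap[OF gs] P unfolding four_cycle_class_def by blast
  moreover obtain a' b' where "rung k r a' (c k i)" "rung k s b' (c k j)"
    "{c (k - 1) i', c (k - 1) j'} = {a', b'}" using gs unfolding gap_sector_def by blast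
  moreover have "a' = a" "b' = b" using rung_outer_unique(2) calculation r s by blast+
  ultimately show ?thesis by metis
qed

text \<open>The foot is an inner vertex of the gap, so both cycle edges at it belong to the gap. Any
  boundary edge through the foot contains one of them, and the uniqueness of the face along the gap
  decides \<open>F\<close>.\<close>

lemma attached_face:
  assumes k: "1 \<le> k" "k < n" and t: "rung (k + 1) e (c k t) w" and g: "gap k i j" "i < t" "t < j"
    and gs: "gap_sector k i j r s i' j'" and att: "attached G pos crv C (k + 1) e F"
  shows "F = gap_face k i j r s i' j'"
proof -
  have kn: "k \<le> n" "k + 1 \<le> n" using k by auto
  obtain u X where F: "F \<in> outer_faces G pos crv C k" and u: "u \<in> ends G e" "u \<in> V k"
    and X: "X \<subseteq> C k" "pos u \<in> cu X" "cu X \<subseteq> frontier F"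
    using att cverts_C[OF kn(1)] unfolding attached_def by auto
  have "w \<notin> V k" using V_disjoint[OF kn, of w] t unfolding rung_def by auto
  then have "u = c k t" using u t unfolding rung_def by auto
  then obtain f where f: "f \<in> X" "pos (c k t) \<in> crv f" using X(2) unfolding merged_curve_def by auto
  then have fe: "f \<in> C k" "f \<in> edges G" using X(1) C_edges[OF kn(1)] by auto
  have "c k t \<in> verts G" using V_verts[OF kn(1)] by (rule subsetD) simp
  then have "c k t \<in> ends G f" using f(2) pos_in_crv[OF _ fe(2)] by blast
  then have "f = ed k t \<or> f = ed k (t - 1)" using ed_at[OF kn(1) fe(1)] by blast
  then have "f \<in> seg k i j" using g by (auto intro!: seg_mem)
  moreover have "crv f \<subseteq> frontier F" using X(3) f(1) unfolding merged_curve_def by blast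
  ultimately show ?thesis using gap_face_outer(2)[OF gs F] by blast
qed

text \<open>The rung at an outward vertex is attached to the face of the gap around it, and both
  cycle edges at the vertex lie in that gap.\<close>

lemma marked_block:
  assumes P: "four_cycle_class G pos crv C k P" and k: "1 \<le> k" "k < n"
    and block: "\<forall>e\<in>rungs G C (k + 1). \<exists>F\<in>P. attached G pos crv C (k + 1) e F"
    and t: "c k t \<in> outward k"
  shows "marked P (ed k t)" "marked P (ed k (t - 1))"
proof -
  have sub: "P \<subseteq> outer_faces G pos crv C k" using P unfolding four_cycle_class_def by blast
  have kn: "k \<le> n" using k by auto
  have "c k t \<notin> inward k" using in_out[OF kn, of "c k t"] t by simp
  then obtain i j where g: "gap k i j" "i < t" "t < j" using gap_around[OF k(1) kn] by blast
  obtain r s i' j' where gs: "gap_sector k i j r s i' j'" using gap_sector_exists[OF g(1)] .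
  obtain e w where e: "rung (k + 1) e (c k t) w" using t unfolding outward_def by blast
  obtain F where "F \<in> P" "attached G pos crv C (k + 1) e F" using block rung_in_rungs[OF e] by blast
  then have "gap_face k i j r s i' j' \<in> P" using attached_face[OF k e g gs] by simp
  then show "marked P (ed k t)" "marked P (ed k (t - 1))"
    using marked_iff[OF sub gs seg_mem] g by simp_all
qed

text \<open>Dual to the block case. Consequently a marked gap has no inner vertex and is a single
  edge.\<close>

lemma marked_ring:
  assumes P: "four_cycle_class G pos crv C k P" and k: "1 \<le> k" "k < n"
    and ring: "\<forall>e\<in>rungs G C (k + 1). \<exists>F\<in>outer_faces G pos crv C k - P. attached G pos crv C (k + 1) e F"
    and t: "c k t \<in> outward k"
  shows "\<not> marked P (ed k t)" "\<not> marked P (ed k (t - 1))"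
proof -
  have sub: "P \<subseteq> outer_faces G pos crv C k" using P unfolding four_cycle_class_def by blast
  have kn: "k \<le> n" using k by auto
  have "c k t \<notin> inward k" using in_out[OF kn, of "c k t"] t by simp
  then obtain i j where g: "gap k i j" "i < t" "t < j" using gap_around[OF k(1) kn] by blast
  obtain r s i' j' where gs: "gap_sector k i j r s i' j'" using gap_sector_exists[OF g(1)] .
  obtain e w where e: "rung (k + 1) e (c k t) w" using t unfolding outward_def by blast
  obtain F where "F \<notin> P" "attached G pos crv C (k + 1) e F" using ring rung_in_rungs[OF e] by blast
  then have "gap_face k i j r s i' j' \<notin> P" using attached_face[OF k e g gs] by simp
  then show "\<not> marked P (ed k t)" "\<not> marked P (ed k (t - 1))"
    using marked_iff[OF sub gs seg_mem] g by simp_all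
qed

text \<open>The topology is forgotten here: what remains is that the feet of a gap are neighbours
  among the outward vertices of the lower cycle.\<close>

lemma gap_feet:
  assumes g: "gap k i j" and r: "rung k r a (c k i)" and s: "rung k s b (c k j)"
  obtains i' j' where "i' < j'" "j' < i' + l (k - 1)" "{c (k - 1) i', c (k - 1) j'} = {a, b}"
    "\<And>t. i' < t \<Longrightarrow> t < j' \<Longrightarrow> c (k - 1) t \<notin> outward (k - 1)"
proof -
  obtain i' j' where gs: "gap_sector k i j r s i' j'" using gap_sector_ex[OF g r s] .
  then obtain a' b' where "i' < j'" "j' < i' + l (k - 1)" "rung k r a' (c k i)" "rung k s b' (c k j)"
    "{c (k - 1) i', c (k - 1) j'} = {a', b'}" unfolding gap_sector_def by blast
  moreover have "a' = a" "b' = b" using rung_outer_unique(2) calculation r s by blast+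
  ultimately show thesis using gap_sector_feet[OF gs] that by blast
qed

section \<open>Spanning circuits\<close>

lemma c_step: "k \<le> n \<Longrightarrow> c k s = c k t \<Longrightarrow> c k (s + m) = c k (t + m)"
  using c_eq by (metis mod_add_left_eq)

lemma c_link: "k \<le> n \<Longrightarrow> {c k t, c k (t + 1)} \<in> ends G ` edges G"
  using ends_ed ed_edge by (metis imageI)

lemma rung_link: "rung k e u v \<Longrightarrow> {u, v} \<in> ends G ` edges G \<and> {v, u} \<in> ends G ` edges G"
  unfolding rung_def by (metis imageI insert_commute)

lemma segment_list:
  assumes k: "k \<le> n" and ij: "i \<le> j" "j < i + l k"
  shows "distinct (map (c k) [i..j])" "map (c k) [i..j] \<noteq> []" "set (map (c k) [i..j]) = c k ` {i..j}"
    "hd (map (c k) [i..j]) = c k i" "last (map (c k) [i..j]) = c k j"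
    "links (map (c k) [i..j]) \<subseteq> ends G ` edges G" "length (map (c k) [i..j]) = nat (j - i + 1)"
proof -
  show "distinct (map (c k) [i..j])"
    unfolding distinct_map using c_inj[OF k] ij by (auto intro!: inj_onI)
  show "map (c k) [i..j] \<noteq> []" "set (map (c k) [i..j]) = c k ` {i..j}" using ij by auto
  have "[i..j] = i # [i + 1..j]" using ij by (simp add: upto_rec1)
  then show "hd (map (c k) [i..j]) = c k i" by simp
  have "[i..j] = [i..j - 1] @ [j]" using ij by (simp add: upto_rec2)
  then show "last (map (c k) [i..j]) = c k j" by simp
  show "links (map (c k) [i..j]) \<subseteq> ends G ` edges G" unfolding links_upto using c_link[OF k] by auto
  show "length (map (c k) [i..j]) = nat (j - i + 1)" by simp
qed

lemma C_window_V: "k \<le> n \<Longrightarrow> c k ` {i..i + l k - 1} = V k"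
proof
  assume k: "k \<le> n"
  show "c k ` {i..i + l k - 1} \<subseteq> V k" by auto
  show "V k \<subseteq> c k ` {i..i + l k - 1}"
  proof
    fix v assume "v \<in> V k"
    then obtain t where "i \<le> t" "t < i + l k" "c k t = v" using V_window[OF k] by blast
    then show "v \<in> c k ` {i..i + l k - 1}" by force
  qed
qed

definition spanning_circuit :: "nat \<Rightarrow> 'v list \<Rightarrow> bool" where
  "spanning_circuit k L \<longleftrightarrow> circuit G L \<and> set L = (\<Union>j\<le>k. V j) \<and>
     (\<forall>t. c k t \<in> outward k \<longrightarrow> c k (t + 1) \<in> outward k \<longrightarrow> {c k t, c k (t + 1)} \<in> closed_links L)"

lemma spanning_circuit_0: "\<exists>L. spanning_circuit 0 L"
proof -
  have k: "0 \<le> n" by simp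
  have l0: "3 \<le> l 0" by (rule l3) simp
  let ?L = "map (c 0) [0..l 0 - 1]"
  note S = segment_list[OF k, of 0 "l 0 - 1"]
  have ne: "?L \<noteq> []" using l0 by simp
  have per: "c 0 (l 0) = c 0 0" using c_period[OF k, of 0 1] by simp
  have cl: "closed_links ?L = {{c 0 t, c 0 (t + 1)} |t. 0 \<le> t \<and> t < l 0 - 1} \<union> {{c 0 (l 0 - 1), c 0 0}}"
    unfolding closed_links_eq[OF ne] links_upto using S(4,5) l0 by simp
  have mem: "{c 0 t, c 0 (t + 1)} \<in> closed_links ?L" for t
  proof -
    obtain m where m: "0 \<le> t + m * l 0" "t + m * l 0 < 0 + l 0" using shift_window[OF k] .
    let ?s = "t + m * l 0"
    have e: "c 0 ?s = c 0 t" "c 0 (?s + 1) = c 0 (t + 1)"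
      using c_period[OF k, of t m] c_period[OF k, of "t + 1" m] by (simp_all add: algebra_simps)
    show ?thesis
    proof (cases "?s = l 0 - 1")
      case True
      then have "{c 0 t, c 0 (t + 1)} = {c 0 (l 0 - 1), c 0 0}" using e per by auto
      then show ?thesis unfolding cl by simp
    next
      case False
      then have "?s < l 0 - 1" using m by simp
      then show ?thesis unfolding cl e[symmetric] using m by blast
    qed
  qed
  have "c 0 (l 0 - 1 + 1) = c 0 0" using per by simp
  then have "{c 0 (l 0 - 1), c 0 0} \<in> ends G ` edges G" using c_link[OF k, of "l 0 - 1"] by simp
  then have "closed_links ?L \<subseteq> ends G ` edges G"
    unfolding cl using c_link[OF k] by auto
  then have "circuit G ?L" unfolding circuit_def using S l0 by auto
  moreover have "set ?L = (\<Union>j\<le>0. V j)" using S(3) C_window_V[OF k, of 0] l0 by simp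
  ultimately show ?thesis unfolding spanning_circuit_def using mem by blast
qed

lemma V_below_disjoint:
  assumes "1 \<le> k" "k \<le> n" "v \<in> V k" shows "v \<notin> (\<Union>j\<le>k - 1. V j)"
proof
  assume "v \<in> (\<Union>j\<le>k - 1. V j)"
  then obtain j where "j \<le> k - 1" and vj: "v \<in> V j" by auto
  moreover have "j \<le> n" "j \<noteq> k" using \<open>j \<le> k - 1\<close> assms by auto
  ultimately show False using V_disjoint[OF _ assms(2) vj assms(3)] by blast
qed

lemma Union_V: "1 \<le> k \<Longrightarrow> (\<Union>j\<le>k. V j) = (\<Union>j\<le>k - 1. V j) \<union> V k"
  by (cases k) (auto simp: atMost_Suc)

lemma rung_out: "rung k e u v \<Longrightarrow> u \<in> outward (k - 1)" and rung_in: "rung k e u v \<Longrightarrow> v \<in> inward k"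
  unfolding inward_def outward_def rung_def by auto

text \<open>The link \<open>{a, b}\<close> is replaced by the path once around \<open>C k\<close>
  that leaves out only the edge between \<open>u\<close> and \<open>v\<close>. Both ends of that
  edge are inward, so the invariant does not claim it.\<close>

lemma merge_step:
  assumes k: "1 \<le> k" "k \<le> n" and L: "spanning_circuit (k - 1) L"
    and r: "rung k e a u" and s: "rung k e' b v"
    and ab: "{a, b} = {c (k - 1) t', c (k - 1) (t' + 1)}" and uv: "{u, v} = {c k t, c k (t + 1)}"
  shows "\<exists>L'. spanning_circuit k L'"
proof -
  have lk: "3 \<le> l k" by (rule l3[OF k(2)])
  \<comment> \<open>The two orders of the pair are unified: the path runs upwards from
    \<open>c k (t + 1)\<close> to \<open>c k (t + l k)\<close>, which is
    \<open>c k t\<close>.\<close>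
  obtain a' b' e1 e2 where r': "rung k e1 a' (c k (t + 1))" and s': "rung k e2 b' (c k t)"
    and ab': "{a', b'} = {c (k - 1) t', c (k - 1) (t' + 1)}"
    using r s ab uv by (metis doubleton_eq_iff)
  have "a' \<in> outward (k - 1)" "b' \<in> outward (k - 1)" using rung_out r' s' by auto
  then have "c (k - 1) t' \<in> outward (k - 1)" "c (k - 1) (t' + 1) \<in> outward (k - 1)"
    using ab' by (auto simp: doubleton_eq_iff)
  then have link: "{a', b'} \<in> closed_links L" using L unfolding spanning_circuit_def ab' by blast
  let ?p = "map (c k) [t + 1..t + l k]"
  have "t + 1 \<le> t + l k" "t + l k < t + 1 + l k" using lk by auto
  note S = segment_list[OF k(2) this]
  have setp: "set ?p = V k" using S(3) C_window_V[OF k(2), of "t + 1"] by simp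
  have lst: "last ?p = c k t" using S(5) c_period[OF k(2), of t 1] by simp
  have setL: "set L = (\<Union>j\<le>k - 1. V j)" and cL: "circuit G L"
    using L unfolding spanning_circuit_def by auto
  have disj: "set ?p \<inter> set L = {}" unfolding setp setL using V_below_disjoint[OF k] by blast
  have l1: "{a', hd ?p} \<in> ends G ` edges G" unfolding S(4) using rung_link[OF r'] by blast
  have l2: "{last ?p, b'} \<in> ends G ` edges G" unfolding lst using rung_link[OF s'] by blast
  obtain L' where L': "circuit G L'" "set L' = set L \<union> set ?p"
    "closed_links L - {{a', b'}} \<union> links ?p \<subseteq> closed_links L'"
    using circuit_insert_path[OF cL link S(1,2) disj S(6) l1 l2] .
  have "set L' = (\<Union>j\<le>k. V j)" unfolding L'(2) setp setL using Union_V[OF k(1)] by simp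
  moreover have "{c k w, c k (w + 1)} \<in> closed_links L'" if w: "c k w \<in> outward k" for w
  proof -
    obtain m where m: "t + 1 \<le> w + m * l k" "w + m * l k < t + 1 + l k"
      using shift_window[OF k(2)] .
    let ?s = "w + m * l k"
    have e: "c k ?s = c k w" "c k (?s + 1) = c k (w + 1)"
      using c_period[OF k(2), of w m] c_period[OF k(2), of "w + 1" m] by (simp_all add: algebra_simps)
    have "?s \<noteq> t + l k"
    proof
      assume "?s = t + l k"
      then have "c k w = c k t" using e c_period[OF k(2), of t 1] by simp
      then show False using w rung_in[OF s'] in_out[OF k(2), of "c k t"] by simp
    qed
    then have "t + 1 \<le> ?s" "?s < t + l k" using m by auto
    then have "{c k ?s, c k (?s + 1)} \<in> links ?p" unfolding links_upto by blast
    then show ?thesis using L'(3) unfolding e by blast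
  qed
  ultimately show ?thesis unfolding spanning_circuit_def using L'(1) by blast
qed

text \<open>Gaps that share an inner index, or an end on the same side, coincide. The remaining
  case, one gap ending where the other starts, is excluded because marking flips at an inward
  vertex.\<close>

lemma gap_index_unique:
  assumes P: "four_cycle_class G pos crv C k P"
    and g: "gap k i j" "marked P (ed k i)" and g2: "gap k i2 j2" "marked P (ed k i2)"
    and s: "i \<le> s" "s \<le> j" "i2 \<le> s" "s \<le> j2"
  shows "i = i2" "j = j2"
proof -
  have sub: "P \<subseteq> outer_faces G pos crv C k" using P unfolding four_cycle_class_def by blast
  have k: "1 \<le> k" "k \<le> n" using gapD[OF g(1)] by auto
  note ij = gapD(4)[OF g(1)] gapD(4)[OF g2(1)]
  have no: False if "gap k i' s" "gap k s j'" "marked P (ed k i')" "marked P (ed k s)" for i' j'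
  proof -
    have "marked P (ed k (s - 1))"
      using marked_gap[OF sub that(1), of i' "s - 1"] that(3) gapD(4)[OF that(1)] by auto
    then show False using marked_flip[OF P k, of s] gapD(5)[OF that(2)] that(4) by simp
  qed
  have "i = i2 \<and> j = j2"
  proof (cases "c k s \<in> inward k")
    case True
    then have "s = i \<or> s = j" "s = i2 \<or> s = j2" using gapD(7)[OF g(1), of s] gapD(7)[OF g2(1), of s] s by force+
    then consider "s = i" "s = i2" | "s = j" "s = j2" | "s = i" "s = j2" | "s = j" "s = i2" by blast
    then show ?thesis
    proof cases
      case 1
      then show ?thesis
        using gapD(7)[OF g(1), of j2] gapD(7)[OF g2(1), of j] gapD(6)[OF g(1)] gapD(6)[OF g2(1)] ij
        by (cases j j2 rule: linorder_cases) auto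
    next
      case 2
      then show ?thesis
        using gapD(7)[OF g(1), of i2] gapD(7)[OF g2(1), of i] gapD(5)[OF g(1)] gapD(5)[OF g2(1)] ij
        by (cases i i2 rule: linorder_cases) auto
    next
      case 3
      then show ?thesis using no g g2 by blast
    next
      case 4
      then show ?thesis using no g g2 by blast
    qed
  next
    case False
    then have st: "i < s" "s < j" "i2 < s" "s < j2"
      using s gapD(5,6)[OF g(1)] gapD(5,6)[OF g2(1)] by (auto simp: order_le_less)
    have "i = i2"
      using gapD(7)[OF g(1), of i2] gapD(7)[OF g2(1), of i] gapD(5)[OF g(1)] gapD(5)[OF g2(1)] st
      by (cases i i2 rule: linorder_cases) auto
    moreover have "j = j2"
      using gapD(7)[OF g(1), of j2] gapD(7)[OF g2(1), of j] gapD(6)[OF g(1)] gapD(6)[OF g2(1)] st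
      by (cases j j2 rule: linorder_cases) auto
    ultimately show ?thesis ..
  qed
  then show "i = i2" "j = j2" by auto
qed

text \<open>A vertex has an index in every lap; translating the gap allows two indices of one vertex
  to be compared within the same lap.\<close>

lemma gap_shift_to:
  assumes g: "gap k i j" "marked P (ed k i)" and s: "i \<le> s" "s \<le> j" and eq: "c k s = c k s'"
  obtains i2 j2 where "gap k i2 j2" "marked P (ed k i2)" "i2 \<le> s'" "s' \<le> j2"
    "\<And>t. c k (t + (s' - s)) = c k t" "i2 = i + (s' - s)" "j2 = j + (s' - s)"
proof -
  have k: "k \<le> n" using gapD[OF g(1)] by auto
  have "s mod l k = s' mod l k" using eq c_eq[OF k] by blast
  then have "l k dvd s' - s" by (metis mod_eq_dvd_iff)
  then obtain m where m: "s' - s = m * l k" by (metis dvd_def mult.commute)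
  have "gap k (i + m * l k) (j + m * l k)" by (rule gap_shift[OF g(1)])
  moreover have "marked P (ed k (i + m * l k))" using g(2) ed_eq[OF k, of "i + m * l k" i] by simp
  ultimately have "gap k (i + (s' - s)) (j + (s' - s))" "marked P (ed k (i + (s' - s)))"
    unfolding m .
  moreover have "c k (t + (s' - s)) = c k t" for t unfolding m by (rule c_period[OF k])
  moreover have "i + (s' - s) \<le> s'" "s' \<le> j + (s' - s)" using s by simp_all
  ultimately show thesis using that by blast
qed

lemma marked_gap_at:
  assumes P: "four_cycle_class G pos crv C k P" and k: "1 \<le> k" "k \<le> n" and t: "c k t \<in> inward k"
  obtains i where "gap k t i" "marked P (ed k t)" | i where "gap k i t" "marked P (ed k i)"
proof (cases "marked P (ed k t)")
  case True
  then show thesis using gap_next[OF k t] that(1) by blast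
next
  case False
  have sub: "P \<subseteq> outer_faces G pos crv C k" using P unfolding four_cycle_class_def by blast
  obtain i where i: "gap k i t" using gap_prev[OF k t] .
  have "marked P (ed k (t - 1))" using marked_flip[OF P k t] False by simp
  then have "marked P (ed k i)" using marked_gap[OF sub i, of i "t - 1"] gapD(4)[OF i] by auto
  then show thesis using that(2) i by blast
qed

text \<open>Vertex sets replace index pairs: a gap recurs in every lap, but its vertices form a
  subset of the finite set \<open>V k\<close>, so induction over the gaps becomes possible.\<close>

definition marked_sets :: "nat \<Rightarrow> complex set set \<Rightarrow> 'v set set" where
  "marked_sets k P = {c k ` {i..j} |i j. gap k i j \<and> marked P (ed k i)}"

lemma marked_sets_disjoint:
  assumes P: "four_cycle_class G pos crv C k P"
    and S: "S \<in> marked_sets k P" "T \<in> marked_sets k P" "v \<in> S" "v \<in> T"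
  shows "S = T"
proof -
  obtain i j where g: "gap k i j" "marked P (ed k i)" "S = c k ` {i..j}"
    using S unfolding marked_sets_def by blast
  obtain i2 j2 where g2: "gap k i2 j2" "marked P (ed k i2)" "T = c k ` {i2..j2}"
    using S unfolding marked_sets_def by blast
  obtain s where s: "v = c k s" "i \<le> s" "s \<le> j" using S g by auto
  obtain s' where s': "v = c k s'" "i2 \<le> s'" "s' \<le> j2" using S g2 by auto
  have eq: "c k s = c k s'" using s s' by simp
  obtain i3 j3 where g3: "gap k i3 j3" "marked P (ed k i3)" "i3 \<le> s'" "s' \<le> j3"
    "\<And>t. c k (t + (s' - s)) = c k t" "i3 = i + (s' - s)" "j3 = j + (s' - s)"
    by (rule gap_shift_to[OF g(1,2) s(2,3) eq]) blast
  have "i3 = i2" "j3 = j2" using gap_index_unique[OF P g3(1,2) g2(1,2) g3(3,4) s'(2,3)] by auto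
  moreover have "c k ` {i3..j3} = c k ` {i..j}"
  proof -
    have "{i3..j3} = (\<lambda>t. t + (s' - s)) ` {i..j}" unfolding g3(6,7) by simp
    then show ?thesis by (simp only: image_image g3(5))
  qed
  ultimately show ?thesis using g g2 by simp
qed

text \<open>Induction over the family already inserted. The third conjunct protects the links of
  \<open>L\<close> that contain no foot of an inserted gap; the link needed for the next gap is
  among them, since each foot carries one rung and marked gaps are disjoint.\<close>

lemma marked_sets_insert:
  assumes P: "four_cycle_class G pos crv C k P" and k: "1 \<le> k" "k \<le> n"
    and L: "spanning_circuit (k - 1) L"
    and T: "finite T" "T \<subseteq> marked_sets k P"
  shows "\<exists>L'. circuit G L' \<and> set L' = set L \<union> \<Union>T \<and>
    (\<forall>x\<in>closed_links L. (\<forall>e u v. rung k e u v \<and> v \<in> \<Union>T \<longrightarrow> u \<notin> x) \<longrightarrow> x \<in> closed_links L') \<and>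
    (\<forall>t. c k t \<in> outward k \<inter> \<Union>T \<longrightarrow> {c k t, c k (t + 1)} \<in> closed_links L')"
  using T
proof (induction T rule: finite_induct)
  case empty
  then show ?case using L unfolding spanning_circuit_def by auto
next
  case (insert S T)
  have S: "S \<in> marked_sets k P" and Tsub: "T \<subseteq> marked_sets k P" using insert.prems by auto
  obtain L' where IH: "circuit G L' \<and> set L' = set L \<union> \<Union>T \<and>
    (\<forall>x\<in>closed_links L. (\<forall>e u v. rung k e u v \<and> v \<in> \<Union>T \<longrightarrow> u \<notin> x) \<longrightarrow> x \<in> closed_links L') \<and>
    (\<forall>t. c k t \<in> outward k \<inter> \<Union>T \<longrightarrow> {c k t, c k (t + 1)} \<in> closed_links L')"
    using insert.IH[OF Tsub] by (rule exE)
  have L': "circuit G L'" "set L' = set L \<union> \<Union>T"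
    using conjunct1[OF IH] conjunct1[OF conjunct2[OF IH]] .
  have keep: "x \<in> closed_links L'"
    if "x \<in> closed_links L" "\<And>e u v. rung k e u v \<Longrightarrow> v \<in> \<Union>T \<Longrightarrow> u \<notin> x" for x
    using conjunct1[OF conjunct2[OF conjunct2[OF IH]], THEN bspec, OF that(1)] that(2) by blast
  have linked: "{c k t, c k (t + 1)} \<in> closed_links L'" if "c k t \<in> outward k" "c k t \<in> \<Union>T" for t
    using conjunct2[OF conjunct2[OF conjunct2[OF IH]], THEN spec, of t] that by blast
  obtain i j where g: "gap k i j" "marked P (ed k i)" and Seq: "S = c k ` {i..j}"
    using S unfolding marked_sets_def by blast
  have ST: "v \<notin> \<Union>T" if "v \<in> S" for v
    using marked_sets_disjoint[OF P S _ that] Tsub insert.hyps(2) by blast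
  have ij: "i < j" "j < i + l k" using gapD(4)[OF g(1)] gap_less(1)[OF g(1)] .
  obtain r a where r: "rung k r a (c k i)" using inward_rung[OF gapD(5)[OF g(1)]] by blast
  obtain s b where s: "rung k s b (c k j)" using inward_rung[OF gapD(6)[OF g(1)]] by blast
  have ends: "c k i \<in> S" "c k j \<in> S" unfolding Seq using ij by auto
  obtain t where ab: "{a, b} = {c (k - 1) t, c (k - 1) (t + 1)}" using marked_feet[OF P g r s] by blast
  have "a \<in> outward (k - 1)" "b \<in> outward (k - 1)" using rung_out[OF r] rung_out[OF s] .
  then have "c (k - 1) t \<in> outward (k - 1)" "c (k - 1) (t + 1) \<in> outward (k - 1)"
    using ab by (auto simp: doubleton_eq_iff)
  then have link0: "{a, b} \<in> closed_links L" using L unfolding spanning_circuit_def ab by blast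
  have link: "{a, b} \<in> closed_links L'"
  proof (rule keep[OF link0])
    fix e u v assume e: "rung k e u v" "v \<in> \<Union>T"
    show "u \<notin> {a, b}"
    proof
      assume "u \<in> {a, b}"
      then have "v = c k i \<or> v = c k j" using rung_inner_unique(2) e(1) r s by blast
      then show False using ST ends e(2) by blast
    qed
  qed
  let ?p = "map (c k) [i..j]"
  note Sg = segment_list[OF k(2) less_imp_le[OF ij(1)] ij(2)]
  have setL: "set L = (\<Union>j\<le>k - 1. V j)" using L unfolding spanning_circuit_def by auto
  have "set ?p \<inter> set L = {}" unfolding Sg(3) setL using V_below_disjoint[OF k] by auto
  moreover have "set ?p \<inter> \<Union>T = {}" using ST unfolding Sg(3) Seq by blast
  ultimately have disj: "set ?p \<inter> set L' = {}" unfolding L'(2) by blast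
  have l1: "{a, hd ?p} \<in> ends G ` edges G" unfolding Sg(4) using rung_link[OF r] by blast
  have l2: "{last ?p, b} \<in> ends G ` edges G" unfolding Sg(5) using rung_link[OF s] by blast
  obtain L'' where L'': "circuit G L''" "set L'' = set L' \<union> set ?p"
    "closed_links L' - {{a, b}} \<union> links ?p \<subseteq> closed_links L''"
    using circuit_insert_path[OF L'(1) link Sg(1,2) disj Sg(6) l1 l2] .
  show ?case
  proof (intro exI[of _ L''] conjI ballI allI impI)
    show "circuit G L''" by (rule L''(1))
    show "set L'' = set L \<union> \<Union>(insert S T)" unfolding L''(2) L'(2) Sg(3) Seq by blast
  next
    fix x assume x: "x \<in> closed_links L" and av: "\<forall>e u v. rung k e u v \<and> v \<in> \<Union>(insert S T) \<longrightarrow> u \<notin> x"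
    have "x \<in> closed_links L'" by (rule keep[OF x]) (use av in blast)
    moreover have "a \<notin> x" using av r ends by blast
    ultimately show "x \<in> closed_links L''" using L''(3) by blast
  next
    fix w assume w: "c k w \<in> outward k \<inter> \<Union>(insert S T)"
    show "{c k w, c k (w + 1)} \<in> closed_links L''"
    proof (cases "c k w \<in> S")
      case True
      then obtain t' where t': "c k w = c k t'" "i \<le> t'" "t' \<le> j" unfolding Seq by auto
      \<comment> \<open>\<open>c k j\<close> is inward, so an outward vertex of the gap has its
        successor on the inserted path as well.\<close>
      have "c k j \<notin> outward k" using in_out[OF k(2), of "c k j"] gapD(6)[OF g(1)] by simp
      then have "t' \<noteq> j" using t' w by auto
      then have "{c k t', c k (t' + 1)} \<in> links ?p" unfolding links_upto using t' by fastforce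
      then show ?thesis using L''(3) c_step[OF k(2) t'(1), of 1] t'(1) by auto
    next
      case False
      then have "{c k w, c k (w + 1)} \<in> closed_links L'" using linked w by blast
      \<comment> \<open>Links at level \<open>k\<close> are never consumed, because the link removed
        lies on \<open>C (k - 1)\<close>.\<close>
      moreover have "{c k w, c k (w + 1)} \<noteq> {a, b}"
      proof
        assume "{c k w, c k (w + 1)} = {a, b}"
        then have "a \<in> V k" by (auto simp: doubleton_eq_iff)
        moreover have "a \<in> V (k - 1)" using r unfolding rung_def by auto
        moreover have "k - 1 \<le> n" "k \<noteq> k - 1" using k by auto
        ultimately show False using V_disjoint[OF k(2)] by blast
      qed
      ultimately show ?thesis using L''(3) by blast
    qed
  qed
qed

text \<open>Marked gaps partition \<open>V k\<close>: an inward vertex has exactly one marked side,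
  and the gap around an outward vertex is marked because the next annulus is a block
  annulus.\<close>

lemma block_step:
  assumes P: "four_cycle_class G pos crv C k P" and k: "1 \<le> k" "k < n"
    and block: "\<forall>e\<in>rungs G C (k + 1). \<exists>F\<in>P. attached G pos crv C (k + 1) e F"
    and L: "spanning_circuit (k - 1) L"
  shows "\<exists>L'. spanning_circuit k L'"
proof -
  have kn: "k \<le> n" using k by simp
  have sub: "P \<subseteq> outer_faces G pos crv C k" using P unfolding four_cycle_class_def by blast
  have "finite (V k)" using V_verts[OF kn] fin finite_subset by blast
  moreover have "marked_sets k P \<subseteq> Pow (V k)" unfolding marked_sets_def by auto
  ultimately have finT: "finite (marked_sets k P)" using finite_subset by blast
  have U: "\<Union>(marked_sets k P) = V k"
  proof
    show "\<Union>(marked_sets k P) \<subseteq> V k" unfolding marked_sets_def by auto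
    show "V k \<subseteq> \<Union>(marked_sets k P)"
    proof
      fix v assume "v \<in> V k"
      then obtain t where t: "v = c k t" unfolding V_def by auto
      have "\<exists>i j. gap k i j \<and> marked P (ed k i) \<and> i \<le> t \<and> t \<le> j"
      proof (cases "c k t \<in> inward k")
        case True
        then show ?thesis
          by (cases rule: marked_gap_at[OF P k(1) kn, of t]) (use gapD(4) less_imp_le in blast)+
      next
        case False
        then have "c k t \<in> outward k" using in_out[OF kn, of "c k t"] by simp
        note lb = marked_block[OF P k block this]
        obtain i j where g: "gap k i j" "i < t" "t < j" using gap_around[OF k(1) kn False] .
        then have "marked P (ed k i)" using marked_gap[OF sub g(1), of i t] lb by auto
        then show ?thesis using g less_imp_le by blast
      qed
      then show "v \<in> \<Union>(marked_sets k P)" unfolding marked_sets_def t by fastforce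
    qed
  qed
  obtain L' where L': "circuit G L'" "set L' = set L \<union> V k"
    "\<And>t. c k t \<in> outward k \<Longrightarrow> {c k t, c k (t + 1)} \<in> closed_links L'"
    using marked_sets_insert[OF P k(1) kn L finT] unfolding U by auto
  moreover have "set L = (\<Union>j\<le>k - 1. V j)" using L unfolding spanning_circuit_def by auto
  ultimately have "spanning_circuit k L'"
    unfolding spanning_circuit_def using Union_V[OF k(1)] by auto
  then show ?thesis ..
qed

text \<open>One of the two cycle edges at an inward vertex is marked. Its ends cannot be outward
  when the next annulus is a ring annulus, so it is a gap by itself, and its face is the 4-cycle for
  merging.\<close>

lemma ring_step:
  assumes P: "four_cycle_class G pos crv C k P" and k: "1 \<le> k" "k < n"
    and ring: "\<forall>e\<in>rungs G C (k + 1). \<exists>F\<in>outer_faces G pos crv C k - P. attached G pos crv C (k + 1) e F"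
    and L: "spanning_circuit (k - 1) L"
  shows "\<exists>L'. spanning_circuit k L'"
proof -
  have kn: "k \<le> n" using k by simp
  obtain v where "v \<in> inward k" using inward_ex[OF k(1) kn] by blast
  then obtain w where w: "c k w \<in> inward k" using inward_V unfolding V_def by blast
  obtain t where t: "marked P (ed k t)" using marked_flip[OF P k(1) kn w] by blast
  have "c k t \<in> inward k"
    using marked_ring(1)[OF P k ring, of t] t in_out[OF kn, of "c k t"] by auto
  moreover have "c k (t + 1) \<in> inward k"
    using marked_ring(2)[OF P k ring, of "t + 1"] t in_out[OF kn, of "c k (t + 1)"] by auto
  ultimately have g: "gap k t (t + 1)" unfolding gap_def using k by auto
  obtain r a where r: "rung k r a (c k t)" using inward_rung[OF gapD(5)[OF g]] by blast
  obtain s b where s: "rung k s b (c k (t + 1))" using inward_rung[OF gapD(6)[OF g]] by blast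
  obtain t' where "{a, b} = {c (k - 1) t', c (k - 1) (t' + 1)}" using marked_feet[OF P g t r s] by blast
  then show ?thesis using merge_step[OF k(1) kn L r s] by blast
qed

text \<open>
  Cutting the annulus at a gap of \<open>C k\<close> shows that consecutive rungs on the outer side are consecutive
  on the inner side; as there are at least three rungs, the converse holds as well.
\<close>

lemma consecutive_feet:
  assumes k: "1 \<le> k" "k \<le> n" and u: "u < u'" "u' < u + l (k - 1)"
    and r: "rung k e (c (k - 1) u) v" and r': "rung k e' (c (k - 1) u') v'"
    and none: "\<And>t. u < t \<Longrightarrow> t < u' \<Longrightarrow> c (k - 1) t \<notin> outward (k - 1)"
  obtains i j where "gap k i j" "{v, v'} = {c k i, c k j}"
proof (rule ccontr)
  assume neg: "\<not> thesis"
  have k': "k - 1 \<le> n" using k by simp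
  \<comment> \<open>A neighbour \<open>w\<close> of \<open>v\<close> among the inward vertices has
    its foot next to \<open>c (k - 1) u\<close> among the outward ones. Upwards this would be
    \<open>c (k - 1) u'\<close>, whose rung leads to \<open>v'\<close>; that is excluded, so the
    foot is the next outward vertex below \<open>u\<close>.\<close>
  have side: "\<exists>s<u. c (k - 1) s = a \<and> (\<forall>t. s < t \<longrightarrow> t < u \<longrightarrow> c (k - 1) t \<notin> outward (k - 1))"
    if g: "gap k i j" and vw: "{v, w} = {c k i, c k j}" and ra: "rung k f a w" for i j w a f
  proof -
    have "w \<noteq> v'" using neg that(1,2) \<open>\<And>i j. gap k i j \<Longrightarrow> {v, v'} = {c k i, c k j} \<Longrightarrow> thesis\<close> by blast
    then have au: "a \<noteq> c (k - 1) u'" using rung_inner_unique(2) ra r' by blast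
    obtain r1 a1 where r1: "rung k r1 a1 (c k i)" using inward_rung[OF gapD(5)[OF g]] by blast
    obtain s1 b1 where s1: "rung k s1 b1 (c k j)" using inward_rung[OF gapD(6)[OF g]] by blast
    have "{a1, b1} = {c (k - 1) u, a}"
      using vw rung_outer_unique(2) r ra r1 s1 by (metis doubleton_eq_iff)
    moreover obtain i' j' where ij: "i' < j'" "j' < i' + l (k - 1)"
      "{c (k - 1) i', c (k - 1) j'} = {a1, b1}"
      "\<And>t. i' < t \<Longrightarrow> t < j' \<Longrightarrow> c (k - 1) t \<notin> outward (k - 1)"
      using gap_feet[OF g r1 s1] by blast
    ultimately consider "c (k - 1) i' = c (k - 1) u" "c (k - 1) j' = a"
      | "c (k - 1) j' = c (k - 1) u" "c (k - 1) i' = a" by (metis doubleton_eq_iff)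
    then show ?thesis
    proof cases
      case 1
      let ?d = "u - i'"
      have sh: "c (k - 1) (t + ?d) = c (k - 1) t" for t
        using c_step[OF k' 1(1), of "t - i'"] by (simp add: algebra_simps)
      have ja: "c (k - 1) (j' + ?d) = a" using sh 1 by simp
      have "j' + ?d \<noteq> u'" using ja au by auto
      moreover have "\<not> j' + ?d < u'"
        using none[of "j' + ?d"] ij(1) ja rung_out[OF ra] by auto
      ultimately have "u' < j' + ?d" by simp
      then have "c (k - 1) (u' - ?d) \<notin> outward (k - 1)" using ij(4)[of "u' - ?d"] u by simp
      moreover have "c (k - 1) (u' - ?d) = c (k - 1) u'" using sh[of "u' - ?d"] by simp
      ultimately show ?thesis using rung_out[OF r'] by simp
    next
      case 2
      let ?d = "u - j'"
      have sh: "c (k - 1) (t + ?d) = c (k - 1) t" for t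
        using c_step[OF k' 2(1), of "t - j'"] by (simp add: algebra_simps)
      have "c (k - 1) t \<notin> outward (k - 1)" if "i' + ?d < t" "t < u" for t
        using ij(4)[of "t - ?d"] sh[of "t - ?d"] that by simp
      then show ?thesis using sh[of i'] 2 ij(1) by (intro exI[of _ "i' + ?d"]) auto
    qed
  qed
  have v: "v \<in> inward k" by (rule rung_in[OF r])
  then obtain i0 where i0: "v = c k i0" using inward_V unfolding V_def by blast
  obtain i1 where g1: "gap k i1 i0" using gap_prev[OF k] v i0 by blast
  obtain i2 where g2: "gap k i0 i2" using gap_next[OF k] v i0 by blast
  obtain f1 a1 where a1: "rung k f1 a1 (c k i1)" using inward_rung[OF gapD(5)[OF g1]] by blast
  obtain f2 a2 where a2: "rung k f2 a2 (c k i2)" using inward_rung[OF gapD(6)[OF g2]] by blast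
  obtain s1 where s1: "s1 < u" "c (k - 1) s1 = a1" "\<And>t. s1 < t \<Longrightarrow> t < u \<Longrightarrow> c (k - 1) t \<notin> outward (k - 1)"
    using side[OF g1 _ a1] i0 by auto
  obtain s2 where s2: "s2 < u" "c (k - 1) s2 = a2" "\<And>t. s2 < t \<Longrightarrow> t < u \<Longrightarrow> c (k - 1) t \<notin> outward (k - 1)"
    using side[OF g2 _ a2] i0 by auto
  \<comment> \<open>Both neighbours of \<open>v\<close> thus have the same foot and are equal, so
    only two inward vertices exist, against the bound of three.\<close>
  have "s1 = s2"
    using s1(3)[of s2] s2(3)[of s1] s1 s2 rung_out[OF a1] rung_out[OF a2]
    by (cases s1 s2 rule: linorder_cases) auto
  then have eq: "c k i1 = c k i2" using s1 s2 a1 a2 rung_inner_unique(2) by blast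
  then have "i1 mod l k = i2 mod l k" using c_eq[OF k(2)] by blast
  then have "l k dvd i2 - i1" by (metis mod_eq_dvd_iff)
  then obtain m where m: "i2 - i1 = l k * m" by blast
  have less: "i1 < i0" "i0 < i2" "i0 < i1 + l k" "i2 < i0 + l k"
    using gapD(4)[OF g1] gapD(4)[OF g2] gap_less(1)[OF g1] gap_less(1)[OF g2] by auto
  have "0 < l k * m" "l k * m < l k * 2" using m less by linarith+
  moreover have "0 < l k" using l3[OF k(2)] by simp
  ultimately have "0 < m" "m < 2" by (simp_all add: zero_less_mult_iff)
  then have "m = 1" by simp
  then have "i2 = i1 + l k" using m by simp
  then have "inward k \<subseteq> {c k i1, c k i0}"
  proof (intro subsetI)
    fix w assume w: "w \<in> inward k"
    then obtain t where t: "i1 \<le> t" "t < i1 + l k" "c k t = w" using V_window[OF k(2)] inward_V by blast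
    have "t = i1 \<or> t = i0"
      using gapD(7)[OF g1, of t] gapD(7)[OF g2, of t] t w \<open>i2 = i1 + l k\<close> by force
    then show "w \<in> {c k i1, c k i0}" using t by auto
  qed
  then have "card (inward k) \<le> card {c k i1, c k i0}" by (rule card_mono[rotated]) simp
  also have "\<dots> \<le> 2" by (simp add: card_insert_if)
  finally show False using card_inward[OF k] by simp
qed

section \<open>Parity from the 2-colouring, and the 4-cycles at the two ends\<close>

definition two_colouring :: "'v set \<Rightarrow> bool" where
  "two_colouring A \<longleftrightarrow> (\<forall>e\<in>edges G. \<forall>u v. ends G e = {u, v} \<longrightarrow> (u \<in> A) \<noteq> (v \<in> A))"

lemma two_colouring_edge:
  assumes "two_colouring A" "e \<in> edges G" "ends G e = {u, v}"
  shows "(u \<in> A) \<noteq> (v \<in> A)"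
proof -
  have "\<forall>u v. ends G e = {u, v} \<longrightarrow> (u \<in> A) \<noteq> (v \<in> A)"
    using assms(1,2) unfolding two_colouring_def by (rule bspec)
  then have "ends G e = {u, v} \<longrightarrow> (u \<in> A) \<noteq> (v \<in> A)" by (elim allE)
  then show ?thesis using assms(3) by (rule mp)
qed

lemma two_colouring_ex: "\<exists>A. two_colouring A"
proof -
  obtain A where A: "A \<subseteq> verts G" "\<forall>e\<in>edges G. \<exists>a\<in>A. \<exists>b\<in>verts G - A. ends G e = {a, b}"
    using bip unfolding bipartite_def by blast
  have "(u \<in> A) \<noteq> (v \<in> A)" if "e \<in> edges G" and "ends G e = {u, v}" for e u v
  proof -
    obtain a b where "a \<in> A" "b \<in> verts G - A" "ends G e = {a, b}" using A(2) \<open>e \<in> edges G\<close> by blast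
    then show ?thesis using that by (auto simp: doubleton_eq_iff)
  qed
  then have "two_colouring A" unfolding two_colouring_def by (intro ballI allI impI)
  then show ?thesis ..
qed

lemma colouring_parity:
  assumes A: "two_colouring A"
    and k: "k \<le> n" and ij: "i \<le> j"
  shows "(c k i \<in> A \<longleftrightarrow> c k j \<in> A) \<longleftrightarrow> even (j - i)"
  using ij
proof (induction j rule: int_ge_induct)
  case (step j)
  have "(c k j \<in> A) \<noteq> (c k (j + 1) \<in> A)" using two_colouring_edge[OF A ed_edge[OF k] ends_ed[OF k]] .
  moreover have "even (j + 1 - i) \<longleftrightarrow> \<not> even (j - i)" by presburger
  ultimately show ?case using step by auto
qed simp

lemma feet_colouring:
  assumes A: "two_colouring A"
    and "rung k e a u" "rung k e' b v"
  shows "(a \<in> A \<longleftrightarrow> b \<in> A) \<longleftrightarrow> (u \<in> A \<longleftrightarrow> v \<in> A)"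
proof -
  have "(a \<in> A) \<noteq> (u \<in> A)" "(b \<in> A) \<noteq> (v \<in> A)"
    using two_colouring_edge[OF A] assms(2,3) unfolding rung_def by blast+
  then show ?thesis by blast
qed

lemma C_neighbour: "k \<le> n \<Longrightarrow> {c k s, w} = {c k t, c k (t + 1)} \<Longrightarrow> w = c k (s + 1) \<or> w = c k (s - 1)"
proof -
  assume k: "k \<le> n" and "{c k s, w} = {c k t, c k (t + 1)}"
  then consider "c k s = c k t" "w = c k (t + 1)" | "c k s = c k (t + 1)" "w = c k t"
    by (auto simp: doubleton_eq_iff)
  then show ?thesis
    using c_step[OF k, of s t 1] c_step[OF k, of s "t + 1" "- 1"] by cases auto
qed

text \<open>
  As marked and unmarked segments alternate, this is a perfect matching of \<open>outward k\<close> by edges of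
  \<open>C k\<close>.
\<close>

definition foot_pair :: "nat \<Rightarrow> complex set set \<Rightarrow> 'v \<Rightarrow> 'v \<Rightarrow> bool" where
  "foot_pair k P a b \<longleftrightarrow> (\<exists>i j e e' u v. gap (k + 1) i j \<and> marked P (ed (k + 1) i) \<and>
     rung (k + 1) e a u \<and> rung (k + 1) e' b v \<and> {u, v} = {c (k + 1) i, c (k + 1) j})"

lemma foot_pairI:
  assumes "gap (k + 1) i j" "marked P (ed (k + 1) i)" "rung (k + 1) e a u" "rung (k + 1) e' b v"
    "{u, v} = {c (k + 1) i, c (k + 1) j}"
  shows "foot_pair k P a b"
  unfolding foot_pair_def using assms by (intro exI conjI)

lemma foot_pairE:
  assumes "foot_pair k P a b"
  obtains i j e e' u v where "gap (k + 1) i j" "marked P (ed (k + 1) i)" "rung (k + 1) e a u"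
    "rung (k + 1) e' b v" "{u, v} = {c (k + 1) i, c (k + 1) j}"
  using assms unfolding foot_pair_def by (elim exE conjE) (rule that)

lemma foot_pair_sym: "foot_pair k P a b \<Longrightarrow> foot_pair k P b a"
  by (erule foot_pairE, rule foot_pairI, assumption+) (simp add: insert_commute)

lemma foot_pair_out: "foot_pair k P a b \<Longrightarrow> b \<in> outward k"
  by (erule foot_pairE) (auto simp: outward_def)

text \<open>One side of the outer end of the rung at \<open>a\<close> is marked; the marked gap on
  that side has the rung of the partner at its other end.\<close>

lemma foot_pair_ex:
  assumes P: "four_cycle_class G pos crv C (k + 1) P" and k: "k < n" and a: "a \<in> outward k"
  shows "\<exists>b. foot_pair k P a b"
proof -
  have kk: "1 \<le> k + 1" "k + 1 \<le> n" using k by auto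
  obtain e u where e: "rung (k + 1) e a u" using a unfolding outward_def by blast
  then obtain t where t: "u = c (k + 1) t" using inward_V[of "k + 1"] unfolding rung_def V_def by auto
  have tin: "c (k + 1) t \<in> inward (k + 1)" using rung_in[OF e] t by simp
  show ?thesis
  proof (cases rule: marked_gap_at[OF P kk tin])
    case (1 i)
    obtain e' b where "rung (k + 1) e' b (c (k + 1) i)" using inward_rung[OF gapD(6)[OF 1(1)]] by blast
    then have "foot_pair k P a b" using foot_pairI[OF 1 e] t by simp
    then show ?thesis ..
  next
    case (2 i)
    obtain e' b where "rung (k + 1) e' b (c (k + 1) i)" using inward_rung[OF gapD(5)[OF 2(1)]] by blast
    then have "foot_pair k P a b" using foot_pairI[OF 2 e] t by (simp add: insert_commute)
    then show ?thesis ..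
  qed
qed

text \<open>Two marked gaps through the same outer end coincide, and a gap has only one other
  end.\<close>

lemma foot_pair_unique:
  assumes P: "four_cycle_class G pos crv C (k + 1) P" and ab: "foot_pair k P a b" "foot_pair k P a b'"
  shows "b = b'"
proof -
  obtain i j e f u v where g: "gap (k + 1) i j" "marked P (ed (k + 1) i)"
    and e: "rung (k + 1) e a u" and f: "rung (k + 1) f b v" and uv: "{u, v} = {c (k + 1) i, c (k + 1) j}"
    using foot_pairE[OF ab(1)] .
  obtain i2 j2 e2 f2 u2 v2 where g2: "gap (k + 1) i2 j2" "marked P (ed (k + 1) i2)"
    and e2: "rung (k + 1) e2 a u2" and f2: "rung (k + 1) f2 b' v2"
    and uv2: "{u2, v2} = {c (k + 1) i2, c (k + 1) j2}"
    using foot_pairE[OF ab(2)] .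
  have u: "u2 = u" using rung_inner_unique(2)[OF e2 e] .
  have mem: "c (k + 1) ` {i..j} \<in> marked_sets (k + 1) P" "c (k + 1) ` {i2..j2} \<in> marked_sets (k + 1) P"
    unfolding marked_sets_def using g g2 by blast+
  have ends: "{u, v} \<subseteq> c (k + 1) ` {i..j}" "{u2, v2} \<subseteq> c (k + 1) ` {i2..j2}"
    unfolding uv uv2 using gapD(4)[OF g(1)] gapD(4)[OF g2(1)] by auto
  have "c (k + 1) ` {i..j} = c (k + 1) ` {i2..j2}"
    by (rule marked_sets_disjoint[OF P mem, of u]) (use ends u in auto)
  then have "v2 \<in> c (k + 1) ` {i..j}" using ends(2) by simp
  then obtain t where t: "v2 = c (k + 1) t" "i \<le> t" "t \<le> j" by auto
  have "c (k + 1) t \<in> inward (k + 1)" using rung_in[OF f2] t by simp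
  then have "t = i \<or> t = j" using gapD(7)[OF g(1), of t] t by force
  then have "v2 \<in> {u, v}" unfolding uv using t by auto
  moreover have "v2 \<noteq> u2" using uv2 gap_less(2)[OF g2(1)] by (metis doubleton_eq_iff insert_absorb2)
  ultimately have "v2 = v" using u by auto
  then show ?thesis using rung_outer_unique(2) f f2 by blast
qed

lemma foot_pair_adjacent:
  assumes P: "four_cycle_class G pos crv C (k + 1) P" and ab: "foot_pair k P a b"
  shows "\<exists>t. {a, b} = {c k t, c k (t + 1)}"
proof -
  obtain i j e f u v where g: "gap (k + 1) i j" "marked P (ed (k + 1) i)"
    and e: "rung (k + 1) e a u" and f: "rung (k + 1) f b v" and uv: "{u, v} = {c (k + 1) i, c (k + 1) j}"
    using foot_pairE[OF ab] .
  have "u = c (k + 1) i \<and> v = c (k + 1) j \<or> u = c (k + 1) j \<and> v = c (k + 1) i"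
    using uv by (auto simp: doubleton_eq_iff)
  then show ?thesis
  proof
    assume "u = c (k + 1) i \<and> v = c (k + 1) j"
    then show ?thesis using marked_feet[OF P g, of e a f b] e f by simp
  next
    assume "u = c (k + 1) j \<and> v = c (k + 1) i"
    then show ?thesis using marked_feet[OF P g, of f b e a] e f by (simp add: insert_commute)
  qed
qed

text \<open>Since partners are adjacent, a run of outward vertices leaves no choice: the first
  cannot be matched with the vertex before the run, hence is matched with its successor, and so on
  in twos. A run enclosed by inward vertices therefore has even length.\<close>

lemma foot_pair_next:
  assumes P: "four_cycle_class G pos crv C (k + 1) P" and k: "k < n"
    and i: "c k i \<notin> outward k" and run: "\<And>t. i < t \<Longrightarrow> t < j \<Longrightarrow> c k t \<in> outward k"
  shows "i + 2 * int m + 1 < j \<Longrightarrow> foot_pair k P (c k (i + 2 * int m + 1)) (c k (i + 2 * int m + 2))"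
proof (induction m)
  case 0
  have kn: "k \<le> n" using k by simp
  have "c k (i + 1) \<in> outward k" using run 0 by simp
  then obtain b where b: "foot_pair k P (c k (i + 1)) b" using foot_pair_ex[OF P k] by blast
  then obtain t where "{c k (i + 1), b} = {c k t, c k (t + 1)}" using foot_pair_adjacent[OF P] by blast
  then have "b = c k (i + 1 + 1) \<or> b = c k (i + 1 - 1)" by (rule C_neighbour[OF kn])
  moreover have "b \<noteq> c k i" using foot_pair_out[OF b] i by blast
  ultimately have "b = c k (i + 2)" by (simp add: add.assoc)
  then show ?case using b by simp
next
  case (Suc m)
  have kn: "k \<le> n" using k by simp
  let ?s = "i + 2 * int m + 3"
  have "c k ?s \<in> outward k" using run Suc.prems by simp
  then obtain b where b: "foot_pair k P (c k ?s) b" using foot_pair_ex[OF P k] by blast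
  then obtain t where "{c k ?s, b} = {c k t, c k (t + 1)}" using foot_pair_adjacent[OF P] by blast
  then have "b = c k (?s + 1) \<or> b = c k (?s - 1)" by (rule C_neighbour[OF kn])
  moreover have "b \<noteq> c k (?s - 1)"
  proof
    assume "b = c k (?s - 1)"
    moreover have "?s - 1 = i + 2 * int m + 2" by simp
    ultimately have 1: "foot_pair k P (c k (i + 2 * int m + 2)) (c k ?s)"
      using foot_pair_sym[OF b] by (simp only:)
    have 2: "foot_pair k P (c k (i + 2 * int m + 2)) (c k (i + 2 * int m + 1))"
      using foot_pair_sym[OF Suc.IH] Suc.prems by simp
    have "c k ?s = c k (i + 2 * int m + 1)" using foot_pair_unique[OF P 1 2] .
    then show False using c_inj[OF kn, of ?s "i + 2 * int m + 1"] l3[OF kn] by simp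
  qed
  ultimately have "foot_pair k P (c k ?s) (c k (?s + 1))" using b by simp
  then show ?case by (simp add: algebra_simps)
qed

text \<open>Otherwise both neighbours on \<open>C 1\<close> of an inward vertex are outward and
  carry successive rungs of the second annulus. They have equal colours, so the gap of
  \<open>C 2\<close> between the outer ends has even length and contains an odd number of outward
  vertices. Equal colours also forbid it to be marked, as marked gaps have adjacent feet. If the
  third annulus is a block annulus, an outward vertex would mark the gap; in the other case the foot
  pairs of \<open>P'\<close> would match a run of odd length.\<close>

lemma adjacent_inner_ends:
  assumes n: "2 < n" and P: "four_cycle_class G pos crv C 2 P"
    and type: "(\<forall>e\<in>rungs G C 3. \<exists>F\<in>P. attached G pos crv C 3 e F) \<or>
      (3 < n \<and> four_cycle_class G pos crv C 3 P')"
  shows "\<exists>t. c 1 t \<in> inward 1 \<and> c 1 (t + 1) \<in> inward 1"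
proof (rule ccontr)
  assume neg: "\<not> ?thesis"
  have n1: "1 \<le> n" "(1::nat) \<le> 2" "2 \<le> n" "(1::nat) \<le> 1" "2 < n" using n by auto
  obtain v where "v \<in> inward 1" using inward_ex[of 1] n1 by blast
  then obtain u where u: "c 1 u \<in> inward 1" using inward_V unfolding V_def by blast
  have "c 1 (u + 1) \<notin> inward 1" using neg u by blast
  then have o1: "c 1 (u + 1) \<in> outward 1" using in_out[OF n1(1), of "c 1 (u + 1)"] by simp
  have "c 1 (u - 1 + 1) \<in> inward 1" using u by simp
  then have "c 1 (u - 1) \<notin> inward 1" using neg by blast
  then have o2: "c 1 (u - 1) \<in> outward 1" using in_out[OF n1(1), of "c 1 (u - 1)"] by simp
  obtain e a where e: "rung 2 e (c 1 (u - 1)) a" using o2 unfolding outward_def by (auto simp: numeral_2_eq_2)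
  obtain f b where f: "rung 2 f (c 1 (u + 1)) b" using o1 unfolding outward_def by (auto simp: numeral_2_eq_2)
  have none: "c 1 t \<notin> outward 1" if "u - 1 < t" "t < u + 1" for t
  proof -
    have "t = u" using that by simp
    then show ?thesis using u in_out[OF n1(1), of "c 1 u"] by simp
  qed
  have lt: "u - 1 < u + 1" "u + 1 < u - 1 + l 1" 
  proof -
    have "l 1 \<noteq> 3"
    proof
      assume l: "l 1 = 3"
      obtain A where A: "two_colouring A" using two_colouring_ex by blast
      have "(c 1 0 \<in> A \<longleftrightarrow> c 1 (0 + 3) \<in> A) \<longleftrightarrow> even (0 + 3 - 0 :: int)"
        by (rule colouring_parity[OF A n1(1)]) auto
      moreover have "c 1 (0 + 3) = c 1 0" using c_period[OF n1(1), of 0 1] l by simp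
      ultimately show False by simp
    qed
    then show "u - 1 < u + 1" "u + 1 < u - 1 + l 1" using l3[OF n1(1)] by auto
  qed
  have "(2::nat) - 1 = 1" by simp
  then obtain i j where g: "gap 2 i j" and ab: "{a, b} = {c 2 i, c 2 j}"
    using consecutive_feet[OF n1(2,3), of "u - 1" "u + 1" e a f b] lt e f none by metis
  obtain A where A: "two_colouring A" using two_colouring_ex by blast
  have "(c 1 (u - 1) \<in> A \<longleftrightarrow> c 1 (u + 1) \<in> A) \<longleftrightarrow> even (u + 1 - (u - 1))"
    by (rule colouring_parity[OF A n1(1)]) auto
  then have same: "c 1 (u - 1) \<in> A \<longleftrightarrow> c 1 (u + 1) \<in> A" by simp
  then have "a \<in> A \<longleftrightarrow> b \<in> A" using feet_colouring[OF A e f] by simp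
  then have "c 2 i \<in> A \<longleftrightarrow> c 2 j \<in> A" using ab by (auto simp: doubleton_eq_iff)
  then have ev: "even (j - i)" using colouring_parity[OF A n1(3), of i j] gapD(4)[OF g] by simp
  then have ij: "i + 2 \<le> j" using gapD(4)[OF g] by presburger
  have not_marked: "\<not> marked P (ed 2 i)"
  proof
    assume marked: "marked P (ed 2 i)"
    obtain r a1 where r: "rung 2 r a1 (c 2 i)" using inward_rung[OF gapD(5)[OF g]] by blast
    obtain s b1 where s: "rung 2 s b1 (c 2 j)" using inward_rung[OF gapD(6)[OF g]] by blast
    have ends: "{a1, b1} = {c 1 (u - 1), c 1 (u + 1)}"
      using ab rung_outer_unique(2) r s e f by (metis doubleton_eq_iff)
    obtain t where t: "{a1, b1} = {c (2 - 1) t, c (2 - 1) (t + 1)}" using marked_feet[OF P g marked r s] by blast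
    have "(c 1 t \<in> A) \<noteq> (c 1 (t + 1) \<in> A)" using two_colouring_edge[OF A ed_edge[OF n1(1)] ends_ed[OF n1(1)]] .
    then show False using ends t same by (auto simp: doubleton_eq_iff)
  qed
  have run: "c 2 t \<in> outward 2" if "i < t" "t < j" for t
    using gapD(7)[OF g that] in_out[OF n1(3), of "c 2 t"] by simp
  have eq3: "(2::nat) + 1 = 3" by simp
  show False
  proof (cases "\<forall>e\<in>rungs G C 3. \<exists>F\<in>P. attached G pos crv C 3 e F")
    case True
    have "marked P (ed 2 (i + 1 - 1))"
      by (rule marked_block(2)[OF P n1(2,5)]) (use True run[of "i + 1"] ij in \<open>simp_all add: eq3\<close>)
    then show False using not_marked by simp
  next
    case False
    then have P': "four_cycle_class G pos crv C (2 + 1) P'" using type eq3 by metis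
    \<comment> \<open>The run has \<open>2 * int m' + 1\<close> vertices, so its last one would be
      matched with \<open>c 2 j\<close>, which is inward.\<close>
    obtain m where m: "j - i = 2 * m" using ev by (elim evenE)
    have "m \<ge> 1" using m ij by simp
    then obtain m' where m': "m = int m' + 1" by (metis add.commute zle_iff_zadd)
    have iout: "c 2 i \<notin> outward 2" using in_out[OF n1(3), of "c 2 i"] gapD(5)[OF g] by simp
    have "foot_pair 2 P' (c 2 (i + 2 * int m' + 1)) (c 2 (i + 2 * int m' + 2))"
      by (rule foot_pair_next[OF P' n1(5) iout run]) (use m m' in auto)
    moreover have "i + 2 * int m' + 2 = j" using m m' by simp
    ultimately have "c 2 j \<in> outward 2" using foot_pair_out by metis
    then show False using in_out[OF n1(3), of "c 2 j"] gapD(6)[OF g] by simp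
  qed
qed

text \<open>No vertex of \<open>C 0\<close> is inward, so all are outward, and feet that are
  successive among the outward vertices are adjacent on \<open>C 0\<close>. With the edge on
  \<open>C 1\<close> this closes the 4-cycle for merging.\<close>

lemma first_step:
  assumes n: "1 \<le> n" and t: "c 1 t \<in> inward 1" "c 1 (t + 1) \<in> inward 1" and L: "spanning_circuit 0 L"
  shows "\<exists>L'. spanning_circuit 1 L'"
proof -
  have g: "gap 1 t (t + 1)" unfolding gap_def using n t by auto
  obtain r a where r: "rung 1 r a (c 1 t)" using inward_rung[OF t(1)] by blast
  obtain s b where s: "rung 1 s b (c 1 (t + 1))" using inward_rung[OF t(2)] by blast
  obtain i' j' where ij: "i' < j'" "{c (1 - 1) i', c (1 - 1) j'} = {a, b}"
    "\<And>t. i' < t \<Longrightarrow> t < j' \<Longrightarrow> c (1 - 1) t \<notin> outward (1 - 1)"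
    by (rule gap_feet[OF g r s]) (rule that; blast)
  have "c 0 (i' + 1) \<in> outward 0" using in_out[of 0 "c 0 (i' + 1)"] inward_0 by simp
  then have "\<not> i' + 1 < j'" using ij(3)[of "i' + 1"] by auto
  then have "j' = i' + 1" using ij(1) by simp
  then have "{a, b} = {c (1 - 1) i', c (1 - 1) (i' + 1)}" using ij(2) by simp
  moreover have "spanning_circuit (1 - 1) L" using L by simp
  ultimately show ?thesis using merge_step[OF le_refl n _ r s] by blast
qed

text \<open>A gap of \<open>C (n - 1)\<close> with an outward vertex is marked, so its feet are
  adjacent and its ends differ in colour. Its length is odd and it contains two adjacent outward
  vertices. As all vertices of \<open>C n\<close> are inward, the rungs at these two end in adjacent
  vertices of \<open>C n\<close>.\<close>

lemma last_step:
  assumes n: "2 \<le> n" and P: "four_cycle_class G pos crv C (n - 1) P"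
    and block: "\<forall>e\<in>rungs G C n. \<exists>F\<in>P. attached G pos crv C n e F"
    and L: "spanning_circuit (n - 1) L"
  shows "\<exists>L'. spanning_circuit n L'"
proof -
  let ?k = "n - 1"
  have k: "1 \<le> ?k" "?k < n" "?k \<le> n" "?k + 1 = n" "1 \<le> n" using n by auto
  have sub: "P \<subseteq> outer_faces G pos crv C ?k" using P unfolding four_cycle_class_def by blast
  obtain v where "v \<in> inward n" using inward_ex[OF k(5)] by blast
  then obtain e a where "rung n e a v" using inward_rung by blast
  then have "a \<in> outward ?k" by (rule rung_out)
  then obtain u where u: "c ?k u \<in> outward ?k" using outward_V unfolding V_def by blast
  then have "c ?k u \<notin> inward ?k" using in_out[OF k(3), of "c ?k u"] by simp
  then obtain i j where g: "gap ?k i j" "i < u" "u < j" using gap_around[OF k(1,3)] by blast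
  have "marked P (ed ?k u)"
    by (rule marked_block(1)[OF P k(1,2) _ u]) (use block k(4) in simp)
  then have marked: "marked P (ed ?k i)" using marked_gap[OF sub g(1), of i u] g by auto
  obtain r a1 where r: "rung ?k r a1 (c ?k i)" using inward_rung[OF gapD(5)[OF g(1)]] by blast
  obtain s b1 where s: "rung ?k s b1 (c ?k j)" using inward_rung[OF gapD(6)[OF g(1)]] by blast
  obtain A where A: "two_colouring A" using two_colouring_ex by blast
  obtain t where t: "{a1, b1} = {c (?k - 1) t, c (?k - 1) (t + 1)}" using marked_feet[OF P g(1) marked r s] by blast
  have kk: "?k - 1 \<le> n" using n by simp
  have "(c (?k - 1) t \<in> A) \<noteq> (c (?k - 1) (t + 1) \<in> A)" using two_colouring_edge[OF A ed_edge[OF kk] ends_ed[OF kk]] .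
  then have "(a1 \<in> A) \<noteq> (b1 \<in> A)" using t by (auto simp: doubleton_eq_iff)
  then have "(c ?k i \<in> A) \<noteq> (c ?k j \<in> A)" using feet_colouring[OF A r s] by simp
  then have "odd (j - i)" using colouring_parity[OF A k(3), of i j] gapD(4)[OF g(1)] by simp
  \<comment> \<open>Length 1 is impossible because \<open>u\<close> lies strictly between
    \<open>i\<close> and \<open>j\<close>.\<close>
  then have ij: "i + 3 \<le> j" using g by presburger
  have out: "c ?k t \<in> outward ?k" if "i < t" "t < j" for t
    using gapD(7)[OF g(1) that] in_out[OF k(3), of "c ?k t"] by simp
  have "c ?k (i + 1) \<in> outward ?k" "c ?k (i + 2) \<in> outward ?k" using out ij by auto
  then obtain e1 u1 e2 u2 where e1: "rung n e1 (c ?k (i + 1)) u1" and e2: "rung n e2 (c ?k (i + 2)) u2"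
    unfolding outward_def using k(4) by auto
  have "i + 2 < i + 1 + l ?k" using l3[OF k(3)] by simp
  then obtain i' j' where g': "gap n i' j'" "{u1, u2} = {c n i', c n j'}"
    using consecutive_feet[OF k(5) le_refl, of "i + 1" "i + 2" e1 u1 e2 u2] e1 e2 by auto
  have "c n (i' + 1) \<in> inward n" using in_out[of n "c n (i' + 1)"] outward_n by simp
  then have "\<not> i' + 1 < j'" using gapD(7)[OF g'(1), of "i' + 1"] by auto
  then have "j' = i' + 1" using gapD(4)[OF g'(1)] by simp
  then have "{u1, u2} = {c n i', c n (i' + 1)}" using g'(2) by simp
  moreover have "{c ?k (i + 1), c ?k (i + 2)} = {c ?k (i + 1), c ?k (i + 1 + 1)}" by (simp add: add.assoc)
  ultimately show ?thesis using merge_step[OF k(5) le_refl L e1 e2] by blast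
qed

lemma hamiltonian_if_spanning: "spanning_circuit n L \<Longrightarrow> hamiltonian G"
  using hamiltonian_if_circuit[of G L] unfolding spanning_circuit_def verts_eq by blast

end

section \<open>Induction over the levels\<close>

theorem theorem3p4:
  fixes G :: "('v, 'e) mgraph"
    and pos :: "'v \<Rightarrow> complex" and crv :: "'e \<Rightarrow> complex set" and C :: "nat \<Rightarrow> 'e set"
    and x y :: nat
  assumes "adb_ac G pos crv C (x + y)"
    and "x \<ge> 1" and "y \<ge> 1"
    and "\<forall>k\<in>{1..x}. ring_annulus G pos crv C k"
    and "\<forall>k\<in>{x + 1..x + y}. block_annulus G pos crv C k"
  shows "hamiltonian G"
proof -
  let ?n = "x + y"
  have barn: "barnette G" and emb: "planar_annular_embedding G pos crv C ?n" and n: "?n > 2"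
    using assms(1) unfolding adb_ac_def by auto
  have simple: "simple_graph G" using barn unfolding barnette_def by blast
  have cycle: "\<forall>k\<le>?n. is_cycle G (C k)"
    using emb unfolding planar_annular_embedding_def by (elim conjE)
  \<comment> \<open>The three components are chosen as one tuple, so that a single application of
    \<open>choice\<close> fixes the parametrisations of all levels; beyond \<open>?n\<close> they
    are arbitrary.\<close>
  define periodic where "periodic k z \<longleftrightarrow> 3 \<le> snd (snd z) \<and>
      (\<forall>s t. fst z s = fst z t \<longleftrightarrow> s mod snd (snd z) = t mod snd (snd z)) \<and>
      C k = range (fst (snd z)) \<and> (\<forall>t. ends G (fst (snd z) t) = {fst z t, fst z (t + 1)})"
    for k and z :: "(int \<Rightarrow> 'v) \<times> (int \<Rightarrow> 'e) \<times> int"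
  have "\<exists>z. k \<le> ?n \<longrightarrow> periodic k z" for k
  proof (cases "k \<le> ?n")
    case True
    then have "is_cycle G (C k)" using cycle by simp
    then show ?thesis
    proof (rule is_cycle_periodic[OF simple])
      fix c ed and l :: int
      assume "3 \<le> l" "\<And>s t. c s = c t \<longleftrightarrow> s mod l = t mod l" "C k = range ed"
        "\<And>t. ends G (ed t) = {c t, c (t + 1)}"
      then have "periodic k (c, ed, l)" unfolding periodic_def by simp
      then show ?thesis by blast
    qed
  qed simp
  then have "\<forall>k. \<exists>z. k \<le> ?n \<longrightarrow> periodic k z" by (rule allI)
  then have "\<exists>z. \<forall>k. k \<le> ?n \<longrightarrow> periodic k (z k)" by (rule choice)
  then obtain z where z: "\<forall>k. k \<le> ?n \<longrightarrow> periodic k (z k)" by (rule exE)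
  define c where "c k = fst (z k)" for k
  define ed where "ed k = fst (snd (z k))" for k
  define l where "l k = snd (snd (z k))" for k
  have cyc: "3 \<le> l k" "c k s = c k t \<longleftrightarrow> s mod l k = t mod l k" "C k = range (ed k)"
    "ends G (ed k t) = {c k t, c k (t + 1)}" if "k \<le> ?n" for k s t
    using z that unfolding periodic_def c_def ed_def l_def by simp_all
  interpret annular G pos crv C ?n c ed l
    by unfold_locales (fact barn, fact emb, (rule cyc, assumption)+)
  \<comment> \<open>The type of annulus \<open>k + 1\<close> concerns the faces at level
    \<open>k\<close>, hence the shift. From level 2 on, the maximum in the definition is
    \<open>k + 1\<close> itself.\<close>
  have ring: "\<exists>P. four_cycle_class G pos crv C k P \<and>
      (\<forall>e\<in>rungs G C (k + 1). \<exists>F\<in>outer_faces G pos crv C k - P. attached G pos crv C (k + 1) e F)"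
    if "2 \<le> k" "k + 1 \<le> x" for k
  proof -
    have "ring_annulus G pos crv C (k + 1)" using assms(4) that by simp
    moreover have "max (k + 1) 3 = k + 1" using that by simp
    ultimately show ?thesis unfolding ring_annulus_def Let_def by simp
  qed
  have block: "\<exists>P. four_cycle_class G pos crv C k P \<and>
      (\<forall>e\<in>rungs G C (k + 1). \<exists>F\<in>P. attached G pos crv C (k + 1) e F)"
    if "2 \<le> k" "x < k + 1" "k < ?n" for k
  proof -
    have "block_annulus G pos crv C (k + 1)" using assms(5) that by simp
    moreover have "max (k + 1) 3 = k + 1" using that by simp
    ultimately show ?thesis unfolding block_annulus_def Let_def by simp
  qed
  have four_class: "\<exists>P. four_cycle_class G pos crv C k P" if "2 \<le> k" "k < ?n" for k
    using ring[OF that(1)] block[OF that(1) _ that(2)] by (meson not_le)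
  \<comment> \<open>For \<open>x < 3\<close> the third annulus is a block annulus. Otherwise there
    are at least four annuli, so that level 3 has a 4-cycle class as well.\<close>
  have "\<exists>t. c 1 t \<in> inward 1 \<and> c 1 (t + 1) \<in> inward 1"
  proof (cases "x < 3")
    case True
    then obtain P where "four_cycle_class G pos crv C 2 P"
      "\<forall>e\<in>rungs G C 3. \<exists>F\<in>P. attached G pos crv C 3 e F"
      using block[of 2] n by auto
    then show ?thesis using adjacent_inner_ends[OF n] by blast
  next
    case False
    then have n3: "3 < ?n" using assms(3) by simp
    obtain P where "four_cycle_class G pos crv C 2 P" using four_class[of 2] n by auto
    moreover obtain P' where "four_cycle_class G pos crv C 3 P'" using four_class[of 3] n3 by auto
    ultimately show ?thesis using adjacent_inner_ends[OF n] n3 by blast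
  qed
  then obtain t where t: "c 1 t \<in> inward 1" "c 1 (t + 1) \<in> inward 1" by blast
  obtain L0 where L0: "spanning_circuit 0 L0" using spanning_circuit_0 by blast
  have "1 \<le> ?n" using n by simp
  then have first: "\<exists>L. spanning_circuit 1 L" using first_step t L0 by blast
  have inner: "\<exists>L. spanning_circuit k L" if "1 \<le> k" "k < ?n" for k
    using that
  proof (induction k rule: nat_induct_at_least)
    case base
    show ?case by (rule first)
  next
    case (Suc k)
    then obtain L where L: "spanning_circuit (Suc k - 1) L" by auto
    have k: "1 \<le> Suc k" "2 \<le> Suc k" using Suc by auto
    \<comment> \<open>The step at level \<open>Suc k\<close> depends on the type of the annulus
      outside it, so block steps already begin when \<open>Suc k\<close> equals
      \<open>x\<close>.\<close>
    show ?case
    proof (cases "Suc k + 1 \<le> x")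
      case True
      then show ?thesis using ring[OF k(2) True] ring_step[OF _ k(1) Suc.prems _ L] by blast
    next
      case False
      then show ?thesis using block[OF k(2) _ Suc.prems] block_step[OF _ k(1) Suc.prems _ L] by auto
    qed
  qed
  have n': "2 \<le> ?n - 1" "x < ?n - 1 + 1" "?n - 1 < ?n" "?n - 1 + 1 = ?n" "2 \<le> ?n" "1 \<le> ?n - 1"
    using n assms(3) by auto
  obtain L where L: "spanning_circuit (?n - 1) L" using inner[OF n'(6,3)] by blast
  obtain P where P: "four_cycle_class G pos crv C (?n - 1) P"
    "\<forall>e\<in>rungs G C ?n. \<exists>F\<in>P. attached G pos crv C ?n e F"
    using block[OF n'(1-3)] unfolding n'(4) by blast
  show ?thesis using last_step[OF n'(5) P L] hamiltonian_if_spanning by blast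
qed

end
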